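(* Let $1<\alpha<2$, $0\le r\le 1$, and let $\beta\in[\alpha-1,1]$ be determined by $r=\frac{\sin(\pi\beta)}{\sin(\pi(\alpha-\beta))+\sin(\pi\beta)}$. For $f\in L^2_{\omega^{(\beta,\alpha-\beta)}}(0,1)$ and $0<K_m\le K(x)\le K_M$ on $(0,1)$ (with $K_m,K_M$ constants), there exists a unique solution $u\in L^2_{\omega^{(-(\alpha-\beta),-\beta)}}(0,1)$ to $$-D\Big[K(x)\big(r\,{}_0I_x^{2-\alpha}+(1-r)\,{}_xI_1^{2-\alpha}\big)Du(x)\Big]=f(x),\quad x\in(0,1),\qquad u(0)=u(1)=0.$$
   Context: Weights and spaces: $\omega^{(a,b)}(x)=(1-x)^a x^b$ on $(0,1)$; $\|g\|_\omega=(\int_0^1\omega g^2dx)^{1/2}$, $L^2_\omega(0,1)=\{g:\|g\|_\omega<\infty\}$. Fractional integrals for $0<\sigma<1$: ${}_0I_x^\sigma w(x)=\frac1{\Gamma(\sigma)}\int_0^x w(s)(x-s)^{\sigma-1}ds$ and ${}_xI_1^\sigma w(x)=\frac1{\Gamma(\sigma)}\int_x^1 w(s)(s-x)^{\sigma-1}ds$. $D$ is the first derivative. Put $L_r^\alpha u=-\big(r\,{}_0I_x^{2-\alpha}+(1-r)\,{}_xI_1^{2-\alpha}\big)Du$. Jacobi polynomials on $(0,1)$: $G_n^{(a,b)}(x)=P_n^{(a,b)}(2x-1)$, with $P_n^{(a,b)}$ the standard Jacobi polynomials on $[-1,1]$ (orthogonal for $(1-x)^a(1+x)^b$). Sense of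 solution: every $u\in L^2_{\omega^{(-(\alpha-\beta),-\beta)}}(0,1)$ has a unique expansion $u=\omega^{(\alpha-\beta,\beta)}\sum_{j\ge0}c_jG_j^{(\alpha-\beta,\beta)}$ converging in that space. With $u_N=\omega^{(\alpha-\beta,\beta)}\sum_{j=0}^N c_jG_j^{(\alpha-\beta,\beta)}$, $L_r^\alpha u$ is the limit of $L_r^\alpha u_N$ in $L^2_{\omega^{(\beta-1,\alpha-\beta-1)}}(0,1)$ when this limit exists; the homogeneous boundary conditions are understood as those carried by the truncations $u_N$ (each vanishing at $0$ and $1$). The differential equation is understood in its integrated form: for some constant $A$, $L_r^\alpha u(x)=\frac1{K(x)}\int_0^x f(y)\,dy-\frac{A}{K(x)}$ for a.e. $x\in(0,1)$.
   Formalization: K is taken measurable; when f is not integrable at 0 (possible only for r=1, e.g. f=1/(x(1-ln x)), where the integral of f from 0 to x is undefined), the integrated equation uses lower limit 1/2 instead of 0, which only shifts the constant A. *)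

theory Defs
  imports "HOL-Analysis.Analysis"
begin

abbreviation unit_measure :: "real measure" where
  "unit_measure \<equiv> lebesgue_on {0<..<1}"

definition weight :: "real \<Rightarrow> real \<Rightarrow> real \<Rightarrow> real" where
  "weight a b x = (1 - x) powr a * x powr b"

definition L2w :: "(real \<Rightarrow> real) \<Rightarrow> (real \<Rightarrow> real) set" where
  "L2w \<omega> = {g. g \<in> borel_measurable unit_measure \<and> integrable unit_measure (\<lambda>x. \<omega> x * (g x)\<^sup>2)}"

definition norm_w :: "(real \<Rightarrow> real) \<Rightarrow> (real \<Rightarrow> real) \<Rightarrow> real" where
  "norm_w \<omega> g = sqrt (LINT x|unit_measure. \<omega> x * (g x)\<^sup>2)"

text \<open>
  Membership of all functions in the space is part of convergence: the Bochner integral of a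
  non-integrable function is \<open>0\<close>, so \<^const>\<open>norm_w\<close> alone is meaningless outside \<^const>\<open>L2w\<close>.
\<close>

definition tendsto_L2w :: "(real \<Rightarrow> real) \<Rightarrow> (nat \<Rightarrow> real \<Rightarrow> real) \<Rightarrow> (real \<Rightarrow> real) \<Rightarrow> bool" where
  "tendsto_L2w \<omega> h g \<longleftrightarrow> (\<forall>N. h N \<in> L2w \<omega>) \<and> g \<in> L2w \<omega> \<and>
     (\<lambda>N. norm_w \<omega> (\<lambda>x. h N x - g x)) \<longlonglongrightarrow> 0"

definition frac_int_left :: "real \<Rightarrow> (real \<Rightarrow> real) \<Rightarrow> real \<Rightarrow> real" where
  "frac_int_left \<sigma> w x =
     1 / Gamma \<sigma> * (LINT s|lebesgue_on {0<..<x}. w s * (x - s) powr (\<sigma> - 1))"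

definition frac_int_right :: "real \<Rightarrow> (real \<Rightarrow> real) \<Rightarrow> real \<Rightarrow> real" where
  "frac_int_right \<sigma> w x =
     1 / Gamma \<sigma> * (LINT s|lebesgue_on {x<..<1}. w s * (s - x) powr (\<sigma> - 1))"

text \<open>
  The operator \<open>L\<^sub>r\<^sup>\<alpha>\<close> on functions that are differentiable on \<open>(0,1)\<close>; it is extended to
  less regular functions in \<open>has_frac_flux\<close> below.
\<close>

definition frac_flux :: "real \<Rightarrow> real \<Rightarrow> (real \<Rightarrow> real) \<Rightarrow> real \<Rightarrow> real" where
  "frac_flux \<alpha> r u x =
     - (r * frac_int_left (2 - \<alpha>) (deriv u) x + (1 - r) * frac_int_right (2 - \<alpha>) (deriv u) x)"

text \<open>
  The standard Jacobi polynomial in the explicit form of Szego (4.3.2), with the normalization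
  \<open>P\<^sub>n(1) = (n + a) gchoose n\<close>; orthogonal on \<open>[-1,1]\<close> for the weight \<open>(1 - x)\<^sup>a (1 + x)\<^sup>b\<close>.
\<close>

definition jacobi_P :: "nat \<Rightarrow> real \<Rightarrow> real \<Rightarrow> real \<Rightarrow> real" where
  "jacobi_P n a b x =
     (\<Sum>k\<le>n. ((real n + a) gchoose (n - k)) * ((real n + b) gchoose k) *
        ((x - 1) / 2) ^ k * ((x + 1) / 2) ^ (n - k))"

definition jacobi_G :: "nat \<Rightarrow> real \<Rightarrow> real \<Rightarrow> real \<Rightarrow> real" where
  "jacobi_G n a b x = jacobi_P n a b (2 * x - 1)"

definition truncation :: "real \<Rightarrow> real \<Rightarrow> (nat \<Rightarrow> real) \<Rightarrow> nat \<Rightarrow> real \<Rightarrow> real" where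
  "truncation \<alpha> \<beta> c N x =
     weight (\<alpha> - \<beta>) \<beta> x * (\<Sum>j\<le>N. c j * jacobi_G j (\<alpha> - \<beta>) \<beta> x)"

definition jacobi_expansion :: "real \<Rightarrow> real \<Rightarrow> (real \<Rightarrow> real) \<Rightarrow> (nat \<Rightarrow> real) \<Rightarrow> bool" where
  "jacobi_expansion \<alpha> \<beta> u c \<longleftrightarrow>
     tendsto_L2w (weight (- (\<alpha> - \<beta>)) (- \<beta>)) (truncation \<alpha> \<beta> c) u"

text \<open>
  \<open>L\<^sub>r\<^sup>\<alpha> u\<close> exists and equals \<open>g\<close>, where \<open>c\<close> is the coefficient sequence of \<open>u\<close>.
\<close>

definition has_frac_flux ::
    "real \<Rightarrow> real \<Rightarrow> real \<Rightarrow> (nat \<Rightarrow> real) \<Rightarrow> (real \<Rightarrow> real) \<Rightarrow> bool" where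
  "has_frac_flux \<alpha> \<beta> r c g \<longleftrightarrow>
     tendsto_L2w (weight (\<beta> - 1) (\<alpha> - \<beta> - 1)) (\<lambda>N. frac_flux \<alpha> r (truncation \<alpha> \<beta> c N)) g"

text \<open>
  \<open>\<integral>\<^sub>0\<^sup>x f\<close> whenever \<open>f\<close> is integrable at \<open>0\<close>. For \<open>r = 1\<close>, that is \<open>\<beta> = \<alpha> - 1\<close>, the data space has
  weight \<open>(1 - x)\<^sup>\<beta> x\<close>, and it contains functions such as \<open>1 / (x (1 - ln x))\<close> that are not integrable
  at \<open>0\<close>. For these the lower limit is moved to \<open>1/2\<close>; a change of the lower limit only changes the
  free constant \<open>A\<close> in the integrated equation.
\<close>

definition primitive :: "(real \<Rightarrow> real) \<Rightarrow> real \<Rightarrow> real" where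
  "primitive f x =
     (let a = (if set_integrable lebesgue {0<..<1/2} f then 0 else 1/2 :: real)
      in LINT y=a..x|lebesgue. f y)"

definition is_solution ::
    "real \<Rightarrow> real \<Rightarrow> real \<Rightarrow> (real \<Rightarrow> real) \<Rightarrow> (real \<Rightarrow> real) \<Rightarrow> (real \<Rightarrow> real) \<Rightarrow> bool" where
  "is_solution \<alpha> \<beta> r K f u \<longleftrightarrow>
     u \<in> L2w (weight (- (\<alpha> - \<beta>)) (- \<beta>)) \<and>
     (\<exists>c g A. jacobi_expansion \<alpha> \<beta> u c \<and>
        (\<forall>N. truncation \<alpha> \<beta> c N 0 = 0 \<and> truncation \<alpha> \<beta> c N 1 = 0) \<and>
        has_frac_flux \<alpha> \<beta> r c g \<and>
        (AE x in unit_measure. g x = 1 / K x * primitive f x - A / K x))"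

end

theory Submission
  imports Defs
begin

text \<open>
Put \<open>a = \<alpha> - \<beta>\<close> and \<open>b = \<beta>\<close>, so that \<open>0 < a \<le> 1\<close>, \<open>0 < b \<le> 1\<close> and \<open>a + b = \<alpha>\<close>. If \<open>u\<close> is \<open>weight a b\<close>
times a polynomial, then \<open>u'\<close> is \<open>weight (a - 1) (b - 1)\<close> times a polynomial \<open>q\<close>, and the flux of \<open>u\<close> is
\<open>- T q / \<Gamma>(2 - \<alpha>)\<close>. Here \<open>T q\<close> is the integral of \<open>q\<close> against \<open>weight (a - 1) (b - 1)\<close> and the kernel that
equals \<open>r (x - s)\<close> to the power \<open>1 - \<alpha>\<close> for \<open>s < x\<close> and \<open>(1 - r) (s - x)\<close> to the power \<open>1 - \<alpha>\<close> for \<open>s > x\<close>.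
Everything follows from three properties of \<open>T\<close>.

First, \<open>T 1\<close> is constant. The derivatives of the contributions of \<open>s < x\<close> and of \<open>s > x\<close> are both multiples of
\<open>weight (- b) (- a)\<close>, and the equation that ties \<open>r\<close> to \<open>\<beta>\<close> says, by the reflection formula of the Gamma
function, that the two multiples cancel (\<open>kernel_constants_balance\<close>, \<open>kernel_integral_constant\<close>).

Second, \<open>T\<close> preserves the degree of polynomials and multiplies the leading coefficient of a polynomial of degree
\<open>n\<close> by a positive number of order \<open>n\<close> to the power \<open>\<alpha> - 2\<close> (\<open>frac_op_poly\<close>). Indeed the \<open>x\<close>-derivative of
\<open>x - s\<close> times the kernel is \<open>2 - \<alpha>\<close> times the kernel, so that \<open>T\<close> of \<open>s q(s)\<close> is
\<open>x T q - (2 - \<alpha>) \<integral>\<^sub>0\<^sup>x T q\<close> up to a constant.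

Third, the adjoint of \<open>T\<close> is the operator of the same kind with \<open>a\<close>, \<open>b\<close> exchanged and \<open>1 - r\<close> in place of \<open>r\<close>
(\<open>frac_op_adjoint\<close>), for which the parameters satisfy the same equation. Hence the adjoint also preserves degrees,
and \<open>T\<close> carries a polynomial that is orthogonal to all lower degrees for \<open>weight (a - 1) (b - 1)\<close> to one that is
orthogonal to all lower degrees for \<open>weight (b - 1) (a - 1)\<close>.

Let \<open>u\<^sub>j\<close> be \<open>weight a b\<close> times the \<open>j\<close>-th Jacobi polynomial. An integration by parts shows that the polynomial
factor of \<open>u\<^sub>j'\<close>, of degree \<open>j + 1\<close>, is orthogonal to lower degrees. So the fluxes of the \<open>u\<^sub>j\<close>, together with the
constant \<open>1\<close>, are orthogonal polynomials of every degree in the space of fluxes, and they are complete there since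
polynomials are (\<open>poly_complete_ljac\<close>). The derivative gains a factor \<open>j\<close> and \<open>T\<close> loses only \<open>j\<close> to the power
\<open>2 - \<alpha> < 1\<close>, so the norm of the flux of \<open>u\<^sub>j\<close> dominates that of \<open>u\<^sub>j\<close> (\<open>flux_basis_norm_lower_bound\<close>).
Consequently a function \<open>g\<close> of the flux space is the flux of some \<open>u\<close> if and only if its weighted mean vanishes; its
expansion then determines the coefficients of \<open>u\<close>, and the series for \<open>u\<close> converges by the theorem of Riesz and
Fischer (\<open>flux_exists\<close>, \<open>flux_coefficients\<close>, \<open>jacobi_expansion_exists\<close>).

For \<open>g = (F - A) / K\<close> with \<open>F\<close> the primitive of \<open>f\<close>, the vanishing of the mean is a linear equation for the constant
\<open>A\<close>, with the nonzero coefficient \<open>\<integral> weight (b - 1) (a - 1) / K\<close>. So \<open>A\<close>, then \<open>g\<close>, then the coefficients, and finally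
\<open>u\<close> exist and are unique. That \<open>F\<close> lies in the flux space is a weighted Cauchy-Schwarz estimate
(\<open>primitive_sq_int\<close>).
\<close>

section \<open>Square-integrable functions and orthogonal series\<close>

definition sq_int :: "'a measure \<Rightarrow> ('a \<Rightarrow> real) set" where
  "sq_int M = {g. g \<in> borel_measurable M \<and> integrable M (\<lambda>x. (g x)\<^sup>2)}"

lemma sq_int_measurable: "g \<in> sq_int M \<Longrightarrow> g \<in> borel_measurable M"
  and sq_int_integrable: "g \<in> sq_int M \<Longrightarrow> integrable M (\<lambda>x. (g x)\<^sup>2)"
  by (auto simp: sq_int_def)

lemma sq_int_mult:
  assumes "f \<in> sq_int M" "g \<in> sq_int M"
  shows "integrable M (\<lambda>x. f x * g x)"
proof (rule Bochner_Integration.integrable_bound)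
  show "integrable M (\<lambda>x. (f x)\<^sup>2 + (g x)\<^sup>2)"
    using assms by (simp add: sq_int_def)
  show "(\<lambda>x. f x * g x) \<in> borel_measurable M"
    using assms by (auto simp: sq_int_def)
  have "\<bar>a * b\<bar> \<le> a\<^sup>2 + b\<^sup>2" for a b :: real
    using sum_squares_bound[of a b] sum_squares_bound[of a "-b"] by (simp add: abs_if)
  then show "AE x in M. norm (f x * g x) \<le> norm ((f x)\<^sup>2 + (g x)\<^sup>2)"
    by (simp add: abs_mult)
qed

lemma sq_int_add:
  assumes "f \<in> sq_int M" "g \<in> sq_int M"
  shows "(\<lambda>x. f x + g x) \<in> sq_int M"
  using assms sq_int_mult[OF assms] by (auto simp: sq_int_def power2_sum mult.assoc)

lemma sq_int_cmult: "f \<in> sq_int M \<Longrightarrow> (\<lambda>x. c * f x) \<in> sq_int M"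
  by (auto simp: sq_int_def power_mult_distrib)

lemma sq_int_diff:
  assumes "f \<in> sq_int M" "g \<in> sq_int M"
  shows "(\<lambda>x. f x - g x) \<in> sq_int M"
  using sq_int_add[OF assms(1) sq_int_cmult[OF assms(2), of "-1"]] by simp

lemma sq_int_sum:
  "(\<And>i. i \<in> I \<Longrightarrow> f i \<in> sq_int M) \<Longrightarrow> (\<lambda>x. \<Sum>i\<in>I. f i x) \<in> sq_int M"
proof (induction I rule: infinite_finite_induct)
  case (insert i I)
  then show ?case by (simp add: sq_int_add)
qed (auto simp: sq_int_def)

lemma integral_square_diff:
  assumes "f \<in> sq_int M" "g \<in> sq_int M"
  shows "(LINT x|M. (f x - t * g x)\<^sup>2) =
    (LINT x|M. (f x)\<^sup>2) - 2 * t * (LINT x|M. f x * g x) + t\<^sup>2 * (LINT x|M. (g x)\<^sup>2)"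
proof -
  have "(LINT x|M. (f x - t * g x)\<^sup>2) =
      (LINT x|M. (f x)\<^sup>2 - (2 * t) * (f x * g x) + t\<^sup>2 * (g x)\<^sup>2)"
    by (intro Bochner_Integration.integral_cong) (auto simp: power2_diff power_mult_distrib)
  also have "\<dots> = (LINT x|M. (f x)\<^sup>2) - 2 * t * (LINT x|M. f x * g x) + t\<^sup>2 * (LINT x|M. (g x)\<^sup>2)"
    using assms sq_int_mult[OF assms] by (simp add: sq_int_def)
  finally show ?thesis .
qed

text \<open>
The quadratic \<open>t \<mapsto> \<integral> (f - t g)\<^sup>2\<close> is nonnegative; evaluate it at its minimum, or at a large multiple of the inner
product when it is affine.
\<close>

lemma Cauchy_Schwarz_integral:
  assumes "f \<in> sq_int M" "g \<in> sq_int M"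
  shows "(LINT x|M. f x * g x)\<^sup>2 \<le> (LINT x|M. (f x)\<^sup>2) * (LINT x|M. (g x)\<^sup>2)"
proof -
  define F G P where "F = (LINT x|M. (f x)\<^sup>2)" and "G = (LINT x|M. (g x)\<^sup>2)"
    and "P = (LINT x|M. f x * g x)"
  have pos: "0 \<le> F - 2 * t * P + t\<^sup>2 * G" for t
    using integral_square_diff[OF assms, of t]
      Bochner_Integration.integral_nonneg[of M "\<lambda>x. (f x - t * g x)\<^sup>2"]
    by (simp add: F_def G_def P_def)
  have "P\<^sup>2 \<le> F * G"
  proof (cases "G = 0")
    case True
    have "P = 0"
      using pos[of "(F + 1) / (2 * P)"] True by (cases "P = 0") auto
    then show ?thesis using True by simp
  next
    case False
    then have "G > 0" unfolding G_def by (simp add: less_le)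
    then show ?thesis using pos[of "P / G"]
      by (simp add: field_simps power2_eq_square)
  qed
  then show ?thesis by (simp add: F_def G_def P_def)
qed

lemma L2_limit_inner:
  assumes "\<And>n. h n \<in> sq_int M" "g \<in> sq_int M" "\<phi> \<in> sq_int M"
    and lim: "(\<lambda>n. LINT x|M. (h n x - g x)\<^sup>2) \<longlonglongrightarrow> 0"
  shows "(\<lambda>n. LINT x|M. h n x * \<phi> x) \<longlonglongrightarrow> (LINT x|M. g x * \<phi> x)"
proof -
  have "(\<lambda>n. (LINT x|M. (h n x - g x) * \<phi> x)\<^sup>2) \<longlonglongrightarrow> 0"
  proof (rule tendsto_sandwich[OF _ _ tendsto_const])
    show "(\<lambda>n. (LINT x|M. (h n x - g x)\<^sup>2) * (LINT x|M. (\<phi> x)\<^sup>2)) \<longlonglongrightarrow> 0"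
      using tendsto_mult_right[OF lim, of "LINT x|M. (\<phi> x)\<^sup>2"] by simp
  qed (auto intro!: always_eventually Cauchy_Schwarz_integral sq_int_diff assms)
  then have "(\<lambda>n. sqrt ((LINT x|M. (h n x - g x) * \<phi> x)\<^sup>2)) \<longlonglongrightarrow> sqrt 0"
    by (rule tendsto_real_sqrt)
  then have "(\<lambda>n. LINT x|M. (h n x - g x) * \<phi> x) \<longlonglongrightarrow> 0"
    by (simp add: tendsto_rabs_zero_iff)
  moreover have "(LINT x|M. (h n x - g x) * \<phi> x) = (LINT x|M. h n x * \<phi> x) - (LINT x|M. g x * \<phi> x)" for n
    using sq_int_mult[OF assms(1)[of n] assms(3)] sq_int_mult[OF assms(2,3)]
    by (simp add: left_diff_distrib)
  ultimately show ?thesis by (simp add: LIM_zero_iff)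
qed

lemma integral_square_eq_0_AE:
  assumes "g \<in> sq_int M" "(LINT x|M. (g x)\<^sup>2) \<le> 0"
  shows "AE x in M. g x = 0"
proof -
  have "(LINT x|M. (g x)\<^sup>2) = 0" using assms(2) by (simp add: order_antisym)
  then show ?thesis
    using integral_nonneg_eq_0_iff_AE[OF sq_int_integrable[OF assms(1)]] by simp
qed

lemma L2_limit_unique:
  assumes "\<And>n. h n \<in> sq_int M" "g \<in> sq_int M" "g' \<in> sq_int M"
    and "(\<lambda>n. LINT x|M. (h n x - g x)\<^sup>2) \<longlonglongrightarrow> 0"
    and "(\<lambda>n. LINT x|M. (h n x - g' x)\<^sup>2) \<longlonglongrightarrow> 0"
  shows "AE x in M. g x = g' x"
proof -
  have d: "(\<lambda>x. g x - g' x) \<in> sq_int M" using assms by (simp add: sq_int_diff)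
  have "(LINT x|M. g x * (g x - g' x)) = (LINT x|M. g' x * (g x - g' x))"
    using L2_limit_inner[OF assms(1,2) d assms(4)] L2_limit_inner[OF assms(1,3) d assms(5)]
    by (rule LIMSEQ_unique)
  then have "(LINT x|M. (g x - g' x)\<^sup>2) = 0"
    using sq_int_mult[OF assms(2) d] sq_int_mult[OF assms(3) d]
    by (simp add: power2_eq_square left_diff_distrib)
  then show ?thesis using integral_square_eq_0_AE[OF d] by simp
qed

text \<open>
A subsequence with squared increments below \<open>16\<^sup>-\<^sup>k\<close> has \<open>\<Sum> 4\<^sup>k d\<^sub>k\<^sup>2\<close> integrable, so its increments are almost everywhere
bounded by a geometric sequence and it converges pointwise. The factor \<open>4\<^sup>k\<close> makes the argument work on measure spaces
of infinite measure as well. Fatou's lemma turns the Cauchy condition into convergence to the pointwise limit.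
\<close>

theorem L2_complete:
  assumes h: "\<And>n. h n \<in> sq_int M"
    and cauchy: "\<And>e. 0 < e \<Longrightarrow> \<exists>N. \<forall>m\<ge>N. \<forall>n\<ge>N. (LINT x|M. (h m x - h n x)\<^sup>2) < e"
  shows "\<exists>g\<in>sq_int M. (\<lambda>n. LINT x|M. (h n x - g x)\<^sup>2) \<longlonglongrightarrow> 0"
proof -
  note [measurable] = sq_int_measurable[OF h]
  have "\<exists>N. \<forall>m\<ge>N. \<forall>n\<ge>N. (LINT x|M. (h m x - h n x)\<^sup>2) < (1/16)^k" for k
    using cauchy[of "(1/16)^k"] by simp
  then obtain N where N: "\<And>k m n. N k \<le> m \<Longrightarrow> N k \<le> n \<Longrightarrow>
      (LINT x|M. (h m x - h n x)\<^sup>2) < (1/16)^k" by metis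
  \<comment> \<open>Partial sums give a monotone choice of indices with \<open>N j \<le> s k\<close> for \<open>j \<le> k\<close>.\<close>
  define s where "s k = (\<Sum>j\<le>k. N j)" for k
  have s: "N j \<le> s k" if "j \<le> k" for j k
    unfolding s_def using that by (intro member_le_sum) auto
  define d where "d k x = h (s (Suc k)) x - h (s k) x" for k x
  have [measurable]: "d k \<in> borel_measurable M" for k unfolding d_def by measurable
  have sqd: "(\<lambda>x. h m x - h n x) \<in> sq_int M" for m n by (intro sq_int_diff h)
  have dk: "(\<integral>\<^sup>+x. ennreal (4^k * (d k x)\<^sup>2) \<partial>M) \<le> ennreal ((1/4)^k)" for k
  proof -
    have "(\<integral>\<^sup>+x. ennreal (4^k * (d k x)\<^sup>2) \<partial>M) = ennreal (LINT x|M. 4^k * (d k x)\<^sup>2)"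
      using sq_int_integrable[OF sqd] unfolding d_def
      by (intro nn_integral_eq_integral) auto
    also have "(LINT x|M. 4^k * (d k x)\<^sup>2) \<le> 4^k * (1/16)^k"
      using N[of k "s (Suc k)" "s k"] s[of k k] s[of k "Suc k"] unfolding d_def by simp
    also have "4^k * (1/16)^k = ((1/4)^k :: real)" by (simp flip: power_mult_distrib)
    finally show ?thesis by (simp add: ennreal_leI)
  qed
  have "(\<integral>\<^sup>+x. (\<Sum>k. ennreal (4^k * (d k x)\<^sup>2)) \<partial>M) = (\<Sum>k. \<integral>\<^sup>+x. ennreal (4^k * (d k x)\<^sup>2) \<partial>M)"
    by (intro nn_integral_suminf) auto
  also have "\<dots> \<le> (\<Sum>k. ennreal ((1/4)^k))" by (intro suminf_le dk) auto
  also have "\<dots> < \<infinity>" by (subst suminf_ennreal2) (auto simp: summable_geometric)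
  finally have "AE x in M. (\<Sum>k. ennreal (4^k * (d k x)\<^sup>2)) \<noteq> \<infinity>"
    by (intro nn_integral_PInf_AE) auto
  then have conv: "AE x in M. convergent (\<lambda>k. h (s k) x)"
  proof eventually_elim
    case (elim x)
    define S where "S = enn2real (\<Sum>k. ennreal (4^k * (d k x)\<^sup>2))"
    have S: "(\<Sum>k. ennreal (4^k * (d k x)\<^sup>2)) = ennreal S" "0 \<le> S"
      using elim unfolding S_def by (simp_all only: infinity_ennreal_def ennreal_enn2real_if enn2real_nonneg if_False)
    have pow4: "((2::real)^k)\<^sup>2 = 4^k" for k
      by (simp add: power2_eq_square flip: power_mult_distrib)
    have dS: "4^k * (d k x)\<^sup>2 \<le> S" for k
    proof -
      have "(\<Sum>j<Suc k. ennreal (4^j * (d j x)\<^sup>2)) \<le> ennreal S"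
        unfolding S(1)[symmetric] by (intro sum_le_suminf) auto
      moreover have "ennreal (4^k * (d k x)\<^sup>2) \<le> (\<Sum>j<Suc k. ennreal (4^j * (d j x)\<^sup>2))"
        by (rule member_le_sum) auto
      ultimately have "ennreal (4^k * (d k x)\<^sup>2) \<le> ennreal S" by (rule order_trans[rotated])
      then show ?thesis by (simp only: ennreal_le_iff[OF S(2)])
    qed
    have "\<bar>d k x\<bar> \<le> sqrt S * (1/2)^k" for k
    proof -
      have "(2^k * \<bar>d k x\<bar>)\<^sup>2 \<le> S"
        using dS[of k] pow4[of k] by (simp add: power_mult_distrib)
      then have "2^k * \<bar>d k x\<bar> \<le> sqrt S" by (rule real_le_rsqrt)
      then show ?thesis by (simp add: field_simps)
    qed
    then have "\<exists>N. \<forall>k\<ge>N. \<bar>d k x\<bar> \<le> sqrt S * (1/2)^k" by blast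
    moreover have "summable (\<lambda>k. sqrt S * (1/2)^k)"
      by (intro summable_mult summable_geometric) simp
    ultimately have "summable (\<lambda>k. \<bar>d k x\<bar>)"
      by (rule summable_rabs_comparison_test)
    then have "summable (\<lambda>k. d k x)" by (rule summable_rabs_cancel)
    then have "convergent (\<lambda>n. \<Sum>k<n. d k x)" by (simp add: summable_iff_convergent)
    then have "convergent (\<lambda>n. h (s n) x - h (s 0) x)"
      unfolding d_def by (simp only: sum_lessThan_telescope[of "\<lambda>k. h (s k) x"])
    then have "convergent (\<lambda>n. (h (s n) x - h (s 0) x) + h (s 0) x)"
      by (intro convergent_add convergent_const)
    then show ?case by simp
  qed
  define g where "g x = lim (\<lambda>k. h (s k) x)" for x
  have [measurable]: "g \<in> borel_measurable M" unfolding g_def by measurable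
  have bound: "(\<integral>\<^sup>+x. ennreal ((h n x - g x)\<^sup>2) \<partial>M) \<le> ennreal ((1/16)^K)" if "N K \<le> n" for K n
  proof -
    have "(\<integral>\<^sup>+x. ennreal ((h n x - g x)\<^sup>2) \<partial>M) =
        (\<integral>\<^sup>+x. liminf (\<lambda>k. ennreal ((h n x - h (s k) x)\<^sup>2)) \<partial>M)"
    proof (rule nn_integral_cong_AE)
      show "AE x in M. ennreal ((h n x - g x)\<^sup>2) = liminf (\<lambda>k. ennreal ((h n x - h (s k) x)\<^sup>2))"
        using conv
      proof eventually_elim
        case (elim x)
        then have "(\<lambda>k. h (s k) x) \<longlonglongrightarrow> g x"
          unfolding g_def by (simp add: convergent_LIMSEQ_iff)
        then have "(\<lambda>k. ennreal ((h n x - h (s k) x)\<^sup>2)) \<longlonglongrightarrow> ennreal ((h n x - g x)\<^sup>2)"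
          by (intro tendsto_intros) auto
        then show ?case by (intro lim_imp_Liminf[symmetric]) auto
      qed
    qed
    also have "\<dots> \<le> liminf (\<lambda>k. \<integral>\<^sup>+x. ennreal ((h n x - h (s k) x)\<^sup>2) \<partial>M)"
      by (rule nn_integral_liminf) measurable
    also have "\<dots> \<le> limsup (\<lambda>k. \<integral>\<^sup>+x. ennreal ((h n x - h (s k) x)\<^sup>2) \<partial>M)"
      by (rule Liminf_le_Limsup) simp
    also have "\<dots> \<le> ennreal ((1/16)^K)"
    proof (rule Limsup_bounded)
      show "\<forall>\<^sub>F k in sequentially. (\<integral>\<^sup>+x. ennreal ((h n x - h (s k) x)\<^sup>2) \<partial>M) \<le> ennreal ((1/16)^K)"
        using eventually_ge_at_top[of K]
      proof eventually_elim
        case (elim k)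
        have "(\<integral>\<^sup>+x. ennreal ((h n x - h (s k) x)\<^sup>2) \<partial>M) = ennreal (LINT x|M. (h n x - h (s k) x)\<^sup>2)"
          using sq_int_integrable[OF sqd] by (intro nn_integral_eq_integral) auto
        also have "\<dots> \<le> ennreal ((1/16)^K)"
          using N[OF that s[OF elim]] by (simp add: ennreal_leI)
        finally show ?case .
      qed
    qed
    finally show ?thesis .
  qed
  have diff: "(\<lambda>x. h n x - g x) \<in> sq_int M" if "N K \<le> n" for K n
    using bound[OF that] unfolding sq_int_def
    by (auto intro!: integrableI_bounded simp: order_le_less_trans[OF _ ennreal_less_top])
  have "(\<lambda>x. h (N 0) x - (h (N 0) x - g x)) \<in> sq_int M"
    by (intro sq_int_diff h diff[of 0 "N 0"] order_refl)
  then have g: "g \<in> sq_int M" by simp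
  have "(\<lambda>n. LINT x|M. (h n x - g x)\<^sup>2) \<longlonglongrightarrow> 0"
  proof (rule LIMSEQ_I)
    fix e :: real assume "0 < e"
    then obtain K where K: "(1/16)^K < e" using real_arch_pow_inv[of e "1/16"] by auto
    show "\<exists>no. \<forall>n\<ge>no. norm ((LINT x|M. (h n x - g x)\<^sup>2) - 0) < e"
    proof (intro exI[of _ "N K"] allI impI)
      fix n assume n: "N K \<le> n"
      have "ennreal (LINT x|M. (h n x - g x)\<^sup>2) \<le> ennreal ((1/16)^K)"
        using bound[OF n] sq_int_integrable[OF diff[OF n]] by (subst nn_integral_eq_integral[symmetric]) auto
      then show "norm ((LINT x|M. (h n x - g x)\<^sup>2) - 0) < e"
        using K by simp
    qed
  qed
  with g show ?thesis by blast
qed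

definition orthogonal_system :: "'a measure \<Rightarrow> (nat \<Rightarrow> 'a \<Rightarrow> real) \<Rightarrow> bool" where
  "orthogonal_system M e \<longleftrightarrow> (\<forall>n. e n \<in> sq_int M) \<and>
     (\<forall>m n. m \<noteq> n \<longrightarrow> (LINT x|M. e m x * e n x) = 0)"

lemma orthogonal_system_sum_inner:
  assumes "orthogonal_system M e" "finite J"
  shows "(LINT x|M. (\<Sum>j\<in>J. c j * e j x) * e n x) = (if n \<in> J then c n * (LINT x|M. (e n x)\<^sup>2) else 0)"
proof -
  have e: "e j \<in> sq_int M" for j using assms by (auto simp: orthogonal_system_def)
  have "(LINT x|M. (\<Sum>j\<in>J. c j * e j x) * e n x) = (\<Sum>j\<in>J. c j * (LINT x|M. e j x * e n x))"
    using sq_int_mult[OF e e] by (simp add: sum_distrib_right mult.assoc Bochner_Integration.integral_sum)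
  also have "\<dots> = (\<Sum>j\<in>J. if j = n then c n * (LINT x|M. (e n x)\<^sup>2) else 0)"
    using assms by (intro sum.cong) (auto simp: orthogonal_system_def power2_eq_square)
  finally show ?thesis using assms(2) by simp
qed

lemma orthogonal_system_Pythagoras:
  assumes "orthogonal_system M e" "finite J"
  shows "(LINT x|M. (\<Sum>j\<in>J. c j * e j x)\<^sup>2) = (\<Sum>j\<in>J. (c j)\<^sup>2 * (LINT x|M. (e j x)\<^sup>2))"
proof -
  have e: "e j \<in> sq_int M" for j using assms by (auto simp: orthogonal_system_def)
  have s: "(\<lambda>x. \<Sum>j\<in>J. c j * e j x) \<in> sq_int M" by (intro sq_int_sum sq_int_cmult e)
  have "(LINT x|M. (\<Sum>j\<in>J. c j * e j x)\<^sup>2) =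
      (LINT x|M. (\<Sum>n\<in>J. c n * ((\<Sum>j\<in>J. c j * e j x) * e n x)))"
    by (intro Bochner_Integration.integral_cong)
       (simp_all add: power2_eq_square sum_distrib_left mult_ac)
  also have "\<dots> = (\<Sum>n\<in>J. c n * (LINT x|M. (\<Sum>j\<in>J. c j * e j x) * e n x))"
    using sq_int_mult[OF s e] by (simp add: Bochner_Integration.integral_sum)
  also have "\<dots> = (\<Sum>n\<in>J. (c n)\<^sup>2 * (LINT x|M. (e n x)\<^sup>2))"
    by (intro sum.cong) (simp_all add: orthogonal_system_sum_inner[OF assms] power2_eq_square)
  finally show ?thesis .
qed

theorem Riesz_Fischer:
  assumes orth: "orthogonal_system M e"
    and sum: "summable (\<lambda>n. (c n)\<^sup>2 * (LINT x|M. (e n x)\<^sup>2))"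
  shows "\<exists>g\<in>sq_int M. (\<lambda>N. LINT x|M. ((\<Sum>j\<le>N. c j * e j x) - g x)\<^sup>2) \<longlonglongrightarrow> 0"
proof (rule L2_complete)
  have e: "e j \<in> sq_int M" for j using orth by (auto simp: orthogonal_system_def)
  show "(\<lambda>x. \<Sum>j\<le>n. c j * e j x) \<in> sq_int M" for n by (intro sq_int_sum sq_int_cmult e)
  fix r :: real assume "0 < r"
  define a where "a n = (c n)\<^sup>2 * (LINT x|M. (e n x)\<^sup>2)" for n
  have a: "a n \<ge> 0" for n unfolding a_def by simp
  obtain N where N: "\<And>m n. N \<le> m \<Longrightarrow> norm (sum a {m..<n}) < r"
    using sum \<open>0 < r\<close> unfolding summable_Cauchy a_def[symmetric] by blast
  have le: "(LINT x|M. ((\<Sum>j\<le>m. c j * e j x) - (\<Sum>j\<le>n. c j * e j x))\<^sup>2) < r"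
    if "N \<le> n" "n \<le> m" for m n
  proof -
    have "{..m} = {..n} \<union> {Suc n..<Suc m}" using that by auto
    then have "(\<Sum>j\<le>m. c j * e j x) - (\<Sum>j\<le>n. c j * e j x) = (\<Sum>j\<in>{Suc n..<Suc m}. c j * e j x)" for x
      by (simp only: \<open>{..m} = _\<close>, subst sum.union_disjoint) auto
    then have "(LINT x|M. ((\<Sum>j\<le>m. c j * e j x) - (\<Sum>j\<le>n. c j * e j x))\<^sup>2) = sum a {Suc n..<Suc m}"
      using orthogonal_system_Pythagoras[OF orth, of "{Suc n..<Suc m}" c] by (simp add: a_def)
    also have "\<dots> < r" using N[of "Suc n" "Suc m"] that by auto
    finally show ?thesis .
  qed
  show "\<exists>N. \<forall>m\<ge>N. \<forall>n\<ge>N. (LINT x|M. ((\<Sum>j\<le>m. c j * e j x) - (\<Sum>j\<le>n. c j * e j x))\<^sup>2) < r"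
  proof (intro exI[of _ N] allI impI)
    fix m n assume "N \<le> m" "N \<le> n"
    then show "(LINT x|M. ((\<Sum>j\<le>m. c j * e j x) - (\<Sum>j\<le>n. c j * e j x))\<^sup>2) < r"
      using le[of n m] le[of m n] by (cases "n \<le> m") (auto simp: power2_commute)
  qed
qed

lemma Bessel_inequality:
  assumes orth: "orthogonal_system M e" and pos: "\<And>n. (LINT x|M. (e n x)\<^sup>2) > 0"
    and g: "g \<in> sq_int M"
    and c: "\<And>n. c n = (LINT x|M. g x * e n x) / (LINT x|M. (e n x)\<^sup>2)"
  shows "summable (\<lambda>n. (c n)\<^sup>2 * (LINT x|M. (e n x)\<^sup>2))"
proof (rule summableI_nonneg_bounded[where x = "LINT x|M. (g x)\<^sup>2"])
  have e: "e j \<in> sq_int M" for j using orth by (auto simp: orthogonal_system_def)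
  fix n
  define S where "S x = (\<Sum>j<n. c j * e j x)" for x
  have S: "S \<in> sq_int M" unfolding S_def by (intro sq_int_sum sq_int_cmult e)
  have SS: "(LINT x|M. (S x)\<^sup>2) = (\<Sum>j<n. (c j)\<^sup>2 * (LINT x|M. (e j x)\<^sup>2))"
    unfolding S_def by (rule orthogonal_system_Pythagoras[OF orth]) simp
  have "(LINT x|M. g x * S x) = (\<Sum>j<n. c j * (LINT x|M. g x * e j x))"
    using sq_int_mult[OF g e] unfolding S_def
    by (simp add: sum_distrib_left mult.left_commute Bochner_Integration.integral_sum)
  also have "\<dots> = (\<Sum>j<n. (c j)\<^sup>2 * (LINT x|M. (e j x)\<^sup>2))"
    using pos by (intro sum.cong) (auto simp: c power2_eq_square less_imp_neq)
  finally have "(LINT x|M. g x * S x) = (LINT x|M. (S x)\<^sup>2)" by (simp add: SS)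
  moreover have "0 \<le> (LINT x|M. (g x - 1 * S x)\<^sup>2)" by (intro Bochner_Integration.integral_nonneg) auto
  ultimately show "(\<Sum>j<n. (c j)\<^sup>2 * (LINT x|M. (e j x)\<^sup>2)) \<le> (LINT x|M. (g x)\<^sup>2)"
    using integral_square_diff[OF g S, of 1] by (simp only: SS) simp
qed (use pos in \<open>auto intro: less_imp_le\<close>)

text \<open>
By Bessel's inequality the Fourier series converges to some function, which has the same Fourier coefficients as \<open>g\<close>;
completeness says that it is \<open>g\<close>.
\<close>

theorem orthogonal_expansion:
  assumes orth: "orthogonal_system M e" and pos: "\<And>n. (LINT x|M. (e n x)\<^sup>2) > 0"
    and complete: "\<And>\<phi>. \<phi> \<in> sq_int M \<Longrightarrow> (\<And>n. (LINT x|M. \<phi> x * e n x) = 0) \<Longrightarrow> AE x in M. \<phi> x = 0"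
    and g: "g \<in> sq_int M"
    and c: "\<And>n. c n = (LINT x|M. g x * e n x) / (LINT x|M. (e n x)\<^sup>2)"
  shows "(\<lambda>N. LINT x|M. ((\<Sum>j\<le>N. c j * e j x) - g x)\<^sup>2) \<longlonglongrightarrow> 0"
proof -
  have e: "e j \<in> sq_int M" for j using orth by (auto simp: orthogonal_system_def)
  obtain g' where g': "g' \<in> sq_int M"
    and lim: "(\<lambda>N. LINT x|M. ((\<Sum>j\<le>N. c j * e j x) - g' x)\<^sup>2) \<longlonglongrightarrow> 0"
    using Riesz_Fischer[OF orth Bessel_inequality[OF orth pos g c]] by blast
  have "(LINT x|M. g' x * e n x) = (LINT x|M. g x * e n x)" for n
  proof (rule LIMSEQ_unique)
    show "(\<lambda>N. LINT x|M. (\<Sum>j\<le>N. c j * e j x) * e n x) \<longlonglongrightarrow> (LINT x|M. g' x * e n x)"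
      by (intro L2_limit_inner lim e g' sq_int_sum sq_int_cmult)
    have "(LINT x|M. (\<Sum>j\<le>N. c j * e j x) * e n x) = (LINT x|M. g x * e n x)" if "n \<le> N" for N
      using pos[of n] that orthogonal_system_sum_inner[OF orth, of "{..N}" c n] by (simp add: c[of n])
    then show "(\<lambda>N. LINT x|M. (\<Sum>j\<le>N. c j * e j x) * e n x) \<longlonglongrightarrow> (LINT x|M. g x * e n x)"
      by (intro tendsto_eventually eventually_sequentiallyI[of n])
  qed
  then have "(LINT x|M. (g' x - g x) * e n x) = 0" for n
    using sq_int_mult[OF g e] sq_int_mult[OF g' e] by (simp add: left_diff_distrib)
  then have "AE x in M. g' x - g x = 0" by (intro complete sq_int_diff g g')
  then have "(LINT x|M. ((\<Sum>j\<le>N. c j * e j x) - g' x)\<^sup>2) = (LINT x|M. ((\<Sum>j\<le>N. c j * e j x) - g x)\<^sup>2)" for N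
    using sq_int_measurable[OF g] sq_int_measurable[OF g'] sq_int_measurable[OF e]
    by (intro integral_cong_AE) auto
  then show ?thesis using lim by simp
qed

section \<open>Jacobi measures and completeness of the polynomials\<close>

lemma poly_borel [measurable]: "poly (P :: real poly) \<in> borel_measurable borel"
  by (intro borel_measurable_continuous_onI continuous_intros)

lemma Int_stable_atMost: "Int_stable (range atMost :: real set set)"
proof (rule Int_stableI)
  fix A B :: "real set" assume "A \<in> range atMost" "B \<in> range atMost"
  then obtain c d where "A = {..c}" "B = {..d}" by auto
  then have "A \<inter> B = {..min c d}" by auto
  then show "A \<inter> B \<in> range atMost" by blast
qed

text \<open>
By Weierstrass, \<open>g\<close> is orthogonal to continuous functions; those approximate indicators of half lines, and half
lines generate the Borel sets.
\<close>

lemma integral_eq_0_if_orthogonal_to_poly: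
  fixes g :: "real \<Rightarrow> real"
  assumes sets: "sets M = sets borel" and supp: "AE x in M. x \<in> {0..1}"
    and g: "integrable M g"
    and orth: "\<And>P. (LINT x|M. g x * poly P x) = 0"
  shows "AE x in M. g x = 0"
proof (rule density_unique_real[OF g, of "\<lambda>_. 0"])
  note [measurable_cong] = sets
  have gm[measurable]: "g \<in> borel_measurable M" using g by auto
  have cont: "(LINT x|M. g x * \<phi> x) = 0" if \<phi>: "continuous_on UNIV \<phi>" for \<phi> :: "real \<Rightarrow> real"
  proof -
    have c01: "continuous_on {0..1} \<phi>" using \<phi> continuous_on_subset by blast
    obtain B where B: "\<And>x. x \<in> {0..1} \<Longrightarrow> \<bar>\<phi> x\<bar> \<le> B"
      using compact_imp_bounded[OF compact_continuous_image[OF c01 compact_Icc]]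
      by (force simp: bounded_iff)
    have [measurable]: "\<phi> \<in> borel_measurable borel" using \<phi> by (rule borel_measurable_continuous_onI)
    have int\<phi>: "integrable M (\<lambda>x. g x * \<phi> x)"
    proof (rule Bochner_Integration.integrable_bound[of _ "\<lambda>x. B * g x"])
      show "AE x in M. norm (g x * \<phi> x) \<le> norm (B * g x)"
        using supp
      proof eventually_elim
        case (elim x)
        then have "\<bar>\<phi> x\<bar> \<le> \<bar>B\<bar>" using B[of x] by linarith
        then have "\<bar>g x\<bar> * \<bar>\<phi> x\<bar> \<le> \<bar>g x\<bar> * \<bar>B\<bar>" by (intro mult_left_mono) auto
        then show ?case by (simp add: abs_mult mult.commute)
      qed
    qed (use g in auto)
    have "\<bar>LINT x|M. g x * \<phi> x\<bar> \<le> e * (LINT x|M. \<bar>g x\<bar>)" if "e > 0" for e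
    proof -
      obtain n where n: "\<And>x. x \<in> {0..1} \<Longrightarrow> \<bar>\<phi> x - (\<Sum>k\<le>n. \<phi> (k/n) * Bernstein n k x)\<bar> < e"
        using Bernstein_Weierstrass[OF c01 \<open>e > 0\<close>] by blast
      define P where "P = (\<Sum>k\<le>n. smult (\<phi> (k/n) * of_nat (n choose k)) ([:0,1:]^k * [:1,-1:]^(n-k)))"
      have P: "poly P x = (\<Sum>k\<le>n. \<phi> (k/n) * Bernstein n k x)" for x
        by (simp add: P_def poly_sum Bernstein_def algebra_simps)
      have ae: "AE x in M. \<bar>g x * (\<phi> x - poly P x)\<bar> \<le> e * \<bar>g x\<bar>"
        using supp
      proof eventually_elim
        case (elim x)
        then have "\<bar>\<phi> x - poly P x\<bar> \<le> e" using n[of x] by (simp add: P)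
        then have "\<bar>g x\<bar> * \<bar>\<phi> x - poly P x\<bar> \<le> \<bar>g x\<bar> * e" by (intro mult_left_mono) auto
        then show ?case by (simp add: abs_mult mult.commute)
      qed
      have int1: "integrable M (\<lambda>x. g x * (\<phi> x - poly P x))"
        by (rule Bochner_Integration.integrable_bound[of _ "\<lambda>x. e * \<bar>g x\<bar>"])
           (use ae g \<open>e > 0\<close> in \<open>auto\<close>)
      have "integrable M (\<lambda>x. g x * \<phi> x - g x * (\<phi> x - poly P x))"
        using int\<phi> int1 by (rule Bochner_Integration.integrable_diff)
      then have intP: "integrable M (\<lambda>x. g x * poly P x)" by (simp add: algebra_simps)
      have "(LINT x|M. g x * (\<phi> x - poly P x)) = (LINT x|M. g x * \<phi> x)"
        using Bochner_Integration.integral_diff[OF int\<phi> intP] orth[of P] by (simp add: right_diff_distrib)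
      moreover have "\<bar>LINT x|M. g x * (\<phi> x - poly P x)\<bar> \<le> (LINT x|M. \<bar>g x * (\<phi> x - poly P x)\<bar>)"
        by (rule integral_abs_bound)
      moreover have "\<dots> \<le> (LINT x|M. e * \<bar>g x\<bar>)"
        by (rule integral_mono_AE) (use int1 g ae in auto)
      ultimately show ?thesis by simp
    qed
    then have le: "\<bar>LINT x|M. g x * \<phi> x\<bar> \<le> e * (LINT x|M. \<bar>g x\<bar>)" if "e > 0" for e
      using that by blast
    define I X where "I = (LINT x|M. \<bar>g x\<bar>)" and "X = \<bar>LINT x|M. g x * \<phi> x\<bar>"
    have I: "0 \<le> I" by (simp add: I_def)
    have le': "X \<le> e * I" if "e > 0" for e using le[OF that] by (simp only: I_def X_def)
    have "X \<le> 0"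
    proof (rule ccontr)
      assume "\<not> X \<le> 0"
      then have "X \<le> X / (I + 1) * I" using I by (intro le') simp
      also have "\<dots> < X" using I \<open>\<not> X \<le> 0\<close> by (simp add: divide_less_eq)
      finally show False by simp
    qed
    then show ?thesis by (simp add: X_def)
  qed
  have half_line: "(LINT x|M. indicator {..c} x * g x) = 0" for c :: real
  proof (rule LIMSEQ_unique)
    define \<phi> where "\<phi> n x = max 0 (min 1 (1 - real n * (x - c)))" for n x
    have [measurable]: "\<phi> n \<in> borel_measurable borel" for n unfolding \<phi>_def by measurable
    show "(\<lambda>n. LINT x|M. g x * \<phi> n x) \<longlonglongrightarrow> (LINT x|M. indicator {..c} x * g x)"
    proof (rule integral_dominated_convergence[where w = "\<lambda>x. \<bar>g x\<bar>"])
      show "AE x in M. (\<lambda>n. g x * \<phi> n x) \<longlonglongrightarrow> indicator {..c} x * g x"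
      proof (rule AE_I2)
        fix x
        have "(\<lambda>n. \<phi> n x) \<longlonglongrightarrow> indicator {..c} x"
        proof (cases "x \<le> c")
          case True
          then have "\<phi> n x = 1" for n
            using mult_nonneg_nonpos[of "real n" "x - c"] by (simp add: \<phi>_def)
          then show ?thesis using True by simp
        next
          case False
          then obtain N where N: "1 < real N * (x - c)"
            using reals_Archimedean3[of "x - c"] by (auto simp: )
          have "\<phi> n x = 0" if "N \<le> n" for n
          proof -
            have "real N * (x - c) \<le> real n * (x - c)" using that False by (intro mult_right_mono) auto
            then show ?thesis using N by (simp add: \<phi>_def)
          qed
          then show ?thesis using False
            by (intro tendsto_eventually eventually_sequentiallyI[of N]) auto
        qed
        then have "(\<lambda>n. g x * \<phi> n x) \<longlonglongrightarrow> g x * indicator {..c} x" by (rule tendsto_mult_left)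
        then show "(\<lambda>n. g x * \<phi> n x) \<longlonglongrightarrow> indicator {..c} x * g x" by (simp add: mult.commute)
      qed
      have "\<bar>\<phi> n x\<bar> \<le> 1" for n x by (simp add: \<phi>_def)
      then show "AE x in M. norm (g x * \<phi> n x) \<le> \<bar>g x\<bar>" for n
        by (simp add: abs_mult mult_left_le)
    qed (use g in auto)
    have "continuous_on UNIV (\<phi> n)" for n unfolding \<phi>_def by (intro continuous_intros)
    then show "(\<lambda>n. LINT x|M. g x * \<phi> n x) \<longlonglongrightarrow> 0" by (simp add: cont)
  qed
  have int_g: "integrable M (\<lambda>x. indicator A x * g x)" if "A \<in> sets M" for A
    using integrable_mult_indicator[OF that g] by simp
  have whole: "(LINT x|M. g x) = 0" using orth[of 1] by simp
  have cl: "range atMost \<subseteq> Pow (UNIV :: real set)" by simp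
  fix A assume "A \<in> sets M"
  then have "A \<in> sigma_sets UNIV (range atMost)"
    by (simp add: sets borel_eq_atMost)
  then have "A \<in> sets M \<and> (LINT x|M. indicator A x * g x) = 0"
  proof (induction rule: sigma_sets_induct_disjoint[OF Int_stable_atMost cl, consumes 1, case_names basic empty compl union])
    case basic
    then show ?case using half_line by (auto simp: sets)
  next
    case empty
    then show ?case by simp
  next
    case (compl A)
    have "(LINT x|M. indicator (UNIV - A) x * g x) = (LINT x|M. g x - indicator A x * g x)"
      by (intro Bochner_Integration.integral_cong) (auto simp: indicator_def)
    then show ?case using compl int_g[of A] g whole by (auto simp: sets Diff_eq)
  next
    case (union A)
    then have A: "\<And>i. A i \<in> sets M" by auto
    have "set_lebesgue_integral M (\<Union>i. A i) g = (\<Sum>i. set_lebesgue_integral M (A i) g)"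
    proof (rule lebesgue_integral_countable_add[OF A])
      show "\<And>i j. i \<noteq> j \<Longrightarrow> A i \<inter> A j = {}" using union by (auto simp: disjoint_family_on_def)
      show "set_integrable M (\<Union>i. A i) g"
        using A int_g[of "\<Union>i. A i"] by (auto simp: set_integrable_def)
    qed
    then show ?case using union A by (auto simp: set_lebesgue_integral_def)
  qed
  then show "set_lebesgue_integral M A g = set_lebesgue_integral M A (\<lambda>_. 0)"
    by (simp add: set_lebesgue_integral_def)
qed simp

text \<open>
The weight as a Borel measure on the whole line that is carried by the unit interval. Having all Borel sets measurable
makes products and Fubini's theorem convenient.
\<close>

definition jac :: "real \<Rightarrow> real \<Rightarrow> real measure" where
  "jac p q = density lborel (\<lambda>x. ennreal (indicator {0<..<1} x * weight p q x))"

lemma sets_jac [simp, measurable_cong]: "sets (jac p q) = sets borel"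
  by (simp add: jac_def)

lemma space_jac [simp]: "space (jac p q) = UNIV"
  by (simp add: jac_def)

lemma weight_borel [measurable]: "weight p q \<in> borel_measurable borel"
  unfolding weight_def by measurable

lemma weight_pos: "0 < x \<Longrightarrow> x < 1 \<Longrightarrow> 0 < weight p q x"
  by (simp add: weight_def)

lemma AE_jac: "(AE x in jac p q. P x) \<longleftrightarrow> (AE x in lborel. x \<in> {0<..<1} \<longrightarrow> P x)"
proof -
  have "(AE x in jac p q. P x) \<longleftrightarrow> (AE x in lborel. 0 < ennreal (indicator {0<..<1} x * weight p q x) \<longrightarrow> P x)"
    unfolding jac_def by (rule AE_density) measurable
  also have "\<dots> \<longleftrightarrow> (AE x in lborel. x \<in> {0<..<1} \<longrightarrow> P x)"
    by (rule AE_cong) (auto simp: indicator_def weight_pos)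
  finally show ?thesis .
qed

lemma AE_jac_unit: "AE x in jac p q. x \<in> {0<..<1}"
  by (simp add: AE_jac)

lemma nn_integral_jac:
  assumes [measurable]: "f \<in> borel_measurable borel"
  shows "(\<integral>\<^sup>+x. f x \<partial>jac p q) = (\<integral>\<^sup>+x. ennreal (indicator {0<..<1} x * weight p q x) * f x \<partial>lborel)"
  unfolding jac_def by (rule nn_integral_density) measurable

lemma integrable_jac_iff:
  fixes f :: "real \<Rightarrow> real"
  assumes [measurable]: "f \<in> borel_measurable borel"
  shows "integrable (jac p q) f \<longleftrightarrow> integrable lborel (\<lambda>x. indicator {0<..<1} x * weight p q x * f x)"
  unfolding jac_def by (subst integrable_real_density) (auto simp: weight_def)

lemma integral_jac:
  fixes f :: "real \<Rightarrow> real"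
  assumes [measurable]: "f \<in> borel_measurable borel"
  shows "(LINT x|jac p q. f x) = (LINT x|lborel. indicator {0<..<1} x * weight p q x * f x)"
  unfolding jac_def by (subst integral_real_density) (auto simp: weight_def)

lemma Beta_pos: "0 < a \<Longrightarrow> 0 < b \<Longrightarrow> 0 < (Beta a b :: real)"
  by (simp add: Beta_def)

lemma nn_integral_weight:
  assumes "-1 < p" "-1 < q"
  shows "(\<integral>\<^sup>+x. ennreal (indicator {0<..<1} x * weight p q x) \<partial>lborel) = ennreal (Beta (q + 1) (p + 1))"
proof -
  have "((\<lambda>t. t powr q * (1 - t) powr p) has_integral Beta (q + 1) (p + 1)) {0..1}"
    using has_integral_Beta_real[of "q + 1" "p + 1"] assms by simp
  then have "((\<lambda>t. t powr q * (1 - t) powr p) has_integral Beta (q + 1) (p + 1)) {0<..<1}"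
    by (simp add: has_integral_Icc_iff_Ioo)
  then have "((\<lambda>t. indicator {0<..<1} t * weight p q t) has_integral Beta (q + 1) (p + 1)) UNIV"
    by (subst (asm) has_integral_restrict_UNIV[symmetric])
       (erule has_integral_eq[rotated], simp add: indicator_def weight_def mult.commute)
  then show ?thesis
    by (intro nn_integral_has_integral_lborel) (auto simp: weight_def)
qed

lemma emeasure_jac:
  assumes "-1 < p" "-1 < q"
  shows "emeasure (jac p q) UNIV = ennreal (Beta (q + 1) (p + 1))"
  unfolding jac_def using nn_integral_weight[OF assms] by (simp add: emeasure_density)

lemma finite_measure_jac:
  assumes "-1 < p" "-1 < q"
  shows "finite_measure (jac p q)"
  by (rule finite_measureI) (simp add: emeasure_jac[OF assms])

lemma integrable_jac_bounded:
  fixes f :: "real \<Rightarrow> real"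
  assumes "-1 < p" "-1 < q" and [measurable]: "f \<in> borel_measurable borel"
    and "\<And>x. x \<in> {0<..<1} \<Longrightarrow> \<bar>f x\<bar> \<le> B"
  shows "integrable (jac p q) f"
proof -
  interpret finite_measure "jac p q" using assms by (intro finite_measure_jac)
  show ?thesis
  proof (rule integrable_const_bound[where B = B])
    show "AE x in jac p q. norm (f x) \<le> B" using AE_jac_unit by eventually_elim (use assms in auto)
  qed measurable
qed

lemma poly_bounded_unit: "\<exists>B. \<forall>x\<in>{0<..<1}. \<bar>poly P x\<bar> \<le> (B::real)"
proof -
  have "bounded (poly P ` {0..1})"
    by (intro compact_imp_bounded compact_continuous_image continuous_intros) auto
  then show ?thesis by (force simp: bounded_iff)
qed

lemma integrable_jac_poly:
  assumes "-1 < p" "-1 < q"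
  shows "integrable (jac p q) (poly P)"
  using poly_bounded_unit[of P] by (auto intro: integrable_jac_bounded[OF assms])

lemma integrable_jac_poly_mult:
  assumes "-1 < p" "-1 < q"
  shows "integrable (jac p q) (\<lambda>x. poly P x * poly Q x)"
proof -
  have "poly (P * Q) = (\<lambda>x. poly P x * poly Q x)" by (simp add: fun_eq_iff)
  then show ?thesis using integrable_jac_poly[OF assms, of "P * Q"] by simp
qed

lemma poly_sq_int: "-1 < p \<Longrightarrow> -1 < q \<Longrightarrow> poly P \<in> sq_int (jac p q)"
  using integrable_jac_poly_mult[of p q P P] by (simp add: sq_int_def power2_eq_square)

lemma integral_jac_poly_square_pos:
  assumes "-1 < p" "-1 < q" "P \<noteq> 0"
  shows "0 < (LINT x|jac p q. (poly P x)\<^sup>2)"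
proof (rule ccontr)
  assume "\<not> ?thesis"
  then have "AE x in jac p q. poly P x = 0"
    by (intro integral_square_eq_0_AE poly_sq_int assms) auto
  then have "AE x in lborel. x \<in> {0<..<1} \<longrightarrow> poly P x = 0" by (simp add: AE_jac)
  moreover have "AE x in lborel. x \<notin> {x. poly P x = 0}"
    using poly_roots_finite[OF assms(3)]
    by (intro AE_not_in) (auto intro!: finite_imp_null_set_lborel)
  ultimately have "AE x in lborel. x \<notin> {0<..<(1::real)}" by eventually_elim auto
  then have "emeasure lborel {0<..<(1::real)} = 0"
    by (subst (asm) AE_iff_measurable[where N = "{0<..<1}"]) auto
  then show False by simp
qed

text \<open>
Moments of the form needed for Jacobi polynomials, which are combinations of \<open>(1 - x)\<^sup>i x\<^sup>j\<close>.
\<close>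

lemma integral_jac_moment:
  assumes "-1 < p" "-1 < q"
  shows "(LINT x|jac p q. (1 - x)^i * x^j) = Beta (q + real j + 1) (p + real i + 1)"
proof -
  have "(LINT x|jac p q. (1 - x)^i * x^j) =
      (LINT x|lborel. indicator {0<..<1} x * weight (p + i) (q + j) x)"
    unfolding integral_jac[of "\<lambda>x. (1 - x)^i * x^j", simplified]
    by (intro Bochner_Integration.integral_cong)
       (auto simp: indicator_def weight_def powr_add powr_realpow)
  also have "\<dots> = Beta (q + real j + 1) (p + real i + 1)"
    using assms
    by (subst integral_eq_nn_integral)
       (auto simp: weight_def nn_integral_weight[unfolded weight_def] less_imp_le[OF Beta_pos])
  finally show ?thesis .
qed

section \<open>The two-sided Abel kernel\<close>

text \<open>
The diagonal is a null set; the value \<open>0\<close> there makes the kernel the sum of its two one-sided parts and the symmetry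
\<open>frac_kernel_swap\<close> hold everywhere.
\<close>

definition frac_kernel :: "real \<Rightarrow> real \<Rightarrow> real \<Rightarrow> real \<Rightarrow> real" where
  "frac_kernel \<alpha> r x s = (if s < x then r * (x - s) powr (1 - \<alpha>)
     else if x < s then (1 - r) * (s - x) powr (1 - \<alpha>) else 0)"

lemma weight_nonneg: "0 \<le> weight p q x"
  by (simp add: weight_def)

text \<open>
Euler's integral for the hypergeometric function in the case in which it is elementary. The substitution
\<open>t = v / (1 - z + z v)\<close> is the projective map that fixes \<open>0\<close> and \<open>1\<close> and sends the singularity \<open>1 / z\<close> to infinity.
\<close>

lemma nn_integral_Euler:
  fixes b c z :: real
  assumes "0 < b" "0 < c" "0 < z" "z < 1"
  shows "(\<integral>\<^sup>+t. ennreal (indicator {0<..<1} t * (t powr (b - 1) * (1 - t) powr (c - 1) *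
      (1 - z * t) powr (- b - c))) \<partial>lborel) = ennreal (Beta b c * (1 - z) powr (- b))"
proof -
  define f where "f t = t powr (b - 1) * (1 - t) powr (c - 1) * (1 - z * t) powr (- b - c)" for t
  define d where "d v = 1 - z + z * v" for v
  define g where "g v = v / d v" for v
  define g' where "g' v = (1 - z) / (d v)\<^sup>2" for v
  have dpos: "d v > 0" if "v \<in> {0..1}" for v
    using that assms unfolding d_def by (intro add_pos_nonneg) auto
  have [measurable]: "f \<in> borel_measurable borel" unfolding f_def by measurable
  have g01: "g 0 = 0" "g 1 = 1" by (auto simp: g_def d_def)
  have drop: "(\<integral>\<^sup>+t. ennreal (indicator {0<..<1} t * h t) \<partial>lborel) = (\<integral>\<^sup>+t. ennreal (h t * indicator {0..1} t) \<partial>lborel)"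
    for h :: "real \<Rightarrow> real"
  proof (rule nn_integral_cong_AE)
    have "AE t in lborel. t \<noteq> (0::real)" "AE t in lborel. t \<noteq> (1::real)"
      by (rule AE_lborel_singleton)+
    then show "AE t in lborel. ennreal (indicator {0<..<1} t * h t) = ennreal (h t * indicator {0..1} t)"
      by eventually_elim (auto simp: indicator_def)
  qed
  have "(\<integral>\<^sup>+t. ennreal (f t * indicator {g 0..g 1} t) \<partial>lborel) = (\<integral>\<^sup>+v. ennreal (f (g v) * g' v * indicator {0..1} v) \<partial>lborel)"
  proof (rule nn_integral_substitution)
    show "set_borel_measurable borel {g 0..g 1} f" by (simp add: set_borel_measurable_def)
    fix v :: real assume v: "v \<in> {0..1}"
    show "(g has_real_derivative g' v) (at v)"
      unfolding g_def[abs_def] g'_def d_def[abs_def] using dpos[OF v]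
      by (auto intro!: derivative_eq_intros simp: d_def power2_eq_square field_simps)
    show "0 \<le> g' v" using assms dpos[OF v] by (simp add: g'_def)
  next
    show "continuous_on {0..1} g'"
      unfolding g'_def d_def using dpos by (intro continuous_intros) (force simp: d_def)+
  qed simp
  also have "\<dots> = (\<integral>\<^sup>+v. ennreal (indicator {0<..<1} v * (f (g v) * g' v)) \<partial>lborel)" by (simp add: drop)
  also have "\<dots> = (\<integral>\<^sup>+v. ennreal ((1 - z) powr (- b)) * ennreal (indicator {0<..<1} v * weight (c - 1) (b - 1) v) \<partial>lborel)"
  proof (rule nn_integral_cong)
    fix v :: real
    show "ennreal (indicator {0<..<1} v * (f (g v) * g' v)) =
        ennreal ((1 - z) powr (- b)) * ennreal (indicator {0<..<1} v * weight (c - 1) (b - 1) v)"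
    proof (cases "v \<in> {0<..<1}")
      case True
      then have v: "0 < v" "v < 1" by auto
      then have d: "0 < d v" using dpos[of v] by simp
      have e: "1 - g v = (1 - z) * (1 - v) / d v" "1 - z * g v = (1 - z) / d v"
        using d by (auto simp: g_def field_simps) (auto simp: d_def algebra_simps)
      have g'': "g' v = (1 - z) powr 1 * d v powr (- 2)"
        using d assms by (simp add: g'_def powr_minus field_simps powr_numeral)
      have "f (g v) * g' v = (1 - z) powr (- b) * weight (c - 1) (b - 1) v"
        unfolding f_def e g'' using d v assms unfolding g_def weight_def
        by (simp add: powr_def ln_mult ln_div divide_pos_pos del: exp_ln powr_one powr_one_gt_zero_iff flip: exp_add) (simp add: algebra_simps)
      then show ?thesis using True by (simp add: ennreal_mult')
    qed simp
  qed
  also have "\<dots> = ennreal ((1 - z) powr (- b)) * ennreal (Beta b c)"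
    using nn_integral_weight[of "c - 1" "b - 1"] assms by (subst nn_integral_cmult) auto
  finally show ?thesis
    using drop[of f] assms less_imp_le[OF Beta_pos[of b c]]
    by (simp add: f_def g01 ennreal_mult' ennreal_mult'' mult.commute)
qed

text \<open>
Scaling \<open>s = x t\<close> moves the dependence on \<open>x\<close> into the factor \<open>x\<close> to the power \<open>1 - a\<close> times \<open>1 - x t\<close> to the power
\<open>a - 1\<close>. That factor is the integral of its derivative from \<open>0\<close> to \<open>x\<close>, and after an exchange of integrals the
integral over \<open>t\<close> is Euler's.
\<close>

lemma nn_integral_left_kernel:
  fixes a b x :: real
  assumes "a < 1" "0 < b" "a + b < 2" "0 < x" "x < 1"
  shows "(\<integral>\<^sup>+s. ennreal (indicator {0<..<x} s * (weight (a - 1) (b - 1) s * (x - s) powr (1 - a - b))) \<partial>lborel) =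
    ennreal ((1 - a) * Beta b (2 - a - b)) * (\<integral>\<^sup>+z. ennreal (indicator {0<..<x} z * weight (- b) (- a) z) \<partial>lborel)"
proof -
  define h where "h t = indicator {0<..<1} t * (t powr (b - 1) * (1 - t) powr (1 - a - b))" for t :: real
  define k where "k z t = indicator {0<..<x} z * ((1 - a) * z powr (- a) * (1 - z * t) powr (a - 2))" for z t :: real
  have [measurable]: "h \<in> borel_measurable borel" unfolding h_def by measurable
  have [measurable]: "(\<lambda>(z, t). k z t) \<in> borel_measurable (borel \<Otimes>\<^sub>M borel)" unfolding k_def by measurable
  have scale: "(\<integral>\<^sup>+s. ennreal (indicator {0<..<x} s * (weight (a - 1) (b - 1) s * (x - s) powr (1 - a - b))) \<partial>lborel) =
      ennreal \<bar>x\<bar> * (\<integral>\<^sup>+t. ennreal (indicator {0<..<x} (0 + x * t) * (weight (a - 1) (b - 1) (0 + x * t) * (x - (0 + x * t)) powr (1 - a - b))) \<partial>lborel)"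
    using assms by (intro nn_integral_real_affine) auto
  also have "\<dots> = (\<integral>\<^sup>+t. ennreal \<bar>x\<bar> * ennreal (indicator {0<..<x} (0 + x * t) * (weight (a - 1) (b - 1) (0 + x * t) * (x - (0 + x * t)) powr (1 - a - b))) \<partial>lborel)"
    by (subst nn_integral_cmult) auto
  also have "\<dots> = (\<integral>\<^sup>+t. ennreal (h t) * ennreal (x powr (1 - a) * (1 - x * t) powr (a - 1)) \<partial>lborel)"
  proof (rule nn_integral_cong)
    fix t :: real
    show "ennreal \<bar>x\<bar> * ennreal (indicator {0<..<x} (0 + x * t) * (weight (a - 1) (b - 1) (0 + x * t) * (x - (0 + x * t)) powr (1 - a - b))) =
        ennreal (h t) * ennreal (x powr (1 - a) * (1 - x * t) powr (a - 1))"
    proof (cases "t \<in> {0<..<1}")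
      case True
      then have t: "0 < t" "t < 1" by auto
      have "x * t < x" "0 < x * t" using t assms by auto
      with assms have xt: "0 < x * t" "x * t < x" "x * t < 1" by linarith+
      have e: "x - x * t = x * (1 - t)" by (simp add: algebra_simps)
      have "x powr 1 * (weight (a - 1) (b - 1) (x * t) * (x - x * t) powr (1 - a - b)) =
          t powr (b - 1) * (1 - t) powr (1 - a - b) * (x powr (1 - a) * (1 - x * t) powr (a - 1))"
        unfolding e weight_def using t xt assms
        by (simp add: powr_def ln_mult del: exp_ln powr_one powr_one_gt_zero_iff flip: exp_add) (simp add: algebra_simps)
      then have "x * (weight (a - 1) (b - 1) (x * t) * (x - x * t) powr (1 - a - b)) =
          t powr (b - 1) * (1 - t) powr (1 - a - b) * (x powr (1 - a) * (1 - x * t) powr (a - 1))"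
        using assms by simp
      then show ?thesis using t xt assms
        by (simp add: h_def ennreal_mult'[symmetric] )
    next
      case False
      then have "x * t \<notin> {0<..<x}" using assms by (auto simp: zero_less_mult_iff)
      then show ?thesis using False by (simp add: h_def)
    qed
  qed
  also have "\<dots> = (\<integral>\<^sup>+t. (\<integral>\<^sup>+z. ennreal (h t) * ennreal (k z t) \<partial>lborel) \<partial>lborel)"
  proof (rule nn_integral_cong)
    fix t :: real
    show "ennreal (h t) * ennreal (x powr (1 - a) * (1 - x * t) powr (a - 1)) = (\<integral>\<^sup>+z. ennreal (h t) * ennreal (k z t) \<partial>lborel)"
    proof (cases "t \<in> {0<..<1}")
      case True
      then have t: "0 < t" "t < 1" by auto
      define \<phi> where "\<phi> z = z powr (1 - a) * (1 - z * t) powr (a - 1)" for z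
      have lt: "z * t < 1" if "0 \<le> z" "z \<le> x" for z
      proof -
        have "z * t \<le> z * 1" using that t by (intro mult_left_mono) auto
        then show ?thesis using that assms by simp
      qed
      have "((\<lambda>z. (1 - a) * z powr (- a) * (1 - z * t) powr (a - 2)) has_integral (\<phi> x - \<phi> 0)) {0..x}"
      proof (rule fundamental_theorem_of_calculus_interior)
        show "continuous_on {0..x} \<phi>"
          unfolding \<phi>_def using assms lt
          by (intro continuous_on_mult continuous_on_powr' continuous_intros) (force intro: less_imp_le)+
        fix z assume z: "z \<in> {0<..<x}"
        have 1: "1 - z * t > 0" using lt[of z] z by auto
        have "(\<phi> has_real_derivative ((1 - a) * z powr (- a) * (1 - z * t) powr (a - 1)
             + z powr (1 - a) * ((a - 1) * (1 - z * t) powr (a - 2) * (- t)))) (at z)"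
          unfolding \<phi>_def using z 1
          by (auto intro!: derivative_eq_intros)
        also have "(1 - a) * z powr (- a) * (1 - z * t) powr (a - 1)
             + z powr (1 - a) * ((a - 1) * (1 - z * t) powr (a - 2) * (- t)) =
             (1 - a) * z powr (- a) * (1 - z * t) powr (a - 2) * ((1 - z * t) + z * t)"
        proof -
          have "(1 - z * t) powr (a - 1) = (1 - z * t) powr (a - 2) * (1 - z * t)"
            using 1 powr_add[of "1 - z * t" "a - 2" 1] by simp
          moreover have "z powr (1 - a) = z powr (- a) * z"
            using z powr_add[of z "- a" 1] by simp
          moreover have "(1 - a) * Z * (P * (1 - z * t)) + Z * z * ((a - 1) * P * (- t)) =
              (1 - a) * Z * P * ((1 - z * t) + z * t)" for Z P
            by (simp add: algebra_simps)
          ultimately show ?thesis by (simp only:)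
        qed
        finally show "(\<phi> has_vector_derivative (1 - a) * z powr (- a) * (1 - z * t) powr (a - 2)) (at z)"
          by (simp add: has_real_derivative_iff_has_vector_derivative)
      qed (use assms in auto)
      then have "((\<lambda>z. (1 - a) * z powr (- a) * (1 - z * t) powr (a - 2)) has_integral (\<phi> x - \<phi> 0)) {0<..<x}"
        by (simp add: has_integral_Icc_iff_Ioo)
      then have "((\<lambda>z. k z t) has_integral (\<phi> x - \<phi> 0)) UNIV"
        by (subst (asm) has_integral_restrict_UNIV[symmetric])
           (erule has_integral_eq[rotated], simp add: indicator_def k_def)
      then have "(\<integral>\<^sup>+z. ennreal (k z t) \<partial>lborel) = ennreal (\<phi> x - \<phi> 0)"
        using assms by (intro nn_integral_has_integral_lborel) (auto simp: k_def)
      moreover have "\<phi> 0 = 0" by (simp add: \<phi>_def)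
      ultimately show ?thesis by (simp add: nn_integral_cmult \<phi>_def)
    qed (simp add: h_def)
  qed
  also have "\<dots> = (\<integral>\<^sup>+z. (\<integral>\<^sup>+t. ennreal (h t) * ennreal (k z t) \<partial>lborel) \<partial>lborel)"
    by (rule lborel_pair.Fubini') measurable
  also have "\<dots> = (\<integral>\<^sup>+z. ennreal ((1 - a) * Beta b (2 - a - b)) * ennreal (indicator {0<..<x} z * weight (- b) (- a) z) \<partial>lborel)"
  proof (rule nn_integral_cong)
    fix z :: real
    show "(\<integral>\<^sup>+t. ennreal (h t) * ennreal (k z t) \<partial>lborel) =
        ennreal ((1 - a) * Beta b (2 - a - b)) * ennreal (indicator {0<..<x} z * weight (- b) (- a) z)"
    proof (cases "z \<in> {0<..<x}")
      case True
      have e: "(2 - a - b) - 1 = 1 - a - b" "- b - (2 - a - b) = a - 2" by auto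
      have B: "0 \<le> Beta b (2 - a - b)" using assms by (intro less_imp_le Beta_pos) auto
      have "ennreal (h t) * ennreal (k z t) = ennreal ((1 - a) * z powr (- a)) *
          ennreal (indicator {0<..<1} t * (t powr (b - 1) * (1 - t) powr ((2 - a - b) - 1) * (1 - z * t) powr (- b - (2 - a - b))))" for t
      proof -
        have "h t * k z t = ((1 - a) * z powr (- a)) *
            (indicator {0<..<1} t * (t powr (b - 1) * (1 - t) powr (1 - a - b) * (1 - z * t) powr (a - 2)))"
          using True by (simp add: h_def k_def)
        moreover have "0 \<le> h t" "0 \<le> (1 - a) * z powr (- a)" using assms by (auto simp: h_def)
        ultimately show ?thesis unfolding e by (metis ennreal_mult')
      qed
      then have "(\<integral>\<^sup>+t. ennreal (h t) * ennreal (k z t) \<partial>lborel) =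
          ennreal ((1 - a) * z powr (- a)) * ennreal (Beta b (2 - a - b) * (1 - z) powr (- b))"
        using nn_integral_Euler[of b "2 - a - b" z] True assms by (simp only:) (subst nn_integral_cmult, auto)
      also have "\<dots> = ennreal (((1 - a) * Beta b (2 - a - b)) * weight (- b) (- a) z)"
        using assms by (subst ennreal_mult'[symmetric]) (auto simp: weight_def mult_ac)
      also have "\<dots> = ennreal ((1 - a) * Beta b (2 - a - b)) * ennreal (weight (- b) (- a) z)"
        using assms B by (intro ennreal_mult') auto
      finally show ?thesis using True by simp
    qed (simp add: k_def)
  qed
  finally show ?thesis by (simp add: nn_integral_cmult)
qed

lemma nn_integral_reflect:
  fixes f :: "real \<Rightarrow> ennreal"
  assumes [measurable]: "f \<in> borel_measurable borel"
  shows "(\<integral>\<^sup>+s. f s \<partial>lborel) = (\<integral>\<^sup>+s. f (1 - s) \<partial>lborel)"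
  using nn_integral_real_affine[of f "-1" 1] by simp

lemma nn_integral_right_kernel:
  fixes a b x :: real
  assumes "b < 1" "0 < a" "a + b < 2" "0 < x" "x < 1"
  shows "(\<integral>\<^sup>+s. ennreal (indicator {x<..<1} s * (weight (a - 1) (b - 1) s * (s - x) powr (1 - a - b))) \<partial>lborel) =
    ennreal ((1 - b) * Beta a (2 - a - b)) * (\<integral>\<^sup>+z. ennreal (indicator {x<..<1} z * weight (- b) (- a) z) \<partial>lborel)"
proof -
  have "(\<integral>\<^sup>+s. ennreal (indicator {x<..<1} s * (weight (a - 1) (b - 1) s * (s - x) powr (1 - a - b))) \<partial>lborel) =
      (\<integral>\<^sup>+s. ennreal (indicator {0<..<1 - x} s * (weight (b - 1) (a - 1) s * (1 - x - s) powr (1 - b - a))) \<partial>lborel)"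
    by (subst nn_integral_reflect) (auto intro!: nn_integral_cong simp: indicator_def weight_def algebra_simps)
  also have "\<dots> = ennreal ((1 - b) * Beta a (2 - b - a)) * (\<integral>\<^sup>+z. ennreal (indicator {0<..<1 - x} z * weight (- a) (- b) z) \<partial>lborel)"
    using assms by (intro nn_integral_left_kernel) auto
  also have "(\<integral>\<^sup>+z. ennreal (indicator {0<..<1 - x} z * weight (- a) (- b) z) \<partial>lborel) =
      (\<integral>\<^sup>+z. ennreal (indicator {x<..<1} z * weight (- b) (- a) z) \<partial>lborel)"
    by (subst nn_integral_reflect) (auto intro!: nn_integral_cong simp: indicator_def weight_def algebra_simps)
  finally show ?thesis by (simp add: algebra_simps)
qed

text \<open>
The degenerate case \<open>a = 1\<close>, in which the left integral is itself constant.
\<close>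

lemma nn_integral_left_kernel_full:
  fixes b x :: real
  assumes "0 < b" "b < 1" "0 < x" "x < 1"
  shows "(\<integral>\<^sup>+s. ennreal (indicator {0<..<x} s * (weight 0 (b - 1) s * (x - s) powr (- b))) \<partial>lborel) = ennreal (Beta b (1 - b))"
proof -
  have "(\<integral>\<^sup>+s. ennreal (indicator {0<..<x} s * (weight 0 (b - 1) s * (x - s) powr (- b))) \<partial>lborel) =
     ennreal \<bar>x\<bar> * (\<integral>\<^sup>+t. ennreal (indicator {0<..<x} (0 + x * t) * (weight 0 (b - 1) (0 + x * t) * (x - (0 + x * t)) powr (- b))) \<partial>lborel)"
    using assms by (intro nn_integral_real_affine) auto
  also have "\<dots> = (\<integral>\<^sup>+t. ennreal \<bar>x\<bar> * ennreal (indicator {0<..<x} (0 + x * t) * (weight 0 (b - 1) (0 + x * t) * (x - (0 + x * t)) powr (- b))) \<partial>lborel)"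
    by (subst nn_integral_cmult) auto
  also have "\<dots> = (\<integral>\<^sup>+t. ennreal (indicator {0<..<1} t * weight (- b) (b - 1) t) \<partial>lborel)"
  proof (rule nn_integral_cong)
    fix t :: real
    show "ennreal \<bar>x\<bar> * ennreal (indicator {0<..<x} (0 + x * t) * (weight 0 (b - 1) (0 + x * t) * (x - (0 + x * t)) powr (- b))) =
        ennreal (indicator {0<..<1} t * weight (- b) (b - 1) t)"
    proof (cases "t \<in> {0<..<1}")
      case True
      then have t: "0 < t" "t < 1" by auto
      have "x * t < x" "0 < x * t" using t assms by auto
      with assms have xt: "0 < x * t" "x * t < x" "x * t < 1" by linarith+
      have e: "x - x * t = x * (1 - t)" by (simp add: algebra_simps)
      have "x powr 1 * (weight 0 (b - 1) (x * t) * (x - x * t) powr (- b)) = weight (- b) (b - 1) t"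
        unfolding e weight_def using t xt assms
        by (simp add: powr_def ln_mult del: exp_ln powr_one powr_one_gt_zero_iff flip: exp_add) (simp add: algebra_simps)
      then show ?thesis using t xt assms
        by (simp add: ennreal_mult'[symmetric] )
    next
      case False
      then have "x * t \<notin> {0<..<x}" using assms by (auto simp: zero_less_mult_iff)
      then show ?thesis using False by simp
    qed
  qed
  also have "\<dots> = ennreal (Beta b (1 - b))"
    using nn_integral_weight[of "-b" "b - 1"] assms by simp
  finally show ?thesis .
qed

lemma Gamma_reflection_real:
  fixes x :: real
  assumes "0 < x" "x < 1"
  shows "Gamma x * Gamma (1 - x) = pi / sin (pi * x)"
proof -
  have e: "1 - complex_of_real x = complex_of_real (1 - x)" by simp
  have "complex_of_real (Gamma x * Gamma (1 - x)) = complex_of_real (pi / sin (pi * x))"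
    using Gamma_reflection_complex[of "of_real x"]
    unfolding e Gamma_complex_of_real of_real_mult[symmetric] sin_of_real of_real_divide[symmetric] .
  then show ?thesis by (simp only: of_real_eq_iff)
qed

text \<open>
The parameters of the problem in symmetric form, with \<open>a = \<alpha> - \<beta>\<close> and \<open>b = \<beta>\<close>. The symmetry \<open>swapped\<close> is what makes
the adjoint operator accessible.
\<close>

locale frac_jacobi =
  fixes a b r :: real
  assumes a: "0 < a" "a \<le> 1" and b: "0 < b" "b \<le> 1" and ab: "1 < a + b" "a + b < 2"
    and r: "r = sin (pi * b) / (sin (pi * a) + sin (pi * b))"
begin

abbreviation "\<alpha> \<equiv> a + b"

lemma sin_nonneg: "0 \<le> sin (pi * a)" "0 \<le> sin (pi * b)"
  using a b by (auto intro!: sin_ge_zero simp: mult_left_le)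

lemma sin_pos: "a < 1 \<Longrightarrow> 0 < sin (pi * a)" "b < 1 \<Longrightarrow> 0 < sin (pi * b)"
  using a b by (auto intro!: sin_gt_zero)

lemma sin_sum_pos: "0 < sin (pi * a) + sin (pi * b)"
proof (cases "a < 1")
  case True
  then show ?thesis using sin_pos sin_nonneg by (auto intro: add_pos_nonneg)
next
  case False
  then have "b < 1" using ab a by auto
  then show ?thesis using sin_pos sin_nonneg by (auto intro: add_nonneg_pos)
qed

lemma r_bounds: "0 \<le> r" "r \<le> 1"
  using sin_sum_pos sin_nonneg unfolding r by (auto simp: divide_le_eq_1)

lemma one_minus_r: "1 - r = sin (pi * a) / (sin (pi * b) + sin (pi * a))"
  using sin_sum_pos unfolding r by (simp add: field_simps)

lemma swapped: "frac_jacobi b a (1 - r)"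
  using a b ab one_minus_r by unfold_locales (auto simp: add.commute)

text \<open>
The constants in \<open>nn_integral_left_kernel\<close> and \<open>nn_integral_right_kernel\<close>, weighted by \<open>r\<close> and \<open>1 - r\<close>, agree exactly
when \<open>r\<close> and \<open>1 - r\<close> are proportional to \<open>sin (\<pi> b)\<close> and \<open>sin (\<pi> a)\<close>.
\<close>

lemma kernel_constants_balance:
  assumes "a < 1" "b < 1"
  shows "r * ((1 - a) * Beta b (2 - a - b)) = (1 - r) * ((1 - b) * Beta a (2 - a - b))"
proof -
  have cancel: "(1 - c) * (X / ((1 - c) * G)) * G = X" if "c < 1" "G > 0" for c X G :: real
    using that by simp
  have L: "(1 - a) * Beta b (2 - a - b) * Gamma (1 - a) = Gamma b * Gamma (2 - a - b)"
  proof -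
    have "Gamma (2 - a) = (1 - a) * Gamma (1 - a)"
      using assms Gamma_plus1[of "1 - a"] nonpos_Ints_nonpos[of "1 - a"] by force
    moreover have "Gamma (1 - a) > 0" using assms by (intro Gamma_real_pos) simp
    moreover have "b + (2 - a - b) = 2 - a" by simp
    ultimately show ?thesis using assms unfolding Beta_def by (simp only: cancel)
  qed
  have R: "(1 - b) * Beta a (2 - a - b) * Gamma (1 - b) = Gamma a * Gamma (2 - a - b)"
  proof -
    have "Gamma (2 - b) = (1 - b) * Gamma (1 - b)"
      using assms Gamma_plus1[of "1 - b"] nonpos_Ints_nonpos[of "1 - b"] by force
    moreover have "Gamma (1 - b) > 0" using assms by (intro Gamma_real_pos) simp
    moreover have "a + (2 - a - b) = 2 - b" by simp
    ultimately show ?thesis using assms unfolding Beta_def by (simp only: cancel)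
  qed
  have G: "0 < Gamma (1 - a)" "0 < Gamma (1 - b)" "0 < Gamma a" "0 < Gamma b"
    using assms a b by (auto intro!: Gamma_real_pos)
  define S where "S = sin (pi * a) + sin (pi * b)"
  have "S > 0" using sin_sum_pos by (simp add: S_def)
  have "r * (Gamma b * Gamma (1 - b)) = pi / S"
    using Gamma_reflection_real[of b] b assms sin_pos unfolding r S_def by simp
  moreover have "(1 - r) * (Gamma a * Gamma (1 - a)) = pi / S"
    using Gamma_reflection_real[of a] a assms sin_pos unfolding one_minus_r S_def by (simp add: add.commute)
  ultimately have "r * Gamma b * Gamma (1 - b) = (1 - r) * Gamma a * Gamma (1 - a)" by (simp add: mult.assoc)
  then have "r * ((1 - a) * Beta b (2 - a - b) * Gamma (1 - a)) * Gamma (1 - b) =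
      (1 - r) * ((1 - b) * Beta a (2 - a - b) * Gamma (1 - b)) * Gamma (1 - a)"
    unfolding L R by algebra
  then show ?thesis using G by simp
qed

lemma frac_kernel_nonneg: "0 \<le> frac_kernel \<alpha> r x s"
  using r_bounds by (simp add: frac_kernel_def)

lemma frac_kernel_measurable [measurable]:
  "(\<lambda>(x, s). frac_kernel \<alpha> r x s) \<in> borel_measurable (borel \<Otimes>\<^sub>M borel)"
  unfolding frac_kernel_def by measurable

lemma kernel_integral_split:
  assumes x: "0 < x" "x < 1"
  shows "(\<integral>\<^sup>+s. ennreal (frac_kernel \<alpha> r x s) \<partial>jac (a - 1) (b - 1)) =
    ennreal r * (\<integral>\<^sup>+s. ennreal (indicator {0<..<x} s * (weight (a - 1) (b - 1) s * (x - s) powr (1 - a - b))) \<partial>lborel) +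
    ennreal (1 - r) * (\<integral>\<^sup>+s. ennreal (indicator {x<..<1} s * (weight (a - 1) (b - 1) s * (s - x) powr (1 - a - b))) \<partial>lborel)"
proof -
  have "(\<integral>\<^sup>+s. ennreal (frac_kernel \<alpha> r x s) \<partial>jac (a - 1) (b - 1)) =
      (\<integral>\<^sup>+s. ennreal (indicator {0<..<1} s * weight (a - 1) (b - 1) s) * ennreal (frac_kernel \<alpha> r x s) \<partial>lborel)"
    by (rule nn_integral_jac) measurable
  also have "\<dots> = (\<integral>\<^sup>+s. ennreal r * ennreal (indicator {0<..<x} s * (weight (a - 1) (b - 1) s * (x - s) powr (1 - a - b))) +
      ennreal (1 - r) * ennreal (indicator {x<..<1} s * (weight (a - 1) (b - 1) s * (s - x) powr (1 - a - b))) \<partial>lborel)"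
  proof (rule nn_integral_cong)
    fix s :: real
    have e: "1 - \<alpha> = 1 - a - b" by simp
    have swap: "ennreal w * ennreal (c * P) = ennreal c * ennreal (w * P)" if "0 \<le> w" "0 \<le> c" for w c P
      using that by (simp add: ennreal_mult' mult.left_commute)
    consider "s \<le> 0" | "0 < s" "s < x" | "s = x" | "x < s" "s < 1" | "1 \<le> s" by linarith
    then show "ennreal (indicator {0<..<1} s * weight (a - 1) (b - 1) s) * ennreal (frac_kernel \<alpha> r x s) =
        ennreal r * ennreal (indicator {0<..<x} s * (weight (a - 1) (b - 1) s * (x - s) powr (1 - a - b))) +
        ennreal (1 - r) * ennreal (indicator {x<..<1} s * (weight (a - 1) (b - 1) s * (s - x) powr (1 - a - b)))"
    proof cases
      case 2
      have "ennreal (weight (a - 1) (b - 1) s) * ennreal (r * (x - s) powr (1 - a - b)) =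
          ennreal r * ennreal (weight (a - 1) (b - 1) s * (x - s) powr (1 - a - b))"
        by (intro swap weight_nonneg r_bounds)
      then show ?thesis using x 2 by (simp only: frac_kernel_def e) simp
    next
      case 4
      have "ennreal (weight (a - 1) (b - 1) s) * ennreal ((1 - r) * (s - x) powr (1 - a - b)) =
          ennreal (1 - r) * ennreal (weight (a - 1) (b - 1) s * (s - x) powr (1 - a - b))"
        using r_bounds by (intro swap weight_nonneg) auto
      then show ?thesis using x 4 by (simp only: frac_kernel_def e) simp
    qed (use x in \<open>auto simp: frac_kernel_def\<close>)
  qed
  also have "\<dots> = ennreal r * (\<integral>\<^sup>+s. ennreal (indicator {0<..<x} s * (weight (a - 1) (b - 1) s * (x - s) powr (1 - a - b))) \<partial>lborel) +
    ennreal (1 - r) * (\<integral>\<^sup>+s. ennreal (indicator {x<..<1} s * (weight (a - 1) (b - 1) s * (s - x) powr (1 - a - b))) \<partial>lborel)"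
    by (subst nn_integral_add) (simp_all add: nn_integral_cmult)
  finally show ?thesis .
qed

text \<open>
With equal constants in front, the integrals over \<open>(0, x)\<close> and \<open>(x, 1)\<close> add up to a complete Beta integral. If \<open>a = 1\<close>
or \<open>b = 1\<close>, then \<open>r = 1\<close> or \<open>r = 0\<close> and only one side is present.
\<close>

lemma kernel_integral_constant:
  "\<exists>C>0. \<forall>x\<in>{0<..<1}. (\<integral>\<^sup>+s. ennreal (frac_kernel \<alpha> r x s) \<partial>jac (a - 1) (b - 1)) = ennreal C"
proof -
  consider "a < 1" "b < 1" | "a = 1" "b < 1" | "b = 1" "a < 1" using a b ab by fastforce
  then show ?thesis
  proof cases
    case 1
    define C where "C = r * ((1 - a) * Beta b (2 - a - b))"
    have B: "0 < Beta b (2 - a - b)" "0 < Beta a (2 - a - b)" using a b ab by (auto intro!: Beta_pos)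
    have "0 < r" using sin_pos(2)[OF 1(2)] sin_sum_pos unfolding r by simp
    then have C: "0 < C" using 1 B by (simp add: C_def)
    show ?thesis
    proof (intro exI[of _ "C * Beta (1 - a) (1 - b)"] conjI ballI)
      show "0 < C * Beta (1 - a) (1 - b)" using C 1 by (simp add: Beta_pos)
      fix x :: real assume x: "x \<in> {0<..<1}"
      let ?W = "\<lambda>I. \<integral>\<^sup>+z. ennreal (indicator I z * weight (- b) (- a) z) \<partial>lborel"
      have "(\<integral>\<^sup>+s. ennreal (frac_kernel \<alpha> r x s) \<partial>jac (a - 1) (b - 1)) =
          ennreal r * (ennreal ((1 - a) * Beta b (2 - a - b)) * ?W {0<..<x}) +
          ennreal (1 - r) * (ennreal ((1 - b) * Beta a (2 - a - b)) * ?W {x<..<1})"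
      proof -
        have x': "0 < x" "x < 1" using x by auto
        show ?thesis
          unfolding kernel_integral_split[OF x'] nn_integral_left_kernel[OF 1(1) b(1) ab(2) x']
            nn_integral_right_kernel[OF 1(2) a(1) ab(2) x'] ..
      qed
      also have "\<dots> = ennreal C * ?W {0<..<x} + ennreal C * ?W {x<..<1}"
      proof -
        have "ennreal r * ennreal ((1 - a) * Beta b (2 - a - b)) = ennreal C"
          unfolding C_def using r_bounds by (simp add: ennreal_mult')
        moreover have "ennreal (1 - r) * ennreal ((1 - b) * Beta a (2 - a - b)) = ennreal C"
          unfolding C_def kernel_constants_balance[OF 1] using r_bounds by (simp add: ennreal_mult')
        ultimately show ?thesis by (simp add: mult.assoc[symmetric])
      qed
      also have "\<dots> = ennreal C * (?W {0<..<x} + ?W {x<..<1})" by (simp add: distrib_left)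
      also have "?W {0<..<x} + ?W {x<..<1} =
          (\<integral>\<^sup>+z. ennreal (indicator {0<..<x} z * weight (- b) (- a) z) + ennreal (indicator {x<..<1} z * weight (- b) (- a) z) \<partial>lborel)"
        by (rule nn_integral_add[symmetric]) measurable
      also have "\<dots> = ?W {0<..<1}"
      proof (rule nn_integral_cong_AE)
        have "AE z in lborel. z \<noteq> x" by (rule AE_lborel_singleton)
        then show "AE z in lborel. ennreal (indicator {0<..<x} z * weight (- b) (- a) z) + ennreal (indicator {x<..<1} z * weight (- b) (- a) z) =
            ennreal (indicator {0<..<1} z * weight (- b) (- a) z)"
        proof eventually_elim
          case (elim z)
          then consider "z < x" | "x < z" by linarith
          then show ?case by cases (use x in \<open>simp_all add: indicator_def\<close>)
        qed
      qed
      also have "\<dots> = ennreal (Beta (1 - a) (1 - b))" using 1 nn_integral_weight[of "-b" "-a"] by simp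
      finally show "(\<integral>\<^sup>+s. ennreal (frac_kernel \<alpha> r x s) \<partial>jac (a - 1) (b - 1)) = ennreal (C * Beta (1 - a) (1 - b))"
        using C 1 by (simp add: ennreal_mult')
    qed
  next
    case 2
    have r1: "r = 1" using sin_pos(2)[OF 2(2)] unfolding r 2 by simp
    show ?thesis
    proof (intro exI[of _ "Beta b (1 - b)"] conjI ballI)
      show "0 < Beta b (1 - b)" using b 2 by (simp add: Beta_pos)
      fix x :: real assume x: "x \<in> {0<..<1}"
      show "(\<integral>\<^sup>+s. ennreal (frac_kernel \<alpha> r x s) \<partial>jac (a - 1) (b - 1)) = ennreal (Beta b (1 - b))"
      proof -
        have x': "0 < x" "x < 1" using x by auto
        show ?thesis
          using kernel_integral_split[OF x'] nn_integral_left_kernel_full[of b x] x' b 2 r1 by simp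
      qed
    qed
  next
    case 3
    have r0: "r = 0" unfolding r 3 by simp
    show ?thesis
    proof (intro exI[of _ "Beta a (1 - a)"] conjI ballI)
      show "0 < Beta a (1 - a)" using a 3 by (simp add: Beta_pos)
      fix x :: real assume x: "x \<in> {0<..<1}"
      have "(\<integral>\<^sup>+s. ennreal (indicator {x<..<1} s * (weight (a - 1) 0 s * (s - x) powr (- a))) \<partial>lborel) =
          (\<integral>\<^sup>+s. ennreal (indicator {0<..<1 - x} s * (weight 0 (a - 1) s * (1 - x - s) powr (- a))) \<partial>lborel)"
        by (subst nn_integral_reflect) (auto intro!: nn_integral_cong simp: indicator_def weight_def algebra_simps)
      note reflected = this
      show "(\<integral>\<^sup>+s. ennreal (frac_kernel \<alpha> r x s) \<partial>jac (a - 1) (b - 1)) = ennreal (Beta a (1 - a))"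
      proof -
        have x': "0 < x" "x < 1" using x by auto
        show ?thesis
          using kernel_integral_split[OF x'] nn_integral_left_kernel_full[of a "1 - x"] x' a 3 reflected r0 by simp
      qed
    qed
  qed
qed

end

section \<open>The fractional operator on polynomials\<close>

definition frac_op :: "real \<Rightarrow> real \<Rightarrow> real \<Rightarrow> real poly \<Rightarrow> real \<Rightarrow> real" where
  "frac_op a b r p x = (LINT s|jac (a - 1) (b - 1). frac_kernel (a + b) r x s * poly p s)"

lemma frac_kernel_swap: "frac_kernel \<alpha> r x s = frac_kernel \<alpha> (1 - r) s x"
  by (simp add: frac_kernel_def)

text \<open>
The leading coefficient is recorded because the action of \<open>frac_op\<close> on leading coefficients is what is needed later.
\<close>

lemma poly_antiderivative:
  fixes P :: "real poly"
  assumes "degree P \<le> n"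
  shows "\<exists>Q. pderiv Q = P \<and> poly Q 0 = 0 \<and> degree Q \<le> Suc n \<and> coeff Q (Suc n) = coeff P n / real (Suc n)"
proof -
  define Q where "Q = (\<Sum>i\<le>n. monom (coeff P i / real (Suc i)) (Suc i))"
  have c: "coeff Q (Suc m) = (if m \<le> n then coeff P m / real (Suc m) else 0)" for m
    unfolding Q_def by (simp add: coeff_sum)
  have "pderiv Q = P"
  proof (rule poly_eqI)
    fix m
    show "coeff (pderiv Q) m = coeff P m"
      using coeff_eq_0[of P m] assms by (simp add: coeff_pderiv c)
  qed
  moreover have "poly Q 0 = 0" by (simp add: Q_def poly_sum poly_monom)
  moreover have "degree Q \<le> Suc n"
    unfolding Q_def by (intro degree_sum_le) (auto intro: order_trans[OF degree_monom_le])
  ultimately show ?thesis using c[of n] by auto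
qed

text \<open>
The kernel is singular at \<open>z = s\<close>, but \<open>z - s\<close> times the kernel is continuous there and vanishes.
\<close>

lemma kernel_FTC:
  assumes "0 < x" "\<alpha> < 2"
  shows "((\<lambda>z. (2 - \<alpha>) * frac_kernel \<alpha> r z s) has_integral
     (x - s) * frac_kernel \<alpha> r x s + s * frac_kernel \<alpha> r 0 s) {0..x}"
proof -
  have e1: "2 - \<alpha> - 1 = 1 - \<alpha>" by simp
  define \<phi> where "\<phi> z = r * max 0 (z - s) powr (2 - \<alpha>) - (1 - r) * max 0 (s - z) powr (2 - \<alpha>)" for z
  have p: "u powr (2 - \<alpha>) = u * u powr (1 - \<alpha>)" if "0 < u" for u :: real
  proof -
    have e: "2 - \<alpha> = 1 + (1 - \<alpha>)" by simp
    show ?thesis using that unfolding e powr_add by simp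
  qed
  have \<phi>: "\<phi> z = (z - s) * frac_kernel \<alpha> r z s" for z
  proof -
    consider "z < s" | "z = s" | "s < z" by linarith
    then show ?thesis
      by cases (auto simp: \<phi>_def frac_kernel_def p max_def algebra_simps)
  qed
  have "((\<lambda>z. (2 - \<alpha>) * frac_kernel \<alpha> r z s) has_integral (\<phi> x - \<phi> 0)) {0..x}"
  proof (rule fundamental_theorem_of_calculus_interior_strong[of "{s}"])
    show "continuous_on {0..x} \<phi>"
      unfolding \<phi>_def using assms
      by (intro continuous_on_diff continuous_on_mult continuous_on_powr' continuous_intros) auto
    fix z assume z: "z \<in> {0<..<x} - {s}"
    have "(\<phi> has_real_derivative (2 - \<alpha>) * frac_kernel \<alpha> r z s) (at z)"
    proof (cases "s < z")
      case True
      have "((\<lambda>z. r * (z - s) powr (2 - \<alpha>)) has_real_derivative (2 - \<alpha>) * frac_kernel \<alpha> r z s) (at z)"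
        using True by (auto intro!: derivative_eq_intros simp: frac_kernel_def e1)
      moreover have "\<forall>\<^sub>F y in nhds z. r * (y - s) powr (2 - \<alpha>) = \<phi> y"
        using eventually_nhds_in_open[of "{s<..}" z] True by (auto simp: \<phi>_def max_def elim!: eventually_mono)
      ultimately show ?thesis by (rule iffD1[OF DERIV_cong_ev[OF refl _ refl], rotated])
    next
      case False
      then have "z < s" using z by auto
      then have "((\<lambda>z. - (1 - r) * (s - z) powr (2 - \<alpha>)) has_real_derivative (2 - \<alpha>) * frac_kernel \<alpha> r z s) (at z)"
        by (auto intro!: derivative_eq_intros simp: frac_kernel_def e1 left_diff_distrib right_diff_distrib mult_ac)
      moreover have "\<forall>\<^sub>F y in nhds z. - (1 - r) * (s - y) powr (2 - \<alpha>) = \<phi> y"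
        using eventually_nhds_in_open[of "{..<s}" z] \<open>z < s\<close> by (auto simp: \<phi>_def max_def left_diff_distrib elim!: eventually_mono)
      ultimately show ?thesis by (rule iffD1[OF DERIV_cong_ev[OF refl _ refl], rotated])
    qed
    then show "(\<phi> has_vector_derivative (2 - \<alpha>) * frac_kernel \<alpha> r z s) (at z)"
      by (simp add: has_real_derivative_iff_has_vector_derivative)
  qed (use assms in auto)
  then show ?thesis by (simp add: \<phi>)
qed

lemma integral_lborel_poly:
  fixes Q :: "real poly"
  assumes "0 < x"
  shows "(LINT z|lborel. indicator {0<..<x} z * poly (pderiv Q) z) = poly Q x - poly Q 0"
proof -
  have "(LINT z|lborel. indicator {0<..<x} z * poly (pderiv Q) z) = (LINT z|lborel. poly (pderiv Q) z * indicator {0..x} z)"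
  proof (rule integral_cong_AE)
    have "AE z in lborel. z \<noteq> 0" "AE z in lborel. z \<noteq> x" by (rule AE_lborel_singleton)+
    then show "AE z in lborel. indicator {0<..<x} z * poly (pderiv Q) z = poly (pderiv Q) z * indicator {0..x} z"
      by eventually_elim (auto simp: indicator_def)
  qed measurable
  also have "\<dots> = poly Q x - poly Q 0"
    using assms by (intro integral_FTC_Icc_real) (auto intro!: poly_DERIV continuous_intros)
  finally show ?thesis .
qed

context frac_jacobi
begin

definition kernel_mass :: real where
  "kernel_mass = (SOME C. 0 < C \<and> (\<forall>x\<in>{0<..<1}. (\<integral>\<^sup>+s. ennreal (frac_kernel \<alpha> r x s) \<partial>jac (a - 1) (b - 1)) = ennreal C))"

lemma kernel_mass: "0 < kernel_mass"
    "0 < x \<Longrightarrow> x < 1 \<Longrightarrow> (\<integral>\<^sup>+s. ennreal (frac_kernel \<alpha> r x s) \<partial>jac (a - 1) (b - 1)) = ennreal kernel_mass"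
proof -
  have "\<exists>C. 0 < C \<and> (\<forall>x\<in>{0<..<1}. (\<integral>\<^sup>+s. ennreal (frac_kernel \<alpha> r x s) \<partial>jac (a - 1) (b - 1)) = ennreal C)"
    using kernel_integral_constant by blast
  note spec = someI_ex[OF this, folded kernel_mass_def]
  show "0 < kernel_mass" using spec by (rule conjunct1)
  show "(\<integral>\<^sup>+s. ennreal (frac_kernel \<alpha> r x s) \<partial>jac (a - 1) (b - 1)) = ennreal kernel_mass"
    if "0 < x" "x < 1"
    using spec that by (intro bspec[OF conjunct2[OF spec]]) simp
qed

text \<open>
This is \<open>kernel_mass\<close> times \<open>\<Gamma>(n + \<alpha> - 1) / (\<Gamma>(\<alpha> - 1) n!)\<close>.
\<close>

definition lead_factor :: "nat \<Rightarrow> real" where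
  "lead_factor n = kernel_mass * (\<Prod>k<n. (real k + \<alpha> - 1) / real (Suc k))"

lemma lead_factor_0 [simp]: "lead_factor 0 = kernel_mass" by (simp add: lead_factor_def)

lemma lead_factor_Suc: "lead_factor (Suc n) = lead_factor n * (real n + \<alpha> - 1) / real (Suc n)"
  by (simp add: lead_factor_def)

lemma lead_factor_pos: "0 < lead_factor n"
  unfolding lead_factor_def using kernel_mass(1) ab by (intro mult_pos_pos prod_pos divide_pos_pos) auto

text \<open>
The sequence \<open>(n + 1) lead_factor (n + 1)\<close> increases, since its consecutive quotients are \<open>(n + \<alpha>) / (n + 1) > 1\<close>.
\<close>

lemma lead_factor_lower_bound: "kernel_mass * (\<alpha> - 1) \<le> real (Suc n) * lead_factor (Suc n)"
proof (induction n)
  case 0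
  then show ?case by (simp add: lead_factor_Suc)
next
  case (Suc n)
  have "real (Suc n) * lead_factor (Suc n) \<le> (real (Suc n) + \<alpha> - 1) * lead_factor (Suc n)"
    using lead_factor_pos[of "Suc n"] ab by (intro mult_right_mono) auto
  also have "\<dots> = real (Suc (Suc n)) * lead_factor (Suc (Suc n))"
    by (simp add: lead_factor_Suc[of "Suc n"])
  finally show ?case using Suc by simp
qed

lemma kernel_integrable:
  assumes "0 < x" "x < 1"
  shows "integrable (jac (a - 1) (b - 1)) (frac_kernel \<alpha> r x)"
    and "(LINT s|jac (a - 1) (b - 1). frac_kernel \<alpha> r x s) = kernel_mass"
proof -
  show "integrable (jac (a - 1) (b - 1)) (frac_kernel \<alpha> r x)"
    using kernel_mass(2)[OF assms] by (intro integrableI_nonneg) (auto simp: frac_kernel_nonneg)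
  show "(LINT s|jac (a - 1) (b - 1). frac_kernel \<alpha> r x s) = kernel_mass"
    using kernel_mass(2)[OF assms] kernel_mass(1)
    by (intro integral_eq_nn_integral[THEN trans]) (auto simp: frac_kernel_nonneg)
qed

lemma kernel_poly_integrable:
  assumes "0 < x" "x < 1"
  shows "integrable (jac (a - 1) (b - 1)) (\<lambda>s. frac_kernel \<alpha> r x s * poly p s)"
proof -
  obtain B where B: "\<And>s. s \<in> {0<..<1} \<Longrightarrow> \<bar>poly p s\<bar> \<le> B" using poly_bounded_unit by blast
  show ?thesis
  proof (rule Bochner_Integration.integrable_bound)
    show "integrable (jac (a - 1) (b - 1)) (\<lambda>s. B * frac_kernel \<alpha> r x s)"
      using kernel_integrable[OF assms] by simp
    show "AE s in jac (a - 1) (b - 1). norm (frac_kernel \<alpha> r x s * poly p s) \<le> norm (B * frac_kernel \<alpha> r x s)"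
      using AE_jac_unit
    proof eventually_elim
      case (elim s)
      then have "\<bar>poly p s\<bar> \<le> \<bar>B\<bar>" using B[of s] by linarith
      then show ?case by (simp add: abs_mult mult.commute mult_right_mono)
    qed
  qed measurable
qed

lemma frac_op_smult_const: "0 < x \<Longrightarrow> x < 1 \<Longrightarrow> frac_op a b r [:c:] x = c * kernel_mass"
  using kernel_integrable(2)[of x] by (simp add: frac_op_def)

lemma frac_op_measurable [measurable]: "frac_op a b r p \<in> borel_measurable borel"
proof -
  interpret finite_measure "jac (a - 1) (b - 1)" using a b by (intro finite_measure_jac) auto
  show ?thesis unfolding frac_op_def[abs_def] by measurable
qed

text \<open>
Integrability comes from \<open>kernel_integral_constant\<close>: the integral of the kernel over \<open>s\<close> is bounded in \<open>z\<close>. The measure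
\<open>N\<close> is Lebesgue measure for the recursion and a Jacobi measure for the adjoint.
\<close>

lemma frac_op_Fubini:
  assumes N: "sigma_finite_measure N" "sets N = sets borel"
    and w: "integrable N (\<lambda>z. indicator {0<..<1} z * w z)"
  shows "(LINT s|jac (a - 1) (b - 1). (LINT z|N. indicator {0<..<1} z * w z * frac_kernel \<alpha> r z s) * poly p s) =
    (LINT z|N. indicator {0<..<1} z * w z * frac_op a b r p z)"
proof -
  note [measurable_cong] = N(2)
  define J where "J = jac (a - 1) (b - 1)"
  interpret J: finite_measure J unfolding J_def using a b by (intro finite_measure_jac) auto
  interpret N: sigma_finite_measure N by fact
  interpret P: pair_sigma_finite N J ..
  have setsJ[measurable_cong]: "sets J = sets borel" by (simp add: J_def)
  define v where "v z = indicator {0<..<1} z * w z" for z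
  have [measurable]: "v \<in> borel_measurable N" using w unfolding v_def by auto
  have v0: "v z = 0" if "z \<notin> {0<..<1}" for z using that by (simp add: v_def)
  obtain B where B: "\<And>s. s \<in> {0<..<1} \<Longrightarrow> \<bar>poly p s\<bar> \<le> B" using poly_bounded_unit by blast
  define f where "f = (\<lambda>(z, s). v z * (frac_kernel \<alpha> r z s * poly p s))"
  have fm[measurable]: "f \<in> borel_measurable (N \<Otimes>\<^sub>M J)" unfolding f_def by measurable
  have kp: "integrable J (\<lambda>s. v z * (frac_kernel \<alpha> r z s * poly p s))" for z
    using kernel_poly_integrable[of z p] v0[of z] by (cases "z \<in> {0<..<1}") (auto simp: J_def)
  have int: "integrable (N \<Otimes>\<^sub>M J) f"
  proof (rule P.Fubini_integrable)
    show "integrable N (\<lambda>z. LINT s|J. norm (f (z, s)))"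
    proof (rule Bochner_Integration.integrable_bound)
      show "integrable N (\<lambda>z. (B * kernel_mass) * v z)" using w unfolding v_def by simp
      show "AE z in N. norm (LINT s|J. norm (f (z, s))) \<le> norm ((B * kernel_mass) * v z)"
      proof (rule AE_I2)
        fix z
        show "norm (LINT s|J. norm (f (z, s))) \<le> norm ((B * kernel_mass) * v z)"
        proof (cases "z \<in> {0<..<1}")
          case True
          have k: "integrable J (frac_kernel \<alpha> r z)" "(LINT s|J. frac_kernel \<alpha> r z s) = kernel_mass"
            using kernel_integrable[of z] True by (auto simp: J_def)
          have "(LINT s|J. norm (f (z, s))) \<le> (LINT s|J. \<bar>v z\<bar> * B * frac_kernel \<alpha> r z s)"
          proof (rule integral_mono_AE)
            show "integrable J (\<lambda>s. norm (f (z, s)))" using kp[of z] by (simp add: f_def)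
            show "integrable J (\<lambda>s. \<bar>v z\<bar> * B * frac_kernel \<alpha> r z s)" using k by simp
            have "AE s in J. s \<in> {0<..<1}" unfolding J_def by (rule AE_jac_unit)
            then show "AE s in J. norm (f (z, s)) \<le> \<bar>v z\<bar> * B * frac_kernel \<alpha> r z s"
            proof eventually_elim
              case (elim s)
              have "\<bar>v z\<bar> * (frac_kernel \<alpha> r z s * \<bar>poly p s\<bar>) \<le> \<bar>v z\<bar> * (frac_kernel \<alpha> r z s * B)"
                by (intro mult_left_mono B elim frac_kernel_nonneg) auto
              then show ?case using frac_kernel_nonneg[of z s]
                by (simp add: f_def abs_mult mult_ac)
            qed
          qed
          also have "\<dots> = \<bar>v z\<bar> * B * kernel_mass" using k by simp
          finally have "(LINT s|J. norm (f (z, s))) \<le> \<bar>v z\<bar> * B * kernel_mass" .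
          moreover have "0 \<le> B" using B[of "1/2"] by auto
          moreover have "0 \<le> (LINT s|J. norm (f (z, s)))" by simp
          ultimately show ?thesis using kernel_mass(1) by (simp add: abs_mult mult_ac)
        qed (simp add: f_def v0)
      qed
    qed measurable
    show "AE z in N. integrable J (\<lambda>s. f (z, s))" using kp by (simp add: f_def)
  qed measurable
  have "(LINT s|J. (LINT z|N. f (z, s))) = (LINT z|N. (LINT s|J. f (z, s)))"
    using P.Fubini_integral[of "\<lambda>z s. f (z, s)"] int by simp
  moreover have "(LINT z|N. f (z, s)) = (LINT z|N. v z * frac_kernel \<alpha> r z s) * poly p s" for s
  proof -
    have "(LINT z|N. f (z, s)) = (LINT z|N. (v z * frac_kernel \<alpha> r z s) * poly p s)"
      by (simp add: f_def mult.assoc)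
    then show ?thesis by simp
  qed
  moreover have "(LINT s|J. f (z, s)) = v z * frac_op a b r p z" for z
    by (simp add: f_def frac_op_def J_def)
  ultimately show ?thesis by (simp add: v_def J_def)
qed

lemma frac_op_adjoint:
  "(LINT x|jac (b - 1) (a - 1). poly q x * frac_op a b r p x) =
   (LINT s|jac (a - 1) (b - 1). frac_op b a (1 - r) q s * poly p s)"
proof -
  interpret finite_measure "jac (b - 1) (a - 1)" using a b by (intro finite_measure_jac) auto
  have ind: "(LINT x|jac (b - 1) (a - 1). indicator {0<..<1} x * h x) = (LINT x|jac (b - 1) (a - 1). h x)"
    if [measurable]: "h \<in> borel_measurable borel" for h :: "real \<Rightarrow> real"
    using AE_jac_unit[of "b - 1" "a - 1"] by (intro integral_cong_AE) (measurable, auto elim: eventually_mono)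
  have "integrable (jac (b - 1) (a - 1)) (\<lambda>x. indicator {0<..<1} x *\<^sub>R poly q x)"
    using integrable_jac_poly[of "b - 1" "a - 1" q] a b by (intro integrable_mult_indicator) auto
  then have "integrable (jac (b - 1) (a - 1)) (\<lambda>x. indicator {0<..<1} x * poly q x)" by simp
  from frac_op_Fubini[OF sigma_finite_measure_axioms sets_jac this, of p]
  moreover have "(LINT z|jac (b - 1) (a - 1). indicator {0<..<1} z * poly q z * frac_op a b r p z) =
      (LINT z|jac (b - 1) (a - 1). poly q z * frac_op a b r p z)"
    using ind[of "\<lambda>z. poly q z * frac_op a b r p z"] by (simp add: mult.assoc)
  moreover have "(LINT z|jac (b - 1) (a - 1). indicator {0<..<1} z * poly q z * frac_kernel \<alpha> r z s) = frac_op b a (1 - r) q s" for s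
  proof -
    have "(LINT z|jac (b - 1) (a - 1). indicator {0<..<1} z * poly q z * frac_kernel \<alpha> r z s) =
        (LINT z|jac (b - 1) (a - 1). indicator {0<..<1} z * (poly q z * frac_kernel \<alpha> r z s))"
      by (simp only: mult.assoc)
    also have "\<dots> = (LINT z|jac (b - 1) (a - 1). poly q z * frac_kernel \<alpha> r z s)"
      by (rule ind) measurable
    also have "\<dots> = frac_op b a (1 - r) q s"
      unfolding frac_op_def frac_kernel_swap[of \<alpha> r] by (simp only: mult.commute add.commute)
    finally show ?thesis .
  qed
  ultimately show ?thesis by simp
qed

lemma kernel_integral_lborel:
  assumes "0 < x" "x < 1"
  shows "(LINT z|lborel. indicator {0<..<1} z * indicator {0<..<x} z * frac_kernel \<alpha> r z s) =
    ((x - s) * frac_kernel \<alpha> r x s + s * frac_kernel \<alpha> r 0 s) / (2 - \<alpha>)" (is "_ = ?R")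
proof -
  define f where "f z = indicator {0<..<1} z * indicator {0<..<x} z * frac_kernel \<alpha> r z s" for z
  have "((\<lambda>z. (2 - \<alpha>) * frac_kernel \<alpha> r z s / (2 - \<alpha>)) has_integral ?R) {0..x}"
    using kernel_FTC[OF assms(1) ab(2)] by (rule has_integral_divide)
  then have "((\<lambda>z. frac_kernel \<alpha> r z s) has_integral ?R) {0<..<x}"
    using ab by (simp add: has_integral_Icc_iff_Ioo)
  then have hi: "(f has_integral ?R) UNIV"
    by (subst (asm) has_integral_restrict_UNIV[symmetric])
       (erule has_integral_eq[rotated], use assms in \<open>simp add: indicator_def f_def\<close>)
  have f0: "0 \<le> f z" for z by (simp add: f_def frac_kernel_nonneg)
  have [measurable]: "f \<in> borel_measurable borel" unfolding f_def by measurable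
  have "(\<integral>\<^sup>+z. ennreal (f z) \<partial>lborel) = ennreal ?R"
    using hi f0 by (intro nn_integral_has_integral_lborel) auto
  moreover have "0 \<le> ?R" using hi f0 by (rule has_integral_nonneg)
  ultimately have "(LINT z|lborel. f z) = ?R"
    using f0 by (simp add: integral_eq_nn_integral)
  then show ?thesis by (simp add: f_def)
qed

text \<open>
Multiplication by \<open>s\<close> is multiplication by \<open>x\<close> minus multiplication by \<open>x - s\<close>, and the latter integrates the kernel.
\<close>

lemma frac_op_shift:
  fixes q :: "real poly"
  obtains C where "\<And>x. 0 < x \<Longrightarrow> x < 1 \<Longrightarrow> frac_op a b r (pCons 0 q) x =
    x * frac_op a b r q x - (2 - \<alpha>) * (LINT z|lborel. indicator {0<..<1} z * indicator {0<..<x} z * frac_op a b r q z) + C"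
proof
  define J where "J = jac (a - 1) (b - 1)"
  define C where "C = (LINT s|J. s * frac_kernel \<alpha> r 0 s * poly q s)"
  fix x :: real assume x: "0 < x" "x < 1"
  have k1: "integrable J (\<lambda>s. frac_kernel \<alpha> r x s * poly q s)"
    and k2: "integrable J (\<lambda>s. frac_kernel \<alpha> r x s * poly (pCons 0 q) s)"
    unfolding J_def using x by (intro kernel_poly_integrable; simp)+
  obtain B where B: "\<And>s. s \<in> {0<..<1} \<Longrightarrow> \<bar>poly q s\<bar> \<le> B" using poly_bounded_unit by blast
  have k3: "integrable J (\<lambda>s. s * frac_kernel \<alpha> r 0 s * poly q s)"
    unfolding J_def
  proof (rule integrable_jac_bounded[where B = B])
    fix s :: real assume s: "s \<in> {0<..<1}"
    have "s * frac_kernel \<alpha> r 0 s = (1 - r) * s powr (2 - \<alpha>)"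
    proof -
      have e: "2 - \<alpha> = 1 + (1 - \<alpha>)" by simp
      show ?thesis using s unfolding e powr_add by (simp add: frac_kernel_def)
    qed
    moreover have "s powr (2 - \<alpha>) \<le> 1" using s ab by (intro powr_le1) auto
    ultimately have "\<bar>s * frac_kernel \<alpha> r 0 s\<bar> \<le> 1"
      using r_bounds by (simp add: abs_mult mult_le_one)
    then have "\<bar>s * frac_kernel \<alpha> r 0 s\<bar> * \<bar>poly q s\<bar> \<le> 1 * B"
      using B[OF s] by (intro mult_mono) auto
    then show "\<bar>s * frac_kernel \<alpha> r 0 s * poly q s\<bar> \<le> B" by (simp add: abs_mult)
  qed (use a b in auto)
  have "integrable lborel (\<lambda>z. indicator {0<..<1} z * (indicator {0<..<x} z :: real))"
    by (rule integrable_real_mult_indicator) (auto simp: mult.commute)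
  from frac_op_Fubini[OF lborel.sigma_finite_measure_axioms sets_lborel this, of q]
  have "(2 - \<alpha>) * (LINT z|lborel. indicator {0<..<1} z * indicator {0<..<x} z * frac_op a b r q z) =
      (2 - \<alpha>) * (LINT s|J. ((x - s) * frac_kernel \<alpha> r x s + s * frac_kernel \<alpha> r 0 s) / (2 - \<alpha>) * poly q s)"
    unfolding kernel_integral_lborel[OF x] J_def by simp
  also have "\<dots> = (LINT s|J. (2 - \<alpha>) * (((x - s) * frac_kernel \<alpha> r x s + s * frac_kernel \<alpha> r 0 s) / (2 - \<alpha>) * poly q s))"
    by simp
  also have "\<dots> = (LINT s|J. x * (frac_kernel \<alpha> r x s * poly q s) - frac_kernel \<alpha> r x s * poly (pCons 0 q) s
      + s * frac_kernel \<alpha> r 0 s * poly q s)"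
  proof (intro Bochner_Integration.integral_cong refl)
    fix s
    have cancel: "c * (u / c * v) = u * v" if "c \<noteq> 0" for c u v :: real using that by simp
    have "2 - \<alpha> \<noteq> 0" using ab by simp
    then show "(2 - \<alpha>) * (((x - s) * frac_kernel \<alpha> r x s + s * frac_kernel \<alpha> r 0 s) / (2 - \<alpha>) * poly q s) =
        x * (frac_kernel \<alpha> r x s * poly q s) - frac_kernel \<alpha> r x s * poly (pCons 0 q) s + s * frac_kernel \<alpha> r 0 s * poly q s"
      unfolding cancel[OF \<open>2 - \<alpha> \<noteq> 0\<close>] by (simp add: algebra_simps)
  qed
  also have "\<dots> = x * frac_op a b r q x - frac_op a b r (pCons 0 q) x + C"
    using k1 k2 k3 by (simp add: frac_op_def C_def J_def)
  finally show "frac_op a b r (pCons 0 q) x = x * frac_op a b r q x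
      - (2 - \<alpha>) * (LINT z|lborel. indicator {0<..<1} z * indicator {0<..<x} z * frac_op a b r q z) + C"
    by simp
qed

text \<open>
Induction on the degree through \<open>frac_op_shift\<close>. On leading coefficients the recursion reads
\<open>1 - (2 - \<alpha>) / (n + 1) = (n + \<alpha> - 1) / (n + 1)\<close>.
\<close>

theorem frac_op_poly:
  assumes "degree p \<le> n"
  shows "\<exists>P. degree P \<le> n \<and> coeff P n = lead_factor n * coeff p n \<and> (\<forall>x\<in>{0<..<1}. frac_op a b r p x = poly P x)"
  using assms
proof (induction n arbitrary: p)
  case 0
  then obtain c where "p = [:c:]" by (auto elim: degree_eq_zeroE)
  then show ?case
    by (intro exI[of _ "[:c * kernel_mass:]"]) (auto simp: frac_op_smult_const)
next
  case (Suc n)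
  obtain c q where p: "p = pCons c q" by (cases p)
  then have "degree q \<le> n" using Suc.prems by (cases "q = 0") auto
  from Suc.IH[OF this] obtain P where P: "degree P \<le> n" "coeff P n = lead_factor n * coeff q n"
    "\<And>x. x \<in> {0<..<1} \<Longrightarrow> frac_op a b r q x = poly P x" by blast
  obtain Q where Q: "pderiv Q = P" "poly Q 0 = 0" "degree Q \<le> Suc n" "coeff Q (Suc n) = coeff P n / real (Suc n)"
    using poly_antiderivative[OF P(1)] by blast
  obtain C where C: "\<And>x. 0 < x \<Longrightarrow> x < 1 \<Longrightarrow> frac_op a b r (pCons 0 q) x =
    x * frac_op a b r q x - (2 - \<alpha>) * (LINT z|lborel. indicator {0<..<1} z * indicator {0<..<x} z * frac_op a b r q z) + C"
    using frac_op_shift[of q] by blast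
  \<comment> \<open>\<open>frac_op\<close> applied to \<open>c + s q(s)\<close>\<close>
  define R where "R = pCons (c * kernel_mass + C) P - smult (2 - \<alpha>) Q"
  show ?case
  proof (intro exI[of _ R] conjI ballI)
    show "degree R \<le> Suc n"
      unfolding R_def using P(1) Q(3) by (intro degree_diff_le) (auto simp: degree_pCons_le le_trans)
    show "coeff R (Suc n) = lead_factor (Suc n) * coeff p (Suc n)"
      by (simp add: R_def p P(2) Q(4) lead_factor_Suc field_simps)
    fix x :: real assume x: "x \<in> {0<..<1}"
    have "(LINT z|lborel. indicator {0<..<1} z * indicator {0<..<x} z * frac_op a b r q z) =
        (LINT z|lborel. indicator {0<..<x} z * poly (pderiv Q) z)"
      unfolding Q(1) using x by (intro Bochner_Integration.integral_cong) (auto simp: P(3) indicator_def)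
    also have "\<dots> = poly Q x" using integral_lborel_poly[of x Q] x Q(2) by simp
    finally have I: "(LINT z|lborel. indicator {0<..<1} z * indicator {0<..<x} z * frac_op a b r q z) = poly Q x" .
    have "frac_op a b r p x = frac_op a b r [:c:] x + frac_op a b r (pCons 0 q) x"
    proof -
      have "frac_op a b r p x = (LINT s|jac (a - 1) (b - 1). frac_kernel \<alpha> r x s * poly [:c:] s + frac_kernel \<alpha> r x s * poly (pCons 0 q) s)"
        unfolding frac_op_def p by (intro Bochner_Integration.integral_cong) (auto simp: algebra_simps)
      then show ?thesis
        using kernel_poly_integrable[of x "[:c:]"] kernel_poly_integrable[of x "pCons 0 q"] x
        unfolding frac_op_def by (subst (asm) Bochner_Integration.integral_add) auto
    qed
    also have "\<dots> = poly R x"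
    proof -
      have "frac_op a b r (pCons 0 q) x = x * poly P x - (2 - \<alpha>) * poly Q x + C"
        using x C[of x] unfolding I P(3)[OF x] by simp
      then show ?thesis using x by (simp add: frac_op_smult_const R_def)
    qed
    finally show "frac_op a b r p x = poly R x" .
  qed
qed

end

section \<open>Jacobi polynomials and their fluxes\<close>

lemma alternating_binomial_Suc:
  fixes f :: "nat \<Rightarrow> real"
  shows "(\<Sum>k\<le>Suc n. (-1)^k * real (Suc n choose k) * f k) =
    (\<Sum>k\<le>n. (-1)^k * real (n choose k) * (f k - f (Suc k)))"
proof -
  have "(\<Sum>k\<le>n. (-1)^k * real (n choose k) * f k) = (\<Sum>k\<le>Suc n. (-1)^k * real (n choose k) * f k)"
    by simp
  also have "\<dots> = f 0 + (\<Sum>k\<le>n. (-1)^Suc k * real (n choose Suc k) * f (Suc k))"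
    by (subst sum.atMost_Suc_shift) simp
  finally have "(\<Sum>k\<le>n. (-1)^k * real (n choose k) * f k) = \<dots>" .
  then show ?thesis
    by (subst sum.atMost_Suc_shift)
       (simp add: sum_subtractf sum.distrib sum_negf algebra_simps)
qed

text \<open>
An \<open>n\<close>-th finite difference annihilates polynomials of degree below \<open>n\<close>, here rising factorials.
\<close>

lemma alternating_binomial_pochhammer:
  fixes c :: real
  assumes "m < n"
  shows "(\<Sum>k\<le>n. (-1)^k * real (n choose k) * pochhammer (c - real k) m) = 0"
  using assms
proof (induction n arbitrary: m c)
  case (Suc n)
  have diff: "pochhammer z m - pochhammer (z - 1) m = real m * pochhammer z (m - 1)" for z :: real
  proof (cases m)
    case (Suc l)
    then show ?thesis
      using pochhammer_rec[of "z - 1" l] pochhammer_rec'[of z l] by (simp add: algebra_simps)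
  qed simp
  have "(\<Sum>k\<le>Suc n. (-1)^k * real (Suc n choose k) * pochhammer (c - real k) m) =
      (\<Sum>k\<le>n. (-1)^k * real (n choose k) * (real m * pochhammer (c - real k) (m - 1)))"
    unfolding alternating_binomial_Suc
  proof (intro sum.cong refl arg_cong2[where f = times])
    fix k
    have "c - real (Suc k) = c - real k - 1" by simp
    then show "pochhammer (c - real k) m - pochhammer (c - real (Suc k)) m = real m * pochhammer (c - real k) (m - 1)"
      using diff[of "c - real k"] by (simp only:)
  qed
  also have "\<dots> = real m * (\<Sum>k\<le>n. (-1)^k * real (n choose k) * pochhammer (c - real k) (m - 1))"
    by (simp add: sum_distrib_left mult_ac)
  also have "\<dots> = 0" using Suc.IH[of "m - 1" c] Suc.prems by (cases m) auto
  finally show ?case .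
qed simp

definition jacobi_poly :: "nat \<Rightarrow> real \<Rightarrow> real \<Rightarrow> real poly" where
  "jacobi_poly n a b = (\<Sum>k\<le>n. smult (((real n + a) gchoose (n - k)) * ((real n + b) gchoose k))
     ([:-1, 1:] ^ k * [:0, 1:] ^ (n - k)))"

lemma poly_jacobi_poly: "poly (jacobi_poly n a b) x = jacobi_G n a b x"
  unfolding jacobi_poly_def jacobi_G_def jacobi_P_def
proof -
  have "(2 * x - 1 - 1) / 2 = x - 1" "(2 * x - 1 + 1) / 2 = x" by (auto simp: field_simps)
  then show "poly (\<Sum>k\<le>n. smult (((real n + a) gchoose (n - k)) * ((real n + b) gchoose k))
      ([:-1, 1:] ^ k * [:0, 1:] ^ (n - k))) x =
    (\<Sum>k\<le>n. ((real n + a) gchoose (n - k)) * ((real n + b) gchoose k) *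
      ((2 * x - 1 - 1) / 2) ^ k * ((2 * x - 1 + 1) / 2) ^ (n - k))"
    by (simp only: poly_sum) (simp add: mult.assoc)
qed

lemma gchoose_Gamma:
  fixes a :: real
  assumes "-1 < a" "k \<le> n"
  shows "(real n + a) gchoose (n - k) = Gamma (a + real n + 1) / (fact (n - k) * Gamma (a + real k + 1))"
proof -
  have "(real n + a) gchoose (n - k) = pochhammer (a + real k + 1) (n - k) / fact (n - k)"
    using assms by (simp add: gbinomial_pochhammer' algebra_simps of_nat_diff)
  also have "pochhammer (a + real k + 1) (n - k) = Gamma (a + real k + 1 + real (n - k)) / Gamma (a + real k + 1)"
    using assms by (intro pochhammer_Gamma) (auto elim!: nonpos_Ints_cases)
  also have "a + real k + 1 + real (n - k) = a + real n + 1" using assms by simp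
  finally show ?thesis by simp
qed

lemma jacobi_poly_degree: "degree (jacobi_poly n a b) \<le> n"
  unfolding jacobi_poly_def
proof (intro degree_sum_le)
  fix k assume "k \<in> {..n}"
  have "degree ([:-1, 1:] ^ k * [:0, 1::real:] ^ (n - k)) \<le> degree ([:-1, 1::real:] ^ k) + degree ([:0, 1::real:] ^ (n - k))"
    by (rule degree_mult_le)
  also have "\<dots> \<le> k + (n - k)"
    by (intro add_mono) (auto simp: degree_power_eq)
  finally have "degree ([:-1, 1:] ^ k * [:0, 1::real:] ^ (n - k)) \<le> n" using \<open>k \<in> {..n}\<close> by simp
  then show "degree (smult (((real n + a) gchoose (n - k)) * ((real n + b) gchoose k))
      ([:-1, 1:] ^ k * [:0, 1:] ^ (n - k))) \<le> n"
    using degree_smult_le order_trans by blast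
qed auto

lemma gchoose_pos: "-1 < a \<Longrightarrow> k \<le> n \<Longrightarrow> 0 < (real n + a) gchoose (n - k)"
  by (simp add: gchoose_Gamma Gamma_real_pos)

lemma jacobi_poly_coeff_pos:
  assumes "-1 < a" "-1 < b"
  shows "0 < coeff (jacobi_poly n a b) n"
proof -
  have c: "coeff ([:-1, 1:] ^ k * [:0, 1::real:] ^ (n - k)) n = 1" if "k \<le> n" for k
  proof -
    have "degree ([:-1, 1:] ^ k * [:0, 1::real:] ^ (n - k)) = n"
      using that by (subst degree_mult_eq) (auto simp: degree_power_eq)
    then show ?thesis
      using lead_coeff_mult[of "[:-1, 1:] ^ k" "[:0, 1::real:] ^ (n - k)"] by (simp add: lead_coeff_power)
  qed
  have "coeff (jacobi_poly n a b) n = (\<Sum>k\<le>n. ((real n + a) gchoose (n - k)) * ((real n + b) gchoose k))"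
    unfolding jacobi_poly_def by (simp add: coeff_sum c)
  also have "\<dots> > 0"
  proof (rule sum_pos)
    fix k assume k: "k \<in> {..n}"
    then have "0 < (real n + b) gchoose (n - (n - k))" using assms by (intro gchoose_pos) auto
    then show "0 < ((real n + a) gchoose (n - k)) * ((real n + b) gchoose k)"
      using k gchoose_pos[of a k n] assms by simp
  qed auto
  finally show ?thesis .
qed

lemma integrable_jac_Bernstein:
  assumes "-1 < p" "-1 < q"
  shows "integrable (jac p q) (\<lambda>x. (1 - x)^k * x^j)"
proof -
  have "poly ([:1, -1:]^k * [:0, 1:]^j) = (\<lambda>x::real. (1 - x)^k * x^j)" by (simp add: fun_eq_iff)
  then show ?thesis using integrable_jac_poly[OF assms, of "[:1, -1:]^k * [:0, 1:]^j"] by simp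
qed

text \<open>
Termwise integration gives Beta values. After cancelling Gamma factors against the generalized binomial coefficients,
an \<open>n\<close>-th finite difference of a rising factorial of degree \<open>m\<close> remains.
\<close>

lemma jacobi_poly_moment:
  assumes "-1 < a" "-1 < b" "m < n"
  shows "(LINT x|jac a b. poly (jacobi_poly n a b) x * x ^ m) = 0"
proof -
  \<comment> \<open>the factors that do not depend on the summation index \<open>k\<close>\<close>
  define K where "K = Gamma (a + real n + 1) * Gamma (b + real n + 1) / (fact n * Gamma (a + b + real n + real m + 2))"
  have int: "integrable (jac a b) (\<lambda>x. (1 - x)^k * x^j)" for k j
    using assms by (intro integrable_jac_Bernstein)
  have "(LINT x|jac a b. poly (jacobi_poly n a b) x * x ^ m) =
      (LINT x|jac a b. (\<Sum>k\<le>n. (((real n + a) gchoose (n - k)) * ((real n + b) gchoose k) * (-1)^k) * ((1 - x)^k * x^(n - k + m))))"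
  proof (intro Bochner_Integration.integral_cong refl)
    fix x :: real
    have "(x - 1)^k = (-1)^k * (1 - x)^k" for k by (simp flip: power_mult_distrib)
    then have "poly ([:-1, 1:] ^ k * [:0, 1:] ^ (n - k)) x = (-1)^k * (1 - x)^k * x^(n - k)" for k by simp
    then show "poly (jacobi_poly n a b) x * x ^ m =
        (\<Sum>k\<le>n. (((real n + a) gchoose (n - k)) * ((real n + b) gchoose k) * (-1)^k) * ((1 - x)^k * x^(n - k + m)))"
      unfolding jacobi_poly_def poly_sum poly_smult sum_distrib_right power_add
      by (intro sum.cong refl) (simp only: mult_ac)
  qed
  also have "\<dots> = (\<Sum>k\<le>n. (((real n + a) gchoose (n - k)) * ((real n + b) gchoose k) * (-1)^k) *
      Beta (b + real (n - k + m) + 1) (a + real k + 1))"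
    using int assms by (simp add: Bochner_Integration.integral_sum integral_jac_moment)
  also have "\<dots> = (\<Sum>k\<le>n. K * ((-1)^k * real (n choose k) * pochhammer ((b + real n + 1) - real k) m))"
  proof (intro sum.cong refl)
    fix k assume "k \<in> {..n}"
    then have k: "k \<le> n" by simp
    have e1: "(real n + a) gchoose (n - k) = Gamma (a + real n + 1) / (fact (n - k) * Gamma (a + real k + 1))"
      using assms k by (intro gchoose_Gamma) auto
    have e2: "(real n + b) gchoose k = Gamma (b + real n + 1) / (fact k * Gamma (b + real n + 1 - real k))"
      using gchoose_Gamma[of b "n - k" n] assms k by (simp add: of_nat_diff algebra_simps)
    have e3: "pochhammer ((b + real n + 1) - real k) m = Gamma ((b + real n + 1) - real k + real m) / Gamma ((b + real n + 1) - real k)"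
      using assms k by (intro pochhammer_Gamma) (auto elim!: nonpos_Ints_cases)
    have e4: "Beta (b + real (n - k + m) + 1) (a + real k + 1) =
        Gamma ((b + real n + 1) - real k + real m) * Gamma (a + real k + 1) / Gamma (a + b + real n + real m + 2)"
      using k by (simp add: Beta_def of_nat_diff algebra_simps)
    have e5: "real (n choose k) = fact n / (fact k * fact (n - k))"
      using k by (rule binomial_fact)
    have g: "Gamma (a + real k + 1) > 0" using assms by (intro Gamma_real_pos) auto
    show "(((real n + a) gchoose (n - k)) * ((real n + b) gchoose k) * (-1)^k) *
        Beta (b + real (n - k + m) + 1) (a + real k + 1) =
        K * ((-1)^k * real (n choose k) * pochhammer ((b + real n + 1) - real k) m)"
      unfolding e1 e2 e3 e4 e5 K_def using g by (simp add: mult_ac)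
  qed
  also have "\<dots> = 0"
    using alternating_binomial_pochhammer[OF assms(3), of "b + real n + 1"]
    by (simp flip: sum_distrib_left)
  finally show ?thesis .
qed

lemma jacobi_poly_orthogonal:
  assumes "-1 < a" "-1 < b" "degree P < n"
  shows "(LINT x|jac a b. poly (jacobi_poly n a b) x * poly P x) = 0"
proof -
  have int: "integrable (jac a b) (\<lambda>x. poly (jacobi_poly n a b) x * x ^ i)" for i
    using integrable_jac_poly_mult[of a b "jacobi_poly n a b" "[:0, 1:]^i"] assms by simp
  have "(LINT x|jac a b. poly (jacobi_poly n a b) x * poly P x) =
      (LINT x|jac a b. (\<Sum>i\<le>degree P. coeff P i * (poly (jacobi_poly n a b) x * x ^ i)))"
    by (intro Bochner_Integration.integral_cong refl)
       (simp add: poly_altdef[of P] sum_distrib_left mult_ac)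
  also have "\<dots> = (\<Sum>i\<le>degree P. coeff P i * (LINT x|jac a b. poly (jacobi_poly n a b) x * x ^ i))"
    using int by (simp add: Bochner_Integration.integral_sum)
  also have "\<dots> = 0"
    using assms by (intro sum.neutral) (auto simp: jacobi_poly_moment)
  finally show ?thesis .
qed

text \<open>
Against a polynomial \<open>G\<close> that is orthogonal to lower degrees, only the leading coefficient of \<open>P\<close> matters. This
computes norms without any explicit formula for the polynomials.
\<close>

lemma integral_orthogonal_lead:
  fixes G P :: "real poly"
  assumes pq: "-1 < p" "-1 < q"
    and orth: "\<And>R. degree R < n \<Longrightarrow> (LINT x|jac p q. poly G x * poly R x) = 0"
    and G: "degree G \<le> n" and P: "degree P \<le> n" and c: "coeff P n = c * coeff G n"
  shows "(LINT x|jac p q. poly G x * poly P x) = c * (LINT x|jac p q. (poly G x)\<^sup>2)"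
proof -
  define R where "R = P - smult c G"
  have "degree R \<le> n" unfolding R_def using G P by (intro degree_diff_le) auto
  moreover have "coeff R n = 0" by (simp add: R_def c)
  ultimately have "R = 0 \<or> degree R < n"
    by (metis leading_coeff_0_iff le_neq_implies_less)
  then have "(LINT x|jac p q. poly G x * poly R x) = 0" using orth by auto
  moreover have "(LINT x|jac p q. poly G x * poly R x) =
      (LINT x|jac p q. poly G x * poly P x - c * (poly G x * poly G x))"
    by (simp add: R_def algebra_simps)
  moreover have "\<dots> = (LINT x|jac p q. poly G x * poly P x) - c * (LINT x|jac p q. poly G x * poly G x)"
    using integrable_jac_poly_mult[OF pq] by simp
  ultimately show ?thesis by (simp add: power2_eq_square)
qed

text \<open>
The polynomial factor of the derivative of \<open>weight a b\<close> times \<open>G\<close>, see \<open>DERIV_weight_poly\<close>.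
\<close>

definition weighted_deriv :: "real \<Rightarrow> real \<Rightarrow> real poly \<Rightarrow> real poly" where
  "weighted_deriv a b G = [:b, -(a + b):] * G + [:0, 1, -1:] * pderiv G"

lemma weight_shift:
  assumes "0 < x" "x < 1"
  shows "weight a b x = weight (a - 1) (b - 1) x * (x * (1 - x))"
  using assms powr_add[of x "b - 1" 1] powr_add[of "1 - x" "a - 1" 1] by (simp add: weight_def)

lemma DERIV_weight_poly:
  assumes "0 < x" "x < 1"
  shows "((\<lambda>x. weight a b x * poly G x) has_real_derivative
    weight (a - 1) (b - 1) x * poly (weighted_deriv a b G) x) (at x)"
proof -
  have "((\<lambda>x. (1 - x) powr a * x powr b * poly G x) has_real_derivative
    ((a * (1 - x) powr (a - 1) * (-1)) * x powr b + (1 - x) powr a * (b * x powr (b - 1))) * poly G x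
     + (1 - x) powr a * x powr b * poly (pderiv G) x) (at x)"
    using assms by (auto intro!: derivative_eq_intros poly_DERIV)
  also have "((a * (1 - x) powr (a - 1) * (-1)) * x powr b + (1 - x) powr a * (b * x powr (b - 1))) * poly G x
     + (1 - x) powr a * x powr b * poly (pderiv G) x = weight (a - 1) (b - 1) x * poly (weighted_deriv a b G) x"
  proof -
    have "x powr b = x powr (b - 1) * x" "(1 - x) powr a = (1 - x) powr (a - 1) * (1 - x)"
      using assms powr_add[of x "b - 1" 1] powr_add[of "1 - x" "a - 1" 1] by auto
    then show ?thesis
      by (simp only:) (simp add: weight_def weighted_deriv_def algebra_simps)
  qed
  finally show ?thesis by (simp add: weight_def)
qed

lemma weighted_deriv_add: "weighted_deriv a b (G + H) = weighted_deriv a b G + weighted_deriv a b H"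
  unfolding weighted_deriv_def pderiv_add distrib_left by (simp only: ac_simps)

lemma weighted_deriv_smult: "weighted_deriv a b (smult c G) = smult c (weighted_deriv a b G)"
  unfolding weighted_deriv_def pderiv_smult mult_smult_right smult_add_right ..

lemma weighted_deriv_sum: "weighted_deriv a b (\<Sum>j\<in>A. H j) = (\<Sum>j\<in>A. weighted_deriv a b (H j))"
proof (induction A rule: infinite_finite_induct)
  case (insert j A)
  then show ?case by (simp only: sum.insert weighted_deriv_add simp_thms)
qed (simp_all add: weighted_deriv_def)

lemma weighted_deriv_mult:
  "weighted_deriv a b (G * P) = weighted_deriv a b G * P + [:0, 1, -1:] * (G * pderiv P)"
  by (simp add: weighted_deriv_def pderiv_mult algebra_simps)

lemma weighted_deriv_degree: "degree G \<le> n \<Longrightarrow> degree (weighted_deriv a b G) \<le> Suc n"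
  and weighted_deriv_coeff: "degree G \<le> n \<Longrightarrow>
    coeff (weighted_deriv a b G) (Suc n) = - (a + b + real n) * coeff G n"
proof -
  assume G: "degree G \<le> n"
  have d: "degree (pderiv G) \<le> n - 1" using G by (simp add: degree_pderiv)
  have pd: "[:0, 1, -1:] * pderiv G = pCons 0 (pderiv G) - pCons 0 (pCons 0 (pderiv G))" by simp
  have bG: "[:b, -(a + b):] * G = smult b G + pCons 0 (smult (-(a + b)) G)" by simp
  have z: "coeff G (Suc n) = 0" "coeff G (Suc (Suc n)) = 0" using G by (auto intro: coeff_eq_0)
  show "degree (weighted_deriv a b G) \<le> Suc n"
  proof (rule degree_le, intro allI impI)
    fix i assume "Suc n < i"
    define j where "j = i - 2"
    have j: "i = Suc (Suc j)" "n \<le> j" using \<open>Suc n < i\<close> by (auto simp: j_def)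
    have "coeff G (Suc j) = 0" "coeff G (Suc (Suc j)) = 0" using G j by (auto intro: coeff_eq_0)
    then show "coeff (weighted_deriv a b G) i = 0"
      unfolding weighted_deriv_def pd bG by (simp add: j coeff_pderiv)
  qed
  show "coeff (weighted_deriv a b G) (Suc n) = - (a + b + real n) * coeff G n"
    unfolding weighted_deriv_def pd bG using z
    by (cases n) (simp_all add: coeff_pderiv algebra_simps)
qed

text \<open>
The integral of the derivative of a function that vanishes at both ends. For monomials this is the functional equation
of the Beta function, which avoids boundary terms.
\<close>

lemma integral_weighted_deriv:
  assumes "0 < a" "0 < b"
  shows "(LINT x|jac (a - 1) (b - 1). poly (weighted_deriv a b H) x) = 0"
proof -
  have pq: "-1 < a - 1" "-1 < b - 1" using assms by auto
  have mono: "(LINT x|jac (a - 1) (b - 1). poly (weighted_deriv a b (monom 1 j)) x) = 0" for j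
  proof -
    have "poly (weighted_deriv a b (monom 1 j)) x = (b + real j) * ((1 - x)^0 * x^j) - (a + b + real j) * ((1 - x)^0 * x^Suc j)" for x
      by (cases j) (simp_all add: weighted_deriv_def poly_monom pderiv_monom algebra_simps)
    moreover have "integrable (jac (a - 1) (b - 1)) (\<lambda>x. (1 - x)^0 * x^j)" for j
      by (rule integrable_jac_Bernstein[OF pq])
    ultimately have "(LINT x|jac (a - 1) (b - 1). poly (weighted_deriv a b (monom 1 j)) x) =
        (b + real j) * Beta (b - 1 + real j + 1) (a - 1 + real 0 + 1) - (a + b + real j) * Beta (b - 1 + real (Suc j) + 1) (a - 1 + real 0 + 1)"
      by (simp only: Bochner_Integration.integral_diff integrable_mult_right integral_mult_right_zero integral_jac_moment[OF pq])
    also have "\<dots> = (b + real j) * Beta (b + real j) a - (a + b + real j) * Beta (b + real j + 1) a"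
      by (simp add: algebra_simps)
    also have "\<dots> = 0"
      using Beta_plus1_left[of "b + real j" a] assms by (force simp: algebra_simps elim!: nonpos_Ints_cases)
    finally show ?thesis .
  qed
  have "poly (weighted_deriv a b H) x = (\<Sum>j\<le>degree H. coeff H j * poly (weighted_deriv a b (monom 1 j)) x)" for x
  proof -
    have "weighted_deriv a b (\<Sum>j\<le>N. smult (coeff H j) (monom 1 j)) = (\<Sum>j\<le>N. smult (coeff H j) (weighted_deriv a b (monom 1 j)))" for N
      by (simp only: weighted_deriv_sum weighted_deriv_smult)
    moreover have "(\<Sum>j\<le>degree H. smult (coeff H j) (monom 1 j)) = H"
      by (simp add: smult_monom poly_as_sum_of_monoms)
    ultimately have "weighted_deriv a b H = (\<Sum>j\<le>degree H. smult (coeff H j) (weighted_deriv a b (monom 1 j)))" by metis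
    then show ?thesis by (simp add: poly_sum)
  qed
  then show ?thesis using integrable_jac_poly[OF pq] by (simp add: Bochner_Integration.integral_sum mono)
qed

lemma integral_by_parts_jac:
  assumes "0 < a" "0 < b"
  shows "(LINT x|jac (a - 1) (b - 1). poly (weighted_deriv a b G) x * poly P x) =
    - (LINT x|jac a b. poly G x * poly (pderiv P) x)"
proof -
  have pq: "-1 < a - 1" "-1 < b - 1" using assms by auto
  have "0 = (LINT x|jac (a - 1) (b - 1). poly (weighted_deriv a b G) x * poly P x + poly ([:0, 1, -1:] * (G * pderiv P)) x)"
    using integral_weighted_deriv[OF assms, of "G * P"] by (simp add: weighted_deriv_mult)
  also have "\<dots> = (LINT x|jac (a - 1) (b - 1). poly (weighted_deriv a b G) x * poly P x) +
      (LINT x|jac (a - 1) (b - 1). poly ([:0, 1, -1:] * (G * pderiv P)) x)"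
    by (intro Bochner_Integration.integral_add integrable_jac_poly_mult integrable_jac_poly pq)
  also have "(LINT x|jac (a - 1) (b - 1). poly ([:0, 1, -1:] * (G * pderiv P)) x) = (LINT x|jac a b. poly G x * poly (pderiv P) x)"
    by (subst (1 2) integral_jac)
       (auto intro!: Bochner_Integration.integral_cong simp: indicator_def weight_shift[of _ a b] algebra_simps)
  finally show ?thesis by simp
qed

context frac_jacobi
begin

definition jacobi_norm_sq :: "nat \<Rightarrow> real" where
  "jacobi_norm_sq n = (LINT x|jac a b. (poly (jacobi_poly n a b) x)\<^sup>2)"

text \<open>
The polynomial factor of the derivative of the \<open>n\<close>-th basis function of the trial space. Up to a constant it is the
Jacobi polynomial of degree \<open>n + 1\<close> with both parameters lowered by one.
\<close>

definition jacobi_deriv :: "nat \<Rightarrow> real poly" where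
  "jacobi_deriv n = weighted_deriv a b (jacobi_poly n a b)"

lemma exponents: "-1 < a" "-1 < b" "-1 < a - 1" "-1 < b - 1"
  using a b by auto

lemma jacobi_norm_sq_pos: "0 < jacobi_norm_sq n"
  unfolding jacobi_norm_sq_def using jacobi_poly_coeff_pos[of a b n] exponents
  by (intro integral_jac_poly_square_pos) auto

lemma jacobi_deriv_degree: "degree (jacobi_deriv n) \<le> Suc n"
  unfolding jacobi_deriv_def by (intro weighted_deriv_degree jacobi_poly_degree)

lemma jacobi_deriv_coeff: "coeff (jacobi_deriv n) (Suc n) = - (\<alpha> + real n) * coeff (jacobi_poly n a b) n"
  unfolding jacobi_deriv_def by (rule weighted_deriv_coeff[OF jacobi_poly_degree])

lemma jacobi_deriv_coeff_neg: "coeff (jacobi_deriv n) (Suc n) < 0"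
  unfolding jacobi_deriv_coeff using jacobi_poly_coeff_pos[of a b n] exponents ab
  by (intro mult_neg_pos) auto

lemma jacobi_deriv_orthogonal:
  assumes "degree P < Suc n"
  shows "(LINT x|jac (a - 1) (b - 1). poly (jacobi_deriv n) x * poly P x) = 0"
proof (cases "pderiv P = 0")
  case True
  then show ?thesis unfolding jacobi_deriv_def integral_by_parts_jac[OF a(1) b(1)] by simp
next
  case False
  then have "degree (pderiv P) < n" using assms pderiv_eq_0_iff[of P] by (simp add: degree_pderiv)
  then show ?thesis unfolding jacobi_deriv_def integral_by_parts_jac[OF a(1) b(1)]
    using exponents by (simp add: jacobi_poly_orthogonal)
qed

text \<open>
One integration by parts; only the leading coefficient of the derivative of \<open>jacobi_deriv n\<close> contributes.
\<close>

lemma jacobi_deriv_norm: "(LINT x|jac (a - 1) (b - 1). (poly (jacobi_deriv n) x)\<^sup>2) = real (Suc n) * (real n + \<alpha>) * jacobi_norm_sq n"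
proof -
  have "(LINT x|jac (a - 1) (b - 1). (poly (jacobi_deriv n) x)\<^sup>2) =
      - (LINT x|jac a b. poly (jacobi_poly n a b) x * poly (pderiv (jacobi_deriv n)) x)"
    unfolding power2_eq_square using integral_by_parts_jac[OF a(1) b(1), of "jacobi_poly n a b" "jacobi_deriv n"]
    by (simp add: jacobi_deriv_def)
  also have "(LINT x|jac a b. poly (jacobi_poly n a b) x * poly (pderiv (jacobi_deriv n)) x) =
      (- real (Suc n) * (real n + \<alpha>)) * jacobi_norm_sq n"
    unfolding jacobi_norm_sq_def
  proof (rule integral_orthogonal_lead[where n = n])
    show "degree (pderiv (jacobi_deriv n)) \<le> n" using jacobi_deriv_degree[of n] by (simp add: degree_pderiv)
    show "coeff (pderiv (jacobi_deriv n)) n = (- real (Suc n) * (real n + \<alpha>)) * coeff (jacobi_poly n a b) n"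
      by (simp add: coeff_pderiv jacobi_deriv_coeff algebra_simps)
  qed (use exponents jacobi_poly_orthogonal jacobi_poly_degree in auto)
  finally show ?thesis by (simp del: of_nat_Suc)
qed

definition flux_poly :: "nat \<Rightarrow> real poly" where
  "flux_poly n = (SOME P. degree P \<le> Suc n \<and> coeff P (Suc n) = lead_factor (Suc n) * coeff (jacobi_deriv n) (Suc n) \<and>
     (\<forall>x\<in>{0<..<1}. frac_op a b r (jacobi_deriv n) x = poly P x))"

lemma flux_poly: "degree (flux_poly n) \<le> Suc n"
    "coeff (flux_poly n) (Suc n) = lead_factor (Suc n) * coeff (jacobi_deriv n) (Suc n)"
    "\<And>x. x \<in> {0<..<1} \<Longrightarrow> frac_op a b r (jacobi_deriv n) x = poly (flux_poly n) x"
proof -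
  note spec = someI_ex[OF frac_op_poly[OF jacobi_deriv_degree[of n]], folded flux_poly_def]
  show "degree (flux_poly n) \<le> Suc n"
    "coeff (flux_poly n) (Suc n) = lead_factor (Suc n) * coeff (jacobi_deriv n) (Suc n)"
    "\<And>x. x \<in> {0<..<1} \<Longrightarrow> frac_op a b r (jacobi_deriv n) x = poly (flux_poly n) x"
    using spec by blast+
qed

lemma flux_poly_inner:
  "(LINT x|jac (b - 1) (a - 1). poly R x * poly (flux_poly n) x) =
   (LINT s|jac (a - 1) (b - 1). frac_op b a (1 - r) R s * poly (jacobi_deriv n) s)"
proof -
  have "(LINT x|jac (b - 1) (a - 1). poly R x * poly (flux_poly n) x) =
      (LINT x|jac (b - 1) (a - 1). poly R x * frac_op a b r (jacobi_deriv n) x)"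
  proof (rule integral_cong_AE)
    show "AE x in jac (b - 1) (a - 1). poly R x * poly (flux_poly n) x = poly R x * frac_op a b r (jacobi_deriv n) x"
      using AE_jac_unit by eventually_elim (simp add: flux_poly(3))
  qed measurable
  then show ?thesis by (simp add: frac_op_adjoint)
qed

interpretation swap: frac_jacobi b a "1 - r" by (rule swapped)

lemma swap_frac_op_integral:
  assumes "\<forall>x\<in>{0<..<1}. frac_op b a (1 - r) R x = poly S x"
  shows "(LINT s|jac (a - 1) (b - 1). frac_op b a (1 - r) R s * poly P s) =
    (LINT s|jac (a - 1) (b - 1). poly P s * poly S s)"
proof (rule integral_cong_AE)
  show "AE s in jac (a - 1) (b - 1). frac_op b a (1 - r) R s * poly P s = poly P s * poly S s"
    using AE_jac_unit by eventually_elim (simp add: assms)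
qed measurable

text \<open>
Move the operator to the other factor: its adjoint keeps the degree of \<open>R\<close>, and \<open>jacobi_deriv n\<close> is orthogonal to that
degree.
\<close>

lemma flux_poly_orthogonal:
  assumes "degree R \<le> n"
  shows "(LINT x|jac (b - 1) (a - 1). poly R x * poly (flux_poly n) x) = 0"
proof -
  obtain S where S: "degree S \<le> n" "\<forall>x\<in>{0<..<1}. frac_op b a (1 - r) R x = poly S x"
    using swap.frac_op_poly[OF assms] by blast
  show ?thesis
    unfolding flux_poly_inner swap_frac_op_integral[OF S(2)]
    using S(1) by (intro jacobi_deriv_orthogonal) auto
qed

text \<open>
Applying the operator and then its adjoint multiplies the leading coefficient by both factors, and all other
coefficients are invisible to \<open>jacobi_deriv n\<close>.
\<close>

lemma flux_poly_norm:
  "(LINT x|jac (b - 1) (a - 1). (poly (flux_poly n) x)\<^sup>2) =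
    swap.lead_factor (Suc n) * lead_factor (Suc n) * (real (Suc n) * (real n + \<alpha>)) * jacobi_norm_sq n"
proof -
  obtain S where S: "degree S \<le> Suc n" "coeff S (Suc n) = swap.lead_factor (Suc n) * coeff (flux_poly n) (Suc n)"
    "\<forall>x\<in>{0<..<1}. frac_op b a (1 - r) (flux_poly n) x = poly S x"
    using swap.frac_op_poly[OF flux_poly(1)[of n]] by blast
  have "(LINT x|jac (b - 1) (a - 1). (poly (flux_poly n) x)\<^sup>2) =
      (LINT s|jac (a - 1) (b - 1). poly (jacobi_deriv n) s * poly S s)"
    unfolding power2_eq_square flux_poly_inner swap_frac_op_integral[OF S(3)] ..
  also have "\<dots> = (swap.lead_factor (Suc n) * lead_factor (Suc n)) * (LINT x|jac (a - 1) (b - 1). (poly (jacobi_deriv n) x)\<^sup>2)"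
    using S(1,2) exponents jacobi_deriv_orthogonal jacobi_deriv_degree
    by (intro integral_orthogonal_lead[where n = "Suc n"]) (auto simp: flux_poly(2))
  finally show ?thesis by (simp add: jacobi_deriv_norm)
qed

lemma flux_poly_norm_lower_bound:
  "kernel_mass * (\<alpha> - 1) * (swap.kernel_mass * (\<alpha> - 1)) * jacobi_norm_sq n \<le> (LINT x|jac (b - 1) (a - 1). (poly (flux_poly n) x)\<^sup>2)"
proof -
  have "kernel_mass * (\<alpha> - 1) * (swap.kernel_mass * (\<alpha> - 1)) \<le> (real (Suc n) * lead_factor (Suc n)) * (real (Suc n) * swap.lead_factor (Suc n))"
    using lead_factor_lower_bound[of n] swap.lead_factor_lower_bound[of n] kernel_mass(1) swap.kernel_mass(1) ab lead_factor_pos[of "Suc n"]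
    by (intro mult_mono[of "kernel_mass * (\<alpha> - 1)" _ "swap.kernel_mass * (\<alpha> - 1)"]) (auto simp: add.commute)
  also have "\<dots> = swap.lead_factor (Suc n) * lead_factor (Suc n) * (real (Suc n) * real (Suc n))" by (simp only: mult_ac)
  also have "\<dots> \<le> swap.lead_factor (Suc n) * lead_factor (Suc n) * (real (Suc n) * (real n + \<alpha>))"
    using lead_factor_pos[of "Suc n"] swap.lead_factor_pos[of "Suc n"] ab
    by (intro mult_left_mono mult_nonneg_nonneg) auto
  finally show ?thesis
    unfolding flux_poly_norm using jacobi_norm_sq_pos[of n] by (intro mult_right_mono) auto
qed

end

section \<open>Lebesgue measurable functions and the primitive of the data\<close>

lemma sq_int_cong:
  assumes "\<And>x. x \<in> space M \<Longrightarrow> f x = g x"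
  shows "f \<in> sq_int M \<longleftrightarrow> g \<in> sq_int M"
proof -
  have "f \<in> borel_measurable M \<longleftrightarrow> g \<in> borel_measurable M"
    using assms by (rule measurable_cong)
  moreover have "integrable M (\<lambda>x. (f x)\<^sup>2) \<longleftrightarrow> integrable M (\<lambda>x. (g x)\<^sup>2)"
    by (intro Bochner_Integration.integrable_cong refl) (simp add: assms)
  ultimately show ?thesis by (simp add: sq_int_def)
qed

text \<open>
The weight as a measure on the Lebesgue measurable subsets of the unit interval, so that the weighted spaces of the
problem are spaces \<open>sq_int\<close>. Borel functions have the same integrals for \<open>ljac\<close> and \<open>jac\<close>.
\<close>

definition ljac :: "real \<Rightarrow> real \<Rightarrow> real measure" where
  "ljac p q = density unit_measure (\<lambda>x. ennreal (weight p q x))"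

lemma unit_measure_borel: "f \<in> borel_measurable borel \<Longrightarrow> f \<in> borel_measurable unit_measure"
  by (intro measurable_restrict_space1 measurable_completion) simp

lemma sets_ljac [measurable_cong, simp]: "sets (ljac p q) = sets unit_measure"
  by (simp add: ljac_def)

lemma space_ljac [simp]: "space (ljac p q) = {0<..<1}"
  by (simp add: ljac_def)

lemma measurable_ljac: "borel_measurable (ljac p q) = borel_measurable unit_measure"
  by (rule measurable_cong_sets) simp_all

lemma ljac_borel: "f \<in> borel_measurable borel \<Longrightarrow> f \<in> borel_measurable (ljac p q)"
  by (simp only: measurable_ljac unit_measure_borel)

lemma AE_ljac: "(AE x in ljac p q. P x) \<longleftrightarrow> (AE x in unit_measure. P x)"
proof -
  have "(AE x in ljac p q. P x) \<longleftrightarrow> (AE x in unit_measure. 0 < ennreal (weight p q x) \<longrightarrow> P x)"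
    unfolding ljac_def by (intro AE_density measurable_compose[OF unit_measure_borel[OF weight_borel]]) simp
  also have "\<dots> \<longleftrightarrow> (AE x in unit_measure. P x)"
    by (rule AE_cong) (simp add: weight_pos)
  finally show ?thesis .
qed

lemma AE_unit_lborel: "(AE x in unit_measure. P x) \<longleftrightarrow> (AE x in lborel. x \<in> {0<..<1} \<longrightarrow> P x)"
  by (subst AE_restrict_space_iff) (auto simp: AE_completion_iff)

lemma integrable_ljac_iff:
  fixes g :: "real \<Rightarrow> real"
  assumes "g \<in> borel_measurable unit_measure"
  shows "integrable (ljac p q) g \<longleftrightarrow> integrable unit_measure (\<lambda>x. weight p q x * g x)"
  unfolding ljac_def using assms unit_measure_borel[OF weight_borel]
  by (intro integrable_real_density) (auto simp: weight_nonneg)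

lemma integral_ljac_weight:
  fixes g :: "real \<Rightarrow> real"
  assumes "g \<in> borel_measurable unit_measure"
  shows "(LINT x|ljac p q. g x) = (LINT x|unit_measure. weight p q x * g x)"
  unfolding ljac_def using assms unit_measure_borel[OF weight_borel]
  by (intro integral_real_density) (auto simp: weight_nonneg)

lemma integral_unit_lborel:
  fixes f :: "real \<Rightarrow> real"
  assumes "f \<in> borel_measurable borel"
  shows "(LINT x|unit_measure. f x) = (LINT x|lborel. indicator {0<..<1} x * f x)"
    and "integrable unit_measure f \<longleftrightarrow> integrable lborel (\<lambda>x. indicator {0<..<1} x * f x)"
proof -
  have [measurable]: "(\<lambda>x. indicator {0<..<1} x * f x) \<in> borel_measurable lborel"
    using assms by simp
  show "(LINT x|unit_measure. f x) = (LINT x|lborel. indicator {0<..<1} x * f x)"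
    by (subst integral_restrict_space) (auto simp: integral_completion)
  show "integrable unit_measure f \<longleftrightarrow> integrable lborel (\<lambda>x. indicator {0<..<1} x * f x)"
    by (subst integrable_restrict_space) (auto simp: integrable_completion)
qed

lemma integral_ljac:
  fixes f :: "real \<Rightarrow> real"
  assumes [measurable]: "f \<in> borel_measurable borel"
  shows "(LINT x|ljac p q. f x) = (LINT x|jac p q. f x)"
    and "integrable (ljac p q) f \<longleftrightarrow> integrable (jac p q) f"
proof -
  note f = unit_measure_borel[OF assms]
  have m: "(\<lambda>x. weight p q x * f x) \<in> borel_measurable borel" by measurable
  show "(LINT x|ljac p q. f x) = (LINT x|jac p q. f x)"
    by (simp add: integral_ljac_weight[OF f] integral_unit_lborel(1)[OF m] integral_jac mult.assoc)
  show "integrable (ljac p q) f \<longleftrightarrow> integrable (jac p q) f"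
    by (simp add: integrable_ljac_iff[OF f] integral_unit_lborel(2)[OF m] integrable_jac_iff mult.assoc)
qed

lemma sq_int_ljac_borel:
  assumes "f \<in> borel_measurable borel"
  shows "f \<in> sq_int (ljac p q) \<longleftrightarrow> f \<in> sq_int (jac p q)"
  using integral_ljac(2)[of "\<lambda>x. (f x)\<^sup>2" p q] assms by (simp add: sq_int_def ljac_borel)

lemma poly_sq_int_ljac: "-1 < p \<Longrightarrow> -1 < q \<Longrightarrow> poly P \<in> sq_int (ljac p q)"
  by (simp add: sq_int_ljac_borel poly_sq_int)

lemma L2w_weight: "g \<in> L2w (weight p q) \<longleftrightarrow> g \<in> sq_int (ljac p q)"
proof (cases "g \<in> borel_measurable unit_measure")
  case True
  then have "(\<lambda>x. (g x)\<^sup>2) \<in> borel_measurable unit_measure" by (rule borel_measurable_power)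
  then show ?thesis using True by (simp add: L2w_def sq_int_def measurable_ljac integrable_ljac_iff)
qed (simp add: L2w_def sq_int_def measurable_ljac)

lemma tendsto_L2w_weight:
  "tendsto_L2w (weight p q) h g \<longleftrightarrow> (\<forall>N. h N \<in> sq_int (ljac p q)) \<and> g \<in> sq_int (ljac p q) \<and>
     (\<lambda>N. LINT x|ljac p q. (h N x - g x)\<^sup>2) \<longlonglongrightarrow> 0"
proof (cases "(\<forall>N. h N \<in> sq_int (ljac p q)) \<and> g \<in> sq_int (ljac p q)")
  case True
  have "norm_w (weight p q) (\<lambda>x. h N x - g x) = sqrt (LINT x|ljac p q. (h N x - g x)\<^sup>2)" for N
  proof -
    have "(\<lambda>x. h N x - g x) \<in> borel_measurable unit_measure"
      using sq_int_measurable[OF sq_int_diff, of "h N" "ljac p q" g] True by (simp add: measurable_ljac)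
    then have "(\<lambda>x. (h N x - g x)\<^sup>2) \<in> borel_measurable unit_measure" by (rule borel_measurable_power)
    then show ?thesis by (simp add: norm_w_def integral_ljac_weight)
  qed
  moreover have "(\<lambda>N. sqrt (s N)) \<longlonglongrightarrow> 0 \<longleftrightarrow> s \<longlonglongrightarrow> 0" if "\<And>N. 0 \<le> s N" for s :: "nat \<Rightarrow> real"
  proof
    assume "(\<lambda>N. sqrt (s N)) \<longlonglongrightarrow> 0"
    from tendsto_power[OF this, of 2] show "s \<longlonglongrightarrow> 0" using that by simp
  next
    assume "s \<longlonglongrightarrow> 0"
    from tendsto_real_sqrt[OF this] show "(\<lambda>N. sqrt (s N)) \<longlonglongrightarrow> 0" by simp
  qed
  ultimately show ?thesis using True by (simp add: tendsto_L2w_def L2w_weight)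
qed (auto simp: tendsto_L2w_def L2w_weight)

lemma unit_borel_version:
  fixes g :: "real \<Rightarrow> real"
  assumes "g \<in> borel_measurable unit_measure"
  obtains g' where "g' \<in> borel_measurable borel" "AE x in lborel. indicator {0<..<1} x * g x = g' x"
proof -
  have "(\<lambda>x. indicator {0<..<1} x *\<^sub>R g x) \<in> borel_measurable lebesgue"
    using assms by (subst (asm) borel_measurable_restrict_space_iff) auto
  then show ?thesis
    using completion_ex_borel_measurable_real[of "\<lambda>x. indicator {0<..<1} x * g x" lborel] that by auto
qed

lemma poly_complete_ljac:
  assumes "-1 < p" "-1 < q" and g: "g \<in> sq_int (ljac p q)"
    and orth: "\<And>P. (LINT x|ljac p q. g x * poly P x) = 0"
  shows "AE x in ljac p q. g x = 0"
proof -
  have gm: "g \<in> borel_measurable unit_measure" using sq_int_measurable[OF g] by (simp add: measurable_ljac)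
  obtain g' where g'[measurable]: "g' \<in> borel_measurable borel"
    and ae: "AE x in lborel. indicator {0<..<1} x * g x = g' x"
    using unit_borel_version[OF gm] .
  have aej: "AE x in ljac p q. g x = g' x"
    unfolding AE_ljac AE_unit_lborel using ae by eventually_elim auto
  note m = ljac_borel[OF g'] sq_int_measurable[OF g] ljac_borel[OF poly_borel]
  have gp: "integrable (ljac p q) (\<lambda>x. g x * poly P x)" for P
    using g poly_sq_int_ljac[of p q P] assms by (intro sq_int_mult) auto
  have "integrable (ljac p q) g" using gp[of 1] by simp
  moreover have "integrable (ljac p q) g \<longleftrightarrow> integrable (ljac p q) g'"
    using m aej by (intro integrable_cong_AE) auto
  ultimately have "integrable (jac p q) g'" by (simp add: integral_ljac(2))
  moreover have "(LINT x|jac p q. g' x * poly P x) = 0" for P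
  proof -
    have "(LINT x|jac p q. g' x * poly P x) = (LINT x|ljac p q. g' x * poly P x)"
      by (simp add: integral_ljac(1))
    also have "\<dots> = (LINT x|ljac p q. g x * poly P x)"
      using m aej by (intro integral_cong_AE borel_measurable_times) (auto elim: eventually_mono)
    finally show ?thesis by (simp add: orth)
  qed
  moreover have "AE x in jac p q. x \<in> {0..1}" using AE_jac_unit[of p q] by eventually_elim auto
  ultimately have "AE x in jac p q. g' x = 0"
    by (intro integral_eq_0_if_orthogonal_to_poly) auto
  then have "AE x in ljac p q. g' x = 0" by (simp add: AE_jac AE_ljac AE_unit_lborel)
  with aej show ?thesis by eventually_elim simp
qed

lemma weight_mult: "weight p q x * weight p' q' x = weight (p + p') (q + q') x"
  by (simp add: weight_def powr_add)

text \<open>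
The integral of a function from \<open>1/2\<close> to \<open>x\<close>, with its sign, is the integral against this kernel. It is jointly
measurable, which yields measurability of primitives in \<open>x\<close>.
\<close>

definition signed_interval :: "real \<Rightarrow> real \<Rightarrow> real" where
  "signed_interval x y = (if 1/2 < y \<and> y < x then 1 else if x < y \<and> y < 1/2 then - 1 else 0)"

lemma signed_interval_eq: "signed_interval x y = indicator {1/2<..<x} y - indicator {x<..<1/2} y"
  by (auto simp: signed_interval_def)

lemma signed_interval_measurable [measurable]:
  "(\<lambda>(x, y). signed_interval x y) \<in> borel_measurable (borel \<Otimes>\<^sub>M borel)"
  unfolding signed_interval_def by measurable

text \<open>
The constant \<open>c\<close> is the integral over \<open>(0, 1/2)\<close> if \<open>f\<close> is integrable there, and \<open>0\<close> otherwise.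
\<close>

lemma primitive_representation:
  fixes f :: "real \<Rightarrow> real"
  assumes f: "f \<in> borel_measurable unit_measure"
  shows "\<exists>f' c. f' \<in> borel_measurable borel \<and> (AE y in lborel. indicator {0<..<1} y * f y = f' y) \<and>
    (\<forall>x\<in>{0<..<1}. integrable lborel (\<lambda>y. signed_interval x y * f' y) \<longrightarrow>
      primitive f x = c + (LINT y|lborel. signed_interval x y * f' y))"
proof -
  obtain f' where f'[measurable]: "f' \<in> borel_measurable borel"
    and ae: "AE y in lborel. indicator {0<..<1} y * f y = f' y"
    using unit_borel_version[OF f] .
  have fm: "(\<lambda>y. indicator {0<..<1} y * f y) \<in> borel_measurable lebesgue"
    using f by (subst (asm) borel_measurable_restrict_space_iff) auto
  have set_int: "set_lebesgue_integral lebesgue {u<..<v} f = (LINT y|lborel. indicator {u<..<v} y * f' y)"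
    "set_integrable lebesgue {u<..<v} f \<longleftrightarrow> integrable lborel (\<lambda>y. indicator {u<..<v} y * f' y)"
    if "0 \<le> u" "v \<le> 1" for u v
  proof -
    have e: "indicator {u<..<v} y *\<^sub>R f y = indicator {u<..<v} y * (indicator {0<..<1} y * f y)" for y
      using that by (auto simp: indicator_def)
    have ae': "AE y in lebesgue. indicator {u<..<v} y * (indicator {0<..<1} y * f y) = indicator {u<..<v} y * f' y"
      unfolding AE_completion_iff using ae by eventually_elim simp
    have m: "(\<lambda>y. indicator {u<..<v} y * (indicator {0<..<1} y * f y)) \<in> borel_measurable lebesgue"
      by (intro borel_measurable_times[OF _ fm] measurable_completion) simp
    have m': "(\<lambda>y. indicator {u<..<v} y * f' y) \<in> borel_measurable lborel" by measurable
    have "set_lebesgue_integral lebesgue {u<..<v} f = (LINT y|lebesgue. indicator {u<..<v} y * f' y)"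
      unfolding set_lebesgue_integral_def e
      by (rule integral_cong_AE[OF m measurable_completion[OF m'] ae'])
    then show "set_lebesgue_integral lebesgue {u<..<v} f = (LINT y|lborel. indicator {u<..<v} y * f' y)"
      by (simp add: integral_completion[OF m'])
    have "set_integrable lebesgue {u<..<v} f \<longleftrightarrow> integrable lebesgue (\<lambda>y. indicator {u<..<v} y * f' y)"
      unfolding set_integrable_def e
      by (rule integrable_cong_AE[OF m measurable_completion[OF m'] ae'])
    then show "set_integrable lebesgue {u<..<v} f \<longleftrightarrow> integrable lborel (\<lambda>y. indicator {u<..<v} y * f' y)"
      by (simp add: integrable_completion[OF m'])
  qed
  define near0 where "near0 \<longleftrightarrow> set_integrable lebesgue {0<..<1/2} f"
  define c where "c = (if near0 then LINT y|lborel. indicator {0<..<1/2} y * f' y else 0)"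
  show ?thesis
  proof (intro exI[of _ f'] exI[of _ c] conjI f' ae ballI impI)
    fix x :: real assume x: "x \<in> {0<..<1}" and int: "integrable lborel (\<lambda>y. signed_interval x y * f' y)"
    show "primitive f x = c + (LINT y|lborel. signed_interval x y * f' y)"
    proof (cases near0)
      case True
      have int0: "integrable lborel (\<lambda>y. indicator {0<..<1/2} y * f' y)"
        using True set_int(2)[of 0 "1/2"] by (simp add: near0_def)
      have "primitive f x = set_lebesgue_integral lebesgue {0<..<x} f"
        using True x by (simp add: primitive_def near0_def interval_lebesgue_integral_def zero_ereal_def)
      also have "\<dots> = (LINT y|lborel. indicator {0<..<x} y * f' y)" using x by (intro set_int) auto
      also have "\<dots> = (LINT y|lborel. indicator {0<..<1/2} y * f' y + signed_interval x y * f' y)"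
      proof (rule integral_cong_AE)
        have "AE y in lborel. y \<noteq> x" "AE y in lborel. y \<noteq> 1/2" by (rule AE_lborel_singleton)+
        then show "AE y in lborel. indicator {0<..<x} y * f' y = indicator {0<..<1/2} y * f' y + signed_interval x y * f' y"
          by eventually_elim (use x in \<open>auto simp: signed_interval_def indicator_def\<close>)
      qed measurable
      also have "\<dots> = c + (LINT y|lborel. signed_interval x y * f' y)"
        using int int0 True by (simp add: c_def)
      finally show ?thesis .
    next
      case False
      have "primitive f x = (if 1/2 \<le> x then set_lebesgue_integral lebesgue {1/2<..<x} f
          else - set_lebesgue_integral lebesgue {x<..<1/2} f)"
        using False by (simp add: primitive_def near0_def interval_lebesgue_integral_def)
      also have "\<dots> = (LINT y|lborel. signed_interval x y * f' y)"
        using x by (simp add: set_int signed_interval_eq)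
      finally show ?thesis using False by (simp add: c_def)
    qed
  qed
qed

text \<open>
By Cauchy-Schwarz the squared integral from \<open>1/2\<close> to \<open>x\<close> is at most the squared norm of \<open>f\<close> times the integral of
\<open>1 / weight b a\<close> between \<open>1/2\<close> and \<open>x\<close>. That integral diverges at an endpoint at most logarithmically, and spending half
of the exponents on the pointwise factor bounds it by a multiple of \<open>weight (- b / 2) (- a / 2) x\<close>. This is
integrable against \<open>weight (b - 1) (a - 1)\<close> because \<open>a\<close> and \<open>b\<close> are positive.
\<close>

lemma primitive_sq_int:
  fixes f :: "real \<Rightarrow> real"
  assumes a: "0 < a" "a \<le> 1" and b: "0 < b" "b \<le> 1"
    and f: "f \<in> sq_int (ljac b a)"
  shows "primitive f \<in> sq_int (ljac (b - 1) (a - 1))"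
proof -
  have fm: "f \<in> borel_measurable unit_measure" using sq_int_measurable[OF f] by (simp add: measurable_ljac)
  obtain f' c where f'[measurable]: "f' \<in> borel_measurable borel"
    and ae: "AE y in lborel. indicator {0<..<1} y * f y = f' y"
    and prim: "\<forall>x\<in>{0<..<1}. integrable lborel (\<lambda>y. signed_interval x y * f' y) \<longrightarrow>
      primitive f x = c + (LINT y|lborel. signed_interval x y * f' y)"
    using primitive_representation[OF fm] by blast
  define H where "H x = (LINT y|lborel. signed_interval x y * f' y)" for x
  have Hm[measurable]: "H \<in> borel_measurable borel" unfolding H_def by measurable
  define \<phi> where "\<phi> y = indicator {0<..<1} y * sqrt (weight b a y) * f' y" for y
  define \<psi> where "\<psi> x y = signed_interval x y * (indicator {0<..<1} y / sqrt (weight b a y))" for x y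
  have \<phi>: "\<phi> \<in> sq_int lborel"
  proof -
    have "AE x in ljac b a. (f x)\<^sup>2 = (f' x)\<^sup>2"
      unfolding AE_ljac AE_unit_lborel using ae by eventually_elim auto
    then have "integrable (ljac b a) (\<lambda>x. (f x)\<^sup>2) \<longleftrightarrow> integrable (ljac b a) (\<lambda>x. (f' x)\<^sup>2)"
      using sq_int_measurable[OF f] ljac_borel[OF f'] by (intro integrable_cong_AE) auto
    then have "integrable (jac b a) (\<lambda>x. (f' x)\<^sup>2)"
      using sq_int_integrable[OF f] by (simp add: integral_ljac(2))
    then have "integrable lborel (\<lambda>x. indicator {0<..<1} x * weight b a x * (f' x)\<^sup>2)"
      by (simp add: integrable_jac_iff)
    moreover have "(\<phi> x)\<^sup>2 = indicator {0<..<1} x * weight b a x * (f' x)\<^sup>2" for x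
      by (simp add: \<phi>_def power_mult_distrib weight_nonneg indicator_def)
    moreover have "\<phi> \<in> borel_measurable lborel" unfolding \<phi>_def by measurable
    ultimately show ?thesis by (simp add: sq_int_def)
  qed
  define B where "B = 2 powr ((a + b) / 2) * Beta (1 - a / 2) (1 - b / 2)"
  have \<psi>: "\<psi> x \<in> sq_int lborel" "(LINT y|lborel. (\<psi> x y)\<^sup>2) \<le> B * weight (- b / 2) (- a / 2) x"
    if x: "x \<in> {0<..<1}" for x
  proof -
    define C where "C = 2 powr ((a + b) / 2) * weight (- b / 2) (- a / 2) x"
    have le: "(\<psi> x y)\<^sup>2 \<le> C * (indicator {0<..<1} y * weight (- b / 2) (- a / 2) y)" for y
    proof (cases "y \<in> {0<..<1} \<and> signed_interval x y \<noteq> 0")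
      case True
      \<comment> \<open>A point between \<open>1/2\<close> and \<open>x\<close> is at most twice as close to an endpoint as \<open>x\<close> is.\<close>
      then have y: "0 < y" "y < 1" "x / 2 \<le> y" "(1 - x) / 2 \<le> 1 - y" and s1: "(signed_interval x y)\<^sup>2 = 1"
        using x by (auto simp: signed_interval_def indicator_def split: if_splits)
      have "y powr (- a / 2) \<le> (x / 2) powr (- a / 2)"
        using y x a by (intro powr_mono2') auto
      moreover have "(1 - y) powr (- b / 2) \<le> ((1 - x) / 2) powr (- b / 2)"
        using y x b by (intro powr_mono2') auto
      ultimately have "weight (- b / 2) (- a / 2) y \<le> ((1 - x) / 2) powr (- b / 2) * (x / 2) powr (- a / 2)"
        unfolding weight_def by (intro mult_mono) auto
      also have "\<dots> = C"
        using x unfolding C_def weight_def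
          by (simp add: powr_divide powr_minus field_simps flip: powr_add)
      finally have "weight (- b / 2) (- a / 2) y \<le> C" .
      then have "weight (- b / 2) (- a / 2) y * weight (- b / 2) (- a / 2) y \<le> C * weight (- b / 2) (- a / 2) y"
        by (intro mult_right_mono) (auto simp: weight_nonneg)
      moreover have "weight (- b / 2) (- a / 2) y * weight (- b / 2) (- a / 2) y = 1 / weight b a y"
        unfolding weight_mult by (simp add: weight_def powr_minus_divide)
      moreover have "(\<psi> x y)\<^sup>2 = 1 / weight b a y"
        using y s1 by (simp add: \<psi>_def power_mult_distrib power_divide weight_nonneg)
      ultimately show ?thesis using y by simp
    next
      case False
      then show ?thesis by (auto simp: \<psi>_def C_def weight_nonneg)
    qed
    have I: "integrable lborel (\<lambda>y. indicator {0<..<1} y * weight (- b / 2) (- a / 2) y)"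
      using integrable_jac_poly[of "- b / 2" "- a / 2" 1] a b by (simp add: integrable_jac_iff)
    then have IC: "integrable lborel (\<lambda>y. C * (indicator {0<..<1} y * weight (- b / 2) (- a / 2) y))" by simp
    have [measurable]: "\<psi> x \<in> borel_measurable borel" unfolding \<psi>_def by measurable
    have sq: "integrable lborel (\<lambda>y. (\<psi> x y)\<^sup>2)"
      by (rule Bochner_Integration.integrable_bound[OF IC]) (use le in \<open>auto intro!: AE_I2 order_trans[OF le]\<close>)
    then show "\<psi> x \<in> sq_int lborel" by (simp add: sq_int_def)
    have "(LINT y|lborel. (\<psi> x y)\<^sup>2) \<le> (LINT y|lborel. C * (indicator {0<..<1} y * weight (- b / 2) (- a / 2) y))"
      by (rule integral_mono[OF sq IC le])
    also have "\<dots> = C * Beta (1 - a / 2) (1 - b / 2)"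
    proof -
      have "(LINT y|lborel. indicator {0<..<1} y * weight (- b / 2) (- a / 2) y) = Beta (1 - a / 2) (1 - b / 2)"
        using nn_integral_weight[of "- b / 2" "- a / 2"] a b Beta_pos[of "1 - a / 2" "1 - b / 2"]
        by (subst integral_eq_nn_integral) (auto simp: weight_nonneg)
      then show ?thesis by simp
    qed
    finally show "(LINT y|lborel. (\<psi> x y)\<^sup>2) \<le> B * weight (- b / 2) (- a / 2) x"
      by (simp add: B_def C_def mult_ac)
  qed
  have prod: "AE y in lborel. \<phi> y * \<psi> x y = signed_interval x y * f' y" if x: "x \<in> {0<..<1}" for x
    using ae
  proof eventually_elim
    case (elim y)
    then show ?case using weight_pos[of y b a] by (cases "y \<in> {0<..<1}") (auto simp: \<phi>_def \<psi>_def)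
  qed
  have sm: "(\<lambda>y. signed_interval x y * f' y) \<in> borel_measurable lborel" for x by measurable
  have \<phi>\<psi>: "integrable lborel (\<lambda>y. signed_interval x y * f' y)" "H x = (LINT y|lborel. \<phi> y * \<psi> x y)" if x: "x \<in> {0<..<1}" for x
  proof -
    note i = sq_int_mult[OF \<phi> \<psi>(1)[OF x]]
    show "integrable lborel (\<lambda>y. signed_interval x y * f' y)"
      using i integrable_cong_AE[OF borel_measurable_integrable[OF i] sm prod[OF x]] by simp
    show "H x = (LINT y|lborel. \<phi> y * \<psi> x y)"
      unfolding H_def using integral_cong_AE[OF borel_measurable_integrable[OF i] sm prod[OF x]] by simp
  qed
  define E where "E = (LINT y|lborel. (\<phi> y)\<^sup>2)"
  have E: "0 \<le> E" by (simp add: E_def)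
  have H: "(H x)\<^sup>2 \<le> E * B * weight (- b / 2) (- a / 2) x" if x: "x \<in> {0<..<1}" for x
  proof -
    have "(H x)\<^sup>2 \<le> E * (LINT y|lborel. (\<psi> x y)\<^sup>2)"
      unfolding \<phi>\<psi>(2)[OF x] E_def by (rule Cauchy_Schwarz_integral[OF \<phi> \<psi>(1)[OF x]])
    also have "\<dots> \<le> E * (B * weight (- b / 2) (- a / 2) x)" using E by (intro mult_left_mono \<psi>(2)[OF x])
    finally show ?thesis by (simp add: mult.assoc)
  qed
  have W: "integrable (jac (b - 1) (a - 1)) (weight (- b / 2) (- a / 2))"
  proof -
    have "integrable lborel (\<lambda>y. indicator {0<..<1} y * weight (b / 2 - 1) (a / 2 - 1) y)"
      using integrable_jac_poly[of "b / 2 - 1" "a / 2 - 1" 1] a b by (simp add: integrable_jac_iff)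
    moreover have "weight (b / 2 - 1) (a / 2 - 1) y = weight (b - 1) (a - 1) y * weight (- b / 2) (- a / 2) y" for y
      unfolding weight_mult by (rule arg_cong2[where f = "\<lambda>p q. weight p q y"]) (simp_all add: field_simps)
    ultimately show ?thesis by (simp add: integrable_jac_iff mult.assoc)
  qed
  have "integrable (jac (b - 1) (a - 1)) (\<lambda>x. (H x)\<^sup>2)"
  proof (rule Bochner_Integration.integrable_bound)
    show "integrable (jac (b - 1) (a - 1)) (\<lambda>x. E * B * weight (- b / 2) (- a / 2) x)" using W by simp
    show "AE x in jac (b - 1) (a - 1). norm ((H x)\<^sup>2) \<le> norm (E * B * weight (- b / 2) (- a / 2) x)"
      using AE_jac_unit
    proof eventually_elim
      case (elim x)
      then show ?case using H[OF elim] by simp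
    qed
  qed measurable
  then have "H \<in> sq_int (jac (b - 1) (a - 1))" by (simp add: sq_int_def)
  moreover have "(\<lambda>x. c) \<in> sq_int (jac (b - 1) (a - 1))"
  proof -
    have "poly [:c:] = (\<lambda>x. c)" by (simp add: fun_eq_iff)
    then show ?thesis using poly_sq_int[of "b - 1" "a - 1" "[:c:]"] a b by simp
  qed
  ultimately have "(\<lambda>x. c + H x) \<in> sq_int (jac (b - 1) (a - 1))" by (intro sq_int_add)
  then have cH: "(\<lambda>x. c + H x) \<in> sq_int (ljac (b - 1) (a - 1))" by (simp add: sq_int_ljac_borel)
  have eq: "primitive f x = c + H x" if "x \<in> {0<..<1}" for x
    using prim that \<phi>\<psi>(1)[OF that] by (simp add: H_def)
  show ?thesis
    using cH sq_int_cong[of "ljac (b - 1) (a - 1)" "primitive f" "\<lambda>x. c + H x"] eq by simp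
qed

section \<open>Existence and uniqueness\<close>

lemma integral_lebesgue_on_lborel:
  fixes f :: "real \<Rightarrow> real"
  assumes "f \<in> borel_measurable borel"
  shows "(LINT s|lebesgue_on {u<..<v}. f s) = (LINT s|lborel. indicator {u<..<v} s * f s)"
proof -
  have "(\<lambda>s. indicator {u<..<v} s * f s) \<in> borel_measurable lborel" using assms by simp
  then show ?thesis by (subst integral_restrict_space) (auto simp: integral_completion)
qed

text \<open>
Polynomials of every degree span all polynomials.
\<close>

lemma integral_eq_0_by_degree:
  fixes B :: "nat \<Rightarrow> real poly"
  assumes pq: "-1 < p" "-1 < q" and g: "g \<in> sq_int (ljac p q)"
    and B: "\<And>n. degree (B n) \<le> n" "\<And>n. coeff (B n) n \<noteq> 0"
    and orth: "\<And>n. (LINT x|ljac p q. g x * poly (B n) x) = 0"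
  shows "(LINT x|ljac p q. g x * poly P x) = 0"
proof -
  have "degree P \<le> n \<Longrightarrow> (LINT x|ljac p q. g x * poly P x) = 0" for n
  proof (induction n arbitrary: P rule: less_induct)
    case (less n)
    have int: "integrable (ljac p q) (\<lambda>x. g x * poly Q x)" for Q
      using sq_int_mult[OF g poly_sq_int_ljac[OF pq]] .
    define R where "R = P - smult (coeff P n / coeff (B n) n) (B n)"
    have "degree R \<le> n" unfolding R_def using less.prems B(1)[of n] by (intro degree_diff_le) auto
    moreover have "coeff R n = 0" using B(2)[of n] by (simp add: R_def)
    ultimately have "R = 0 \<or> degree R < n" by (metis leading_coeff_0_iff le_neq_implies_less)
    then have "(LINT x|ljac p q. g x * poly R x) = 0" using less.IH[of "degree R" R] by auto
    moreover have "(LINT x|ljac p q. g x * poly R x) =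
        (LINT x|ljac p q. g x * poly P x - coeff P n / coeff (B n) n * (g x * poly (B n) x))"
      by (simp add: R_def algebra_simps)
    moreover have "\<dots> = (LINT x|ljac p q. g x * poly P x) -
        coeff P n / coeff (B n) n * (LINT x|ljac p q. g x * poly (B n) x)"
      using int by (simp only: Bochner_Integration.integral_diff integrable_mult_right integral_mult_right_zero)
    ultimately show ?case using orth[of n] by simp
  qed
  then show ?thesis by blast
qed

context frac_jacobi
begin

lemma frac_op_sum:
  assumes "0 < x" "x < 1"
  shows "frac_op a b r (\<Sum>j\<in>J. smult (c j) (p j)) x = (\<Sum>j\<in>J. c j * frac_op a b r (p j) x)"
proof -
  have "frac_op a b r (\<Sum>j\<in>J. smult (c j) (p j)) x =
      (LINT s|jac (a - 1) (b - 1). (\<Sum>j\<in>J. c j * (frac_kernel \<alpha> r x s * poly (p j) s)))"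
    unfolding frac_op_def
    by (intro Bochner_Integration.integral_cong refl) (simp add: poly_sum sum_distrib_left mult_ac)
  also have "\<dots> = (\<Sum>j\<in>J. c j * frac_op a b r (p j) x)"
    using kernel_poly_integrable[OF assms] by (simp add: Bochner_Integration.integral_sum frac_op_def)
  finally show ?thesis .
qed

lemma truncation_eq:
  "truncation \<alpha> b c N x = weight a b x * poly (\<Sum>j\<le>N. smult (c j) (jacobi_poly j a b)) x"
  by (simp add: truncation_def poly_sum poly_jacobi_poly)

lemma deriv_truncation:
  assumes "0 < x" "x < 1"
  shows "deriv (truncation \<alpha> b c N) x = weight (a - 1) (b - 1) x * poly (\<Sum>j\<le>N. smult (c j) (jacobi_deriv j)) x"
proof -
  have "(\<Sum>j\<le>N. smult (c j) (jacobi_deriv j)) = weighted_deriv a b (\<Sum>j\<le>N. smult (c j) (jacobi_poly j a b))"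
    by (simp only: jacobi_deriv_def weighted_deriv_sum weighted_deriv_smult)
  moreover have "truncation \<alpha> b c N = (\<lambda>x. weight a b x * poly (\<Sum>j\<le>N. smult (c j) (jacobi_poly j a b)) x)"
    by (rule ext) (rule truncation_eq)
  ultimately show ?thesis
    using DERIV_imp_deriv[OF DERIV_weight_poly[OF assms]] by (simp only:)
qed

text \<open>
The factors \<open>r\<close> and \<open>1 - r\<close> stay inside the integrals: integrability of the one-sided integrals is only known from
that of the two-sided kernel, and is not available from it when the factor is \<open>0\<close>.
\<close>

lemma frac_flux_eq_frac_op:
  assumes x: "0 < x" "x < 1"
    and u: "\<And>s. 0 < s \<Longrightarrow> s < 1 \<Longrightarrow> deriv u s = weight (a - 1) (b - 1) s * poly p s"
  shows "frac_flux \<alpha> r u x = - frac_op a b r p x / Gamma (2 - \<alpha>)"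
proof -
  define J where "J = jac (a - 1) (b - 1)"
  define w where "w s = weight (a - 1) (b - 1) s * poly p s" for s
  have [measurable]: "w \<in> borel_measurable borel" unfolding w_def by measurable
  have e: "2 - \<alpha> - 1 = 1 - \<alpha>" by simp
  define k where "k s = frac_kernel \<alpha> r x s * poly p s" for s
  have [measurable]: "k \<in> borel_measurable borel" unfolding k_def by measurable
  have k: "integrable J k" unfolding J_def k_def using kernel_poly_integrable[OF x] .
  have L: "r * (LINT s|lebesgue_on {0<..<x}. deriv u s * (x - s) powr (2 - \<alpha> - 1)) =
      (LINT s|J. indicator {..<x} s * k s)"
  proof -
    have "(LINT s|lebesgue_on {0<..<x}. deriv u s * (x - s) powr (2 - \<alpha> - 1)) =
        (LINT s|lebesgue_on {0<..<x}. w s * (x - s) powr (1 - \<alpha>))"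
      unfolding e using x by (intro Bochner_Integration.integral_cong refl) (auto simp: u w_def)
    also have "\<dots> = (LINT s|lborel. indicator {0<..<x} s * (w s * (x - s) powr (1 - \<alpha>)))"
      by (rule integral_lebesgue_on_lborel) measurable
    finally have "r * (LINT s|lebesgue_on {0<..<x}. deriv u s * (x - s) powr (2 - \<alpha> - 1)) =
        (LINT s|lborel. r * (indicator {0<..<x} s * (w s * (x - s) powr (1 - \<alpha>))))" by simp
    also have "\<dots> = (LINT s|lborel. indicator {0<..<1} s * weight (a - 1) (b - 1) s * (indicator {..<x} s * k s))"
      using x by (intro Bochner_Integration.integral_cong refl) (auto simp: indicator_def k_def w_def frac_kernel_def)
    also have "\<dots> = (LINT s|J. indicator {..<x} s * k s)"
      unfolding J_def by (rule integral_jac[symmetric]) measurable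
    finally show ?thesis .
  qed
  have R: "(1 - r) * (LINT s|lebesgue_on {x<..<1}. deriv u s * (s - x) powr (2 - \<alpha> - 1)) =
      (LINT s|J. indicator {x<..} s * k s)"
  proof -
    have "(LINT s|lebesgue_on {x<..<1}. deriv u s * (s - x) powr (2 - \<alpha> - 1)) =
        (LINT s|lebesgue_on {x<..<1}. w s * (s - x) powr (1 - \<alpha>))"
      unfolding e using x by (intro Bochner_Integration.integral_cong refl) (auto simp: u w_def)
    also have "\<dots> = (LINT s|lborel. indicator {x<..<1} s * (w s * (s - x) powr (1 - \<alpha>)))"
      by (rule integral_lebesgue_on_lborel) measurable
    finally have "(1 - r) * (LINT s|lebesgue_on {x<..<1}. deriv u s * (s - x) powr (2 - \<alpha> - 1)) =
        (LINT s|lborel. (1 - r) * (indicator {x<..<1} s * (w s * (s - x) powr (1 - \<alpha>))))" by simp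
    also have "\<dots> = (LINT s|lborel. indicator {0<..<1} s * weight (a - 1) (b - 1) s * (indicator {x<..} s * k s))"
      using x by (intro Bochner_Integration.integral_cong refl) (auto simp: indicator_def k_def w_def frac_kernel_def)
    also have "\<dots> = (LINT s|J. indicator {x<..} s * k s)"
      unfolding J_def by (rule integral_jac[symmetric]) measurable
    finally show ?thesis .
  qed
  have iL: "integrable J (\<lambda>s. indicator {..<x} s * k s)" and iR: "integrable J (\<lambda>s. indicator {x<..} s * k s)"
    using integrable_mult_indicator[OF _ k, of "{..<x}"] integrable_mult_indicator[OF _ k, of "{x<..}"]
    by (simp_all add: J_def)
  have "(LINT s|J. indicator {..<x} s * k s) + (LINT s|J. indicator {x<..} s * k s) =
      (LINT s|J. indicator {..<x} s * k s + indicator {x<..} s * k s)"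
    using iL iR by simp
  also have "\<dots> = frac_op a b r p x"
    unfolding frac_op_def J_def k_def
    by (intro Bochner_Integration.integral_cong refl) (auto simp: indicator_def frac_kernel_def)
  finally have sum: "(LINT s|J. indicator {..<x} s * k s) + (LINT s|J. indicator {x<..} s * k s) = frac_op a b r p x" .
  have "frac_flux \<alpha> r u x = - (1 / Gamma (2 - \<alpha>) * (
      r * (LINT s|lebesgue_on {0<..<x}. deriv u s * (x - s) powr (2 - \<alpha> - 1)) +
      (1 - r) * (LINT s|lebesgue_on {x<..<1}. deriv u s * (s - x) powr (2 - \<alpha> - 1))))"
    unfolding frac_flux_def frac_int_left_def frac_int_right_def by (simp only: distrib_left mult_ac)
  also have "\<dots> = - frac_op a b r p x / Gamma (2 - \<alpha>)" unfolding L R sum by simp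
  finally show ?thesis .
qed

text \<open>
The fluxes of the basis functions, preceded by the constant \<open>1\<close>, to which they are all orthogonal; with it the sequence
contains a polynomial of each degree.
\<close>

fun flux_basis :: "nat \<Rightarrow> real poly" where
  "flux_basis 0 = 1"
| "flux_basis (Suc n) = smult (- 1 / Gamma (2 - \<alpha>)) (flux_poly n)"

lemma Gamma_pos: "0 < Gamma (2 - \<alpha>)"
  using ab by (intro Gamma_real_pos) simp

lemma flux_basis_degree: "degree (flux_basis n) \<le> n"
  by (cases n) (simp_all add: flux_poly(1))

lemma flux_basis_coeff: "coeff (flux_basis n) n \<noteq> 0"
proof (cases n)
  case (Suc m)
  then show ?thesis
    using jacobi_deriv_coeff_neg[of m] lead_factor_pos[of "Suc m"] Gamma_pos by (simp add: flux_poly(2))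
qed simp

lemma frac_flux_truncation:
  assumes "0 < x" "x < 1"
  shows "frac_flux \<alpha> r (truncation \<alpha> b c N) x = (\<Sum>j\<le>N. c j * poly (flux_basis (Suc j)) x)"
proof -
  have "frac_flux \<alpha> r (truncation \<alpha> b c N) x = - (\<Sum>j\<le>N. c j * frac_op a b r (jacobi_deriv j) x) / Gamma (2 - \<alpha>)"
    using frac_flux_eq_frac_op[OF assms, of "truncation \<alpha> b c N" "\<Sum>j\<le>N. smult (c j) (jacobi_deriv j)"]
      deriv_truncation by (simp add: frac_op_sum[OF assms])
  also have "\<dots> = (\<Sum>j\<le>N. c j * poly (flux_basis (Suc j)) x)"
    using assms by (simp add: flux_poly(3) sum_divide_distrib sum_negf)
  finally show ?thesis .
qed

lemma flux_basis_lower: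
  assumes "degree R < n"
  shows "(LINT x|jac (b - 1) (a - 1). poly R x * poly (flux_basis n) x) = 0"
proof (cases n)
  case (Suc m)
  have "(LINT x|jac (b - 1) (a - 1). poly R x * poly (flux_basis n) x) =
      (LINT x|jac (b - 1) (a - 1). (- 1 / Gamma (2 - \<alpha>)) * (poly R x * poly (flux_poly m) x))"
    by (simp add: Suc mult.left_commute)
  also have "\<dots> = (- 1 / Gamma (2 - \<alpha>)) * (LINT x|jac (b - 1) (a - 1). poly R x * poly (flux_poly m) x)"
    by (rule integral_mult_right_zero)
  also have "\<dots> = 0" using assms Suc by (simp add: flux_poly_orthogonal)
  finally show ?thesis .
qed (use assms in simp)

lemma exponents': "-1 < b - 1" "-1 < a - 1"
  using a b by auto

lemma integral_ljac_poly_mult: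
  "(LINT x|ljac p q. poly P x * poly Q x) = (LINT x|jac p q. poly P x * poly Q x)"
  by (rule integral_ljac) measurable

lemma flux_basis_orthogonal: "orthogonal_system (ljac (b - 1) (a - 1)) (\<lambda>n. poly (flux_basis n))"
  unfolding orthogonal_system_def
proof (intro conjI allI impI)
  show "poly (flux_basis n) \<in> sq_int (ljac (b - 1) (a - 1))" for n
    using exponents' by (intro poly_sq_int_ljac)
  fix m n :: nat assume "m \<noteq> n"
  then consider "m < n" | "n < m" by linarith
  then show "(LINT x|ljac (b - 1) (a - 1). poly (flux_basis m) x * poly (flux_basis n) x) = 0"
  proof cases
    case 1
    then have "degree (flux_basis m) < n" using flux_basis_degree[of m] by simp
    then show ?thesis unfolding integral_ljac_poly_mult by (rule flux_basis_lower)
  next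
    case 2
    then have "degree (flux_basis n) < m" using flux_basis_degree[of n] by simp
    then have "(LINT x|jac (b - 1) (a - 1). poly (flux_basis n) x * poly (flux_basis m) x) = 0" by (rule flux_basis_lower)
    then show ?thesis unfolding integral_ljac_poly_mult by (simp add: mult.commute)
  qed
qed

lemma flux_basis_norm_pos: "0 < (LINT x|ljac (b - 1) (a - 1). (poly (flux_basis n) x)\<^sup>2)"
proof -
  have "flux_basis n \<noteq> 0" using flux_basis_coeff[of n] by auto
  from integral_jac_poly_square_pos[OF exponents' this] show ?thesis
    by (simp add: integral_ljac(1))
qed

lemma flux_basis_norm_lower_bound:
  "\<exists>\<kappa>>0. \<forall>n. \<kappa> * jacobi_norm_sq n \<le> (LINT x|ljac (b - 1) (a - 1). (poly (flux_basis (Suc n)) x)\<^sup>2)"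
proof -
  interpret swap: frac_jacobi b a "1 - r" by (rule swapped)
  define \<kappa> where "\<kappa> = kernel_mass * (\<alpha> - 1) * (swap.kernel_mass * (\<alpha> - 1)) / (Gamma (2 - \<alpha>))\<^sup>2"
  have "0 < \<kappa>" unfolding \<kappa>_def using kernel_mass(1) swap.kernel_mass(1) ab Gamma_pos
    by (intro divide_pos_pos mult_pos_pos zero_less_power) auto
  moreover have "\<kappa> * jacobi_norm_sq n \<le> (LINT x|ljac (b - 1) (a - 1). (poly (flux_basis (Suc n)) x)\<^sup>2)" for n
  proof -
    have "(LINT x|ljac (b - 1) (a - 1). (poly (flux_basis (Suc n)) x)\<^sup>2) =
        (LINT x|jac (b - 1) (a - 1). (poly (flux_basis (Suc n)) x)\<^sup>2)"
      by (rule integral_ljac) measurable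
    also have "\<dots> = (LINT x|jac (b - 1) (a - 1). (poly (flux_poly n) x)\<^sup>2) / (Gamma (2 - \<alpha>))\<^sup>2"
      by (simp add: power_divide)
    finally show ?thesis
      using flux_poly_norm_lower_bound[of n] Gamma_pos by (simp add: \<kappa>_def divide_right_mono)
  qed
  ultimately show ?thesis by blast
qed

lemma jacobi_orthogonal_system: "orthogonal_system (ljac a b) (\<lambda>n. poly (jacobi_poly n a b))"
  unfolding orthogonal_system_def
proof (intro conjI allI impI)
  show "poly (jacobi_poly n a b) \<in> sq_int (ljac a b)" for n
    using exponents by (intro poly_sq_int_ljac)
  fix m n :: nat assume "m \<noteq> n"
  then consider "n < m" | "m < n" by linarith
  then show "(LINT x|ljac a b. poly (jacobi_poly m a b) x * poly (jacobi_poly n a b) x) = 0"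
  proof cases
    case 1
    then have "degree (jacobi_poly n a b) < m" using jacobi_poly_degree[of n a b] by simp
    then show ?thesis unfolding integral_ljac_poly_mult using exponents by (simp add: jacobi_poly_orthogonal)
  next
    case 2
    then have "degree (jacobi_poly m a b) < n" using jacobi_poly_degree[of m a b] by simp
    then have "(LINT x|jac a b. poly (jacobi_poly n a b) x * poly (jacobi_poly m a b) x) = 0"
      using exponents by (simp add: jacobi_poly_orthogonal)
    then show ?thesis unfolding integral_ljac_poly_mult by (simp add: mult.commute)
  qed
qed

lemma has_frac_flux_iff:
  "has_frac_flux \<alpha> b r c g \<longleftrightarrow> g \<in> sq_int (ljac (b - 1) (a - 1)) \<and>
    (\<lambda>N. LINT x|ljac (b - 1) (a - 1). ((\<Sum>j\<le>N. c j * poly (flux_basis (Suc j)) x) - g x)\<^sup>2) \<longlonglongrightarrow> 0"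
proof -
  let ?M = "ljac (b - 1) (a - 1)"
  have sq: "(\<lambda>x. \<Sum>j\<le>N. c j * poly (flux_basis (Suc j)) x) \<in> sq_int ?M" for N
    using exponents' by (intro sq_int_sum sq_int_cmult poly_sq_int_ljac)
  have eq: "frac_flux \<alpha> r (truncation \<alpha> b c N) x = (\<Sum>j\<le>N. c j * poly (flux_basis (Suc j)) x)"
    if "x \<in> space ?M" for N x
    using that by (simp add: frac_flux_truncation)
  have "frac_flux \<alpha> r (truncation \<alpha> b c N) \<in> sq_int ?M" for N
    using sq[of N] sq_int_cong[of ?M "frac_flux \<alpha> r (truncation \<alpha> b c N)"
        "\<lambda>x. \<Sum>j\<le>N. c j * poly (flux_basis (Suc j)) x", OF eq] by (simp del: flux_basis.simps)
  moreover have "(LINT x|?M. (frac_flux \<alpha> r (truncation \<alpha> b c N) x - g x)\<^sup>2) =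
      (LINT x|?M. ((\<Sum>j\<le>N. c j * poly (flux_basis (Suc j)) x) - g x)\<^sup>2)" for N
    by (intro Bochner_Integration.integral_cong refl) (simp only: eq[of _ N])
  ultimately show ?thesis
    unfolding has_frac_flux_def tendsto_L2w_weight by simp
qed

text \<open>
Pass to the limit in the inner products with the orthogonal system; the constant \<open>1\<close> is orthogonal to all fluxes.
\<close>

lemma flux_coefficients:
  assumes "has_frac_flux \<alpha> b r c g"
  shows "(LINT x|ljac (b - 1) (a - 1). g x) = 0"
    and "c n = (LINT x|ljac (b - 1) (a - 1). g x * poly (flux_basis (Suc n)) x) /
      (LINT x|ljac (b - 1) (a - 1). (poly (flux_basis (Suc n)) x)\<^sup>2)"
proof -
  let ?M = "ljac (b - 1) (a - 1)"
  let ?S = "\<lambda>N x. \<Sum>j\<le>N. c j * poly (flux_basis (Suc j)) x"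
  have g: "g \<in> sq_int ?M" and lim: "(\<lambda>N. LINT x|?M. (?S N x - g x)\<^sup>2) \<longlonglongrightarrow> 0"
    using assms unfolding has_frac_flux_iff by auto
  have sq: "?S N \<in> sq_int ?M" for N
    using exponents' by (intro sq_int_sum sq_int_cmult poly_sq_int_ljac)
  have S: "?S N x = (\<Sum>i\<in>Suc ` {..N}. c (i - 1) * poly (flux_basis i) x)" for N x
    by (subst sum.reindex) auto
  have inner: "(LINT x|?M. ?S N x * poly (flux_basis m) x) =
      (if m \<in> Suc ` {..N} then c (m - 1) * (LINT x|?M. (poly (flux_basis m) x)\<^sup>2) else 0)" for N m
    unfolding S by (rule orthogonal_system_sum_inner[OF flux_basis_orthogonal]) simp
  have limit: "(\<lambda>N. LINT x|?M. ?S N x * poly (flux_basis m) x) \<longlonglongrightarrow> (LINT x|?M. g x * poly (flux_basis m) x)" for m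
    using exponents' by (intro L2_limit_inner sq g lim poly_sq_int_ljac)
  have "(\<lambda>N. LINT x|?M. ?S N x * poly (flux_basis 0) x) \<longlonglongrightarrow> 0"
    unfolding inner by simp
  from LIMSEQ_unique[OF limit this] show "(LINT x|?M. g x) = 0" by simp
  have "(\<lambda>N. LINT x|?M. ?S N x * poly (flux_basis (Suc n)) x) \<longlonglongrightarrow> c n * (LINT x|?M. (poly (flux_basis (Suc n)) x)\<^sup>2)"
    unfolding inner by (intro tendsto_eventually eventually_sequentiallyI[of n]) auto
  from LIMSEQ_unique[OF limit this] show "c n = (LINT x|?M. g x * poly (flux_basis (Suc n)) x) /
      (LINT x|?M. (poly (flux_basis (Suc n)) x)\<^sup>2)"
    using flux_basis_norm_pos[of "Suc n"] by (simp del: flux_basis.simps)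
qed

text \<open>
Expand \<open>g\<close> in \<open>flux_basis\<close>: the vanishing mean removes the constant term, and the remaining partial sums are the fluxes
of truncations. Bessel's inequality and \<open>flux_basis_norm_lower_bound\<close> give the summability that \<open>u\<close> needs.
\<close>

lemma flux_exists:
  assumes g: "g \<in> sq_int (ljac (b - 1) (a - 1))" and mean: "(LINT x|ljac (b - 1) (a - 1). g x) = 0"
  obtains c where "has_frac_flux \<alpha> b r c g" "summable (\<lambda>n. (c n)\<^sup>2 * jacobi_norm_sq n)"
proof -
  let ?M = "ljac (b - 1) (a - 1)"
  define d where "d n = (LINT x|?M. g x * poly (flux_basis n) x) / (LINT x|?M. (poly (flux_basis n) x)\<^sup>2)" for n
  have d0: "d 0 = 0" using mean by (simp add: d_def)
  have compl: "AE x in ?M. \<phi> x = 0"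
    if "\<phi> \<in> sq_int ?M" "\<And>n. (LINT x|?M. \<phi> x * poly (flux_basis n) x) = 0" for \<phi>
    by (rule poly_complete_ljac[OF exponents' that(1)
          integral_eq_0_by_degree[OF exponents' that(1) flux_basis_degree flux_basis_coeff that(2)]])
  have "(\<lambda>N. LINT x|?M. ((\<Sum>j\<le>N. d j * poly (flux_basis j) x) - g x)\<^sup>2) \<longlonglongrightarrow> 0"
    by (rule orthogonal_expansion[OF flux_basis_orthogonal flux_basis_norm_pos compl g d_def])
  then have "(\<lambda>N. LINT x|?M. ((\<Sum>j\<le>Suc N. d j * poly (flux_basis j) x) - g x)\<^sup>2) \<longlonglongrightarrow> 0"
    by (rule LIMSEQ_Suc)
  then have flux: "has_frac_flux \<alpha> b r (\<lambda>n. d (Suc n)) g"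
    unfolding has_frac_flux_iff sum.atMost_Suc_shift d0 using g by simp
  obtain \<kappa> where \<kappa>: "0 < \<kappa>" "\<And>n. \<kappa> * jacobi_norm_sq n \<le> (LINT x|?M. (poly (flux_basis (Suc n)) x)\<^sup>2)"
    using flux_basis_norm_lower_bound by blast
  have "summable (\<lambda>n. (d n)\<^sup>2 * (LINT x|?M. (poly (flux_basis n) x)\<^sup>2))"
    by (rule Bessel_inequality[OF flux_basis_orthogonal flux_basis_norm_pos g d_def])
  then have "summable (\<lambda>n. (d (Suc n))\<^sup>2 * (LINT x|?M. (poly (flux_basis (Suc n)) x)\<^sup>2))"
    by (subst summable_Suc_iff)
  then have "summable (\<lambda>n. \<kappa> * ((d (Suc n))\<^sup>2 * jacobi_norm_sq n))"
  proof (rule summable_comparison_test'[where N = 0])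
    fix n :: nat
    have "(d (Suc n))\<^sup>2 * (\<kappa> * jacobi_norm_sq n) \<le> (d (Suc n))\<^sup>2 * (LINT x|?M. (poly (flux_basis (Suc n)) x)\<^sup>2)"
      by (intro mult_left_mono \<kappa>) simp
    then show "norm (\<kappa> * ((d (Suc n))\<^sup>2 * jacobi_norm_sq n)) \<le> (d (Suc n))\<^sup>2 * (LINT x|?M. (poly (flux_basis (Suc n)) x)\<^sup>2)"
      using \<kappa>(1) jacobi_norm_sq_pos[of n] by (simp add: abs_mult mult_ac del: flux_basis.simps)
  qed
  then have "summable (\<lambda>n. (d (Suc n))\<^sup>2 * jacobi_norm_sq n)" using \<kappa>(1) by (simp add: summable_cmult_iff)
  with flux show ?thesis by (rule that)
qed

text \<open>
Multiplication by \<open>weight a b\<close> is an isometry onto the trial space, so that convergence there is convergence of the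
polynomial factors.
\<close>

lemma weight_times_square:
  assumes "x \<in> {0<..<1}"
  shows "weight (- a) (- b) x * (weight a b x * y)\<^sup>2 = weight a b x * y\<^sup>2"
  using assms by (simp add: weight_def powr_minus power2_eq_square field_simps)

lemma sq_int_weight_mult:
  assumes v: "v \<in> borel_measurable unit_measure"
  shows "(\<lambda>x. weight a b x * v x) \<in> sq_int (ljac (- a) (- b)) \<longleftrightarrow> v \<in> sq_int (ljac a b)"
    and "(LINT x|ljac (- a) (- b). (weight a b x * v x)\<^sup>2) = (LINT x|ljac a b. (v x)\<^sup>2)"
proof -
  have m: "(\<lambda>x. weight a b x * v x) \<in> borel_measurable unit_measure"
    using v unit_measure_borel[OF weight_borel] by (rule borel_measurable_times[rotated])
  have m2: "(\<lambda>x. (v x)\<^sup>2) \<in> borel_measurable unit_measure" "(\<lambda>x. (weight a b x * v x)\<^sup>2) \<in> borel_measurable unit_measure"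
    using v m by (auto intro: borel_measurable_power)
  have "integrable unit_measure (\<lambda>x. weight (- a) (- b) x * (weight a b x * v x)\<^sup>2) \<longleftrightarrow>
      integrable unit_measure (\<lambda>x. weight a b x * (v x)\<^sup>2)"
    by (intro Bochner_Integration.integrable_cong refl) (simp add: weight_times_square)
  then show "(\<lambda>x. weight a b x * v x) \<in> sq_int (ljac (- a) (- b)) \<longleftrightarrow> v \<in> sq_int (ljac a b)"
    using m v m2 by (simp add: sq_int_def measurable_ljac integrable_ljac_iff)
  show "(LINT x|ljac (- a) (- b). (weight a b x * v x)\<^sup>2) = (LINT x|ljac a b. (v x)\<^sup>2)"
    unfolding integral_ljac_weight[OF m2(1)] integral_ljac_weight[OF m2(2)]
    by (intro Bochner_Integration.integral_cong refl) (simp add: weight_times_square)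
qed

lemma truncation_sq_int: "truncation \<alpha> b c N \<in> sq_int (ljac (- a) (- b))"
proof -
  have eq: "truncation \<alpha> b c N = (\<lambda>x. weight a b x * poly (\<Sum>j\<le>N. smult (c j) (jacobi_poly j a b)) x)"
    by (rule ext) (rule truncation_eq)
  show ?thesis
    unfolding eq using exponents by (subst sq_int_weight_mult(1)) (auto intro: poly_sq_int_ljac unit_measure_borel)
qed

lemma jacobi_expansion_exists:
  assumes "summable (\<lambda>n. (c n)\<^sup>2 * jacobi_norm_sq n)"
  obtains u where "jacobi_expansion \<alpha> b u c"
proof -
  let ?G = "\<lambda>n. poly (jacobi_poly n a b)"
  have "jacobi_norm_sq n = (LINT x|ljac a b. (?G n x)\<^sup>2)" for n
    unfolding jacobi_norm_sq_def by (rule integral_ljac(1)[symmetric]) measurable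
  then obtain v where v: "v \<in> sq_int (ljac a b)"
    and lim: "(\<lambda>N. LINT x|ljac a b. ((\<Sum>j\<le>N. c j * ?G j x) - v x)\<^sup>2) \<longlonglongrightarrow> 0"
    using Riesz_Fischer[OF jacobi_orthogonal_system, of c] assms by auto
  have vm: "v \<in> borel_measurable unit_measure" using sq_int_measurable[OF v] by (simp add: measurable_ljac)
  have "jacobi_expansion \<alpha> b (\<lambda>x. weight a b x * v x) c"
  proof -
    have "(LINT x|ljac (- a) (- b). (truncation \<alpha> b c N x - weight a b x * v x)\<^sup>2) =
        (LINT x|ljac a b. ((\<Sum>j\<le>N. c j * ?G j x) - v x)\<^sup>2)" for N
    proof -
      have m: "(\<lambda>x. (\<Sum>j\<le>N. c j * ?G j x) - v x) \<in> borel_measurable unit_measure"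
        by (intro borel_measurable_diff vm unit_measure_borel) measurable
      have "(LINT x|ljac (- a) (- b). (truncation \<alpha> b c N x - weight a b x * v x)\<^sup>2) =
          (LINT x|ljac (- a) (- b). (weight a b x * ((\<Sum>j\<le>N. c j * ?G j x) - v x))\<^sup>2)"
        by (intro Bochner_Integration.integral_cong refl) (simp add: truncation_eq poly_sum right_diff_distrib)
      then show ?thesis by (simp add: sq_int_weight_mult(2)[OF m])
    qed
    moreover have "weight (- (\<alpha> - b)) (- b) = weight (- a) (- b)" by simp
    ultimately show ?thesis
      unfolding jacobi_expansion_def
      using lim v truncation_sq_int by (simp add: tendsto_L2w_weight sq_int_weight_mult(1)[OF vm])
  qed
  then show ?thesis by (rule that)
qed

theorem unique_solution:
  assumes f: "f \<in> L2w (weight b a)"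
    and Km: "K \<in> borel_measurable unit_measure"
    and K: "0 < Km" "\<forall>x\<in>{0<..<1}. Km \<le> K x \<and> K x \<le> KM"
  shows "\<exists>u. is_solution \<alpha> b r K f u \<and>
    (\<forall>v. is_solution \<alpha> b r K f v \<longrightarrow> (AE x in unit_measure. v x = u x))"
proof -
  let ?M = "ljac (b - 1) (a - 1)"
  define F where "F = primitive f"
  have F: "F \<in> sq_int ?M"
    unfolding F_def using f a b by (intro primitive_sq_int) (auto simp: L2w_weight)
  have KM: "K \<in> borel_measurable ?M" using Km by (simp add: measurable_ljac)
  have one: "(\<lambda>x. 1) \<in> sq_int ?M" 
  proof -
    have "poly 1 = (\<lambda>x. 1 :: real)" by (simp add: fun_eq_iff)
    then show ?thesis using poly_sq_int_ljac[OF exponents', of 1] by simp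
  qed
  have div_sq: "(\<lambda>x. h x / K x) \<in> sq_int ?M" if h: "h \<in> sq_int ?M" for h
  proof -
    have m: "(\<lambda>x. h x / K x) \<in> borel_measurable ?M"
      using sq_int_measurable[OF h] KM by (rule borel_measurable_divide)
    have "integrable ?M (\<lambda>x. (h x / K x)\<^sup>2)"
    proof (rule Bochner_Integration.integrable_bound)
      show "integrable ?M (\<lambda>x. (h x)\<^sup>2 / Km\<^sup>2)" using sq_int_integrable[OF h] by simp
      show "(\<lambda>x. (h x / K x)\<^sup>2) \<in> borel_measurable ?M" using m by (rule borel_measurable_power)
      show "AE x in ?M. norm ((h x / K x)\<^sup>2) \<le> norm ((h x)\<^sup>2 / Km\<^sup>2)"
      proof (rule AE_I2)
        fix x assume "x \<in> space ?M"
        then have "Km \<le> K x" using K by simp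
        then have "Km\<^sup>2 \<le> (K x)\<^sup>2" using K(1) by (intro power_mono) auto
        then show "norm ((h x / K x)\<^sup>2) \<le> norm ((h x)\<^sup>2 / Km\<^sup>2)"
          using K(1) by (simp add: power_divide frac_le)
      qed
    qed
    with m show ?thesis by (simp add: sq_int_def)
  qed
  have FK: "(\<lambda>x. F x / K x) \<in> sq_int ?M" and oneK: "(\<lambda>x. 1 / K x) \<in> sq_int ?M"
    using div_sq[OF F] div_sq[OF one] by auto
  have intFK: "integrable ?M (\<lambda>x. F x / K x)" and intK: "integrable ?M (\<lambda>x. 1 / K x)"
    using sq_int_mult[OF FK one] sq_int_mult[OF oneK one] by auto
  define W where "W = (LINT x|?M. 1 / K x)"
  have W: "0 < W"
  proof -
    have "W \<noteq> 0"
    proof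
      assume "W = 0"
      then have "AE x in ?M. 1 / K x = 0"
        unfolding W_def using K by (subst (asm) integral_nonneg_eq_0_iff_AE[OF intK]) (auto intro!: AE_I2 order_trans[OF less_imp_le[OF K(1)]])
      then have "AE x in ?M. False"
        by (rule AE_mp) (use K in \<open>force intro!: AE_I2\<close>)
      then have "AE x in lborel. x \<notin> {0<..<(1::real)}"
        unfolding AE_ljac AE_unit_lborel by simp
      then have "emeasure lborel {0<..<(1::real)} = 0"
        by (subst (asm) AE_iff_measurable[where N = "{0<..<1}"]) auto
      then show False by simp
    qed
    moreover have "0 \<le> W"
      unfolding W_def using K by (intro integral_nonneg_AE AE_I2) (auto intro: order_trans[OF less_imp_le[OF K(1)]])
    ultimately show ?thesis by simp
  qed
  define gA where "gA A x = 1 / K x * F x - A / K x" for A x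
  have gA_eq: "gA A = (\<lambda>x. F x / K x - A * (1 / K x))" for A by (simp add: gA_def fun_eq_iff)
  have gA_sq: "gA A \<in> sq_int ?M" for A
    unfolding gA_eq by (intro sq_int_diff sq_int_cmult FK oneK)
  have gA_int: "(LINT x|?M. gA A x) = (LINT x|?M. F x / K x) - A * W" for A
    unfolding gA_eq W_def using intFK intK by (simp only: Bochner_Integration.integral_diff integrable_mult_right integral_mult_right_zero)
  \<comment> \<open>the unique constant for which \<open>gA A\<close> has weighted mean \<open>0\<close>\<close>
  define A where "A = (LINT x|?M. F x / K x) / W"
  have "(LINT x|?M. gA A x) = 0" using W by (simp add: gA_int A_def)
  then obtain c where c: "has_frac_flux \<alpha> b r c (gA A)" "summable (\<lambda>n. (c n)\<^sup>2 * jacobi_norm_sq n)"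
    using flux_exists[OF gA_sq] by blast
  obtain u where u: "jacobi_expansion \<alpha> b u c" using jacobi_expansion_exists[OF c(2)] .
  have wab: "weight (- (\<alpha> - b)) (- b) = weight (- a) (- b)" by simp
  have exp_iff: "jacobi_expansion \<alpha> b v d \<longleftrightarrow> v \<in> sq_int (ljac (- a) (- b)) \<and>
      (\<lambda>N. LINT x|ljac (- a) (- b). (truncation \<alpha> b d N x - v x)\<^sup>2) \<longlonglongrightarrow> 0" for v d
    unfolding jacobi_expansion_def wab tendsto_L2w_weight using truncation_sq_int by auto
  have bc: "truncation \<alpha> b d N 0 = 0" "truncation \<alpha> b d N 1 = 0" for d N
    using a b by (simp_all add: truncation_eq weight_def)
  have "is_solution \<alpha> b r K f u"
    unfolding is_solution_def
  proof (intro conjI exI[of _ c] exI[of _ "gA A"] exI[of _ A] allI)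
    show "u \<in> L2w (weight (- (\<alpha> - b)) (- b))"
      unfolding wab L2w_weight using u by (simp add: exp_iff)
    show "AE x in unit_measure. gA A x = 1 / K x * primitive f x - A / K x"
      by (simp add: gA_def F_def)
  qed (use u c bc in auto)
  moreover have "AE x in unit_measure. v x = u x" if v: "is_solution \<alpha> b r K f v" for v
  proof -
    from v obtain c' g' A' where v': "jacobi_expansion \<alpha> b v c'" "has_frac_flux \<alpha> b r c' g'"
      "AE x in unit_measure. g' x = 1 / K x * primitive f x - A' / K x"
      unfolding is_solution_def by blast
    have g': "g' \<in> sq_int ?M" using v'(2) by (simp add: has_frac_flux_iff)
    have ae: "AE x in ?M. g' x = gA A' x" using v'(3) by (simp add: AE_ljac gA_def F_def)
    have cong: "(LINT x|?M. g' x * poly P x) = (LINT x|?M. gA A' x * poly P x)" for P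
      using sq_int_measurable[OF g'] sq_int_measurable[OF gA_sq] ljac_borel[OF poly_borel] ae
      by (intro integral_cong_AE borel_measurable_times) (auto elim: eventually_mono)
    have "(LINT x|?M. gA A' x) = 0" using cong[of 1] flux_coefficients(1)[OF v'(2)] by simp
    then have "A' = A" using W by (simp add: gA_int A_def field_simps)
    then have "c' n = c n" for n
      unfolding flux_coefficients(2)[OF v'(2)] flux_coefficients(2)[OF c(1)] cong by simp
    then have "c' = c" by (rule ext)
    then have "AE x in ljac (- a) (- b). v x = u x"
      using u v'(1) truncation_sq_int unfolding exp_iff
      by (intro L2_limit_unique[where h = "truncation \<alpha> b c"]) auto
    then show ?thesis by (simp add: AE_ljac)
  qed
  ultimately show ?thesis by blast
qed

end

theorem corollary3p1:
  fixes \<alpha> \<beta> r Km KM :: real and K f :: "real \<Rightarrow> real"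
  assumes "1 < \<alpha>" and "\<alpha> < 2"
    and "0 \<le> r" and "r \<le> 1"
    and "\<alpha> - 1 \<le> \<beta>" and "\<beta> \<le> 1"
    and "r = sin (pi * \<beta>) / (sin (pi * (\<alpha> - \<beta>)) + sin (pi * \<beta>))"
    and "f \<in> L2w (weight \<beta> (\<alpha> - \<beta>))"
    and "K \<in> borel_measurable (lebesgue_on {0<..<1})"
    and "0 < Km" and "\<forall>x\<in>{0<..<1}. Km \<le> K x \<and> K x \<le> KM"
  shows "\<exists>u. is_solution \<alpha> \<beta> r K f u \<and>
           (\<forall>v. is_solution \<alpha> \<beta> r K f v \<longrightarrow> (AE x in lebesgue_on {0<..<1}. v x = u x))"
proof -
  interpret frac_jacobi "\<alpha> - \<beta>" \<beta> r
    using assms by unfold_locales auto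
  have "\<alpha> - \<beta> + \<beta> = \<alpha>" by simp
  then show ?thesis using unique_solution[OF assms(8-11)] by (simp only:)
qed

end
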